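(* Let $P$ be a polyomino of width $w$ and height $h$ with $N$ tiles for which the bounding box has already been created, with a single robot in the model described in the context. Counting the number of tiles of $P$ (i.e., producing a binary counter whose value is $N$) can be done in $\mathcal{O}(\max(w,h)\log N + N\min(w,h))$ steps using $\mathcal{O}(\max(w,h))$ additional space and $\mathcal{O}(\log N)$ auxiliary tiles.
   Context: Model: A single robot acts as a deterministic finite automaton (constant memory) on the infinite grid graph with vertex set $\mathbb{Z}^2$ and edges between nodes at unit distance; nodes are called pixels. Each pixel is either empty or occupied by a tile. In each step the robot, based on its state and the state of its current pixel, applies a transition function $\delta(p,b)=(q,c,d)$: it changes to state $q$, sets the current pixel to state $c$ (so it may create or remove a tile), and moves one step in direction $d\in\{\text{up},\text{down},\text{left},\text{right}\}$. A diagonal pair is a pair of pixels $(x_1,y_1),(x_2,y_2)$ with $|x_1-x_2|=|y_1-y_2|=1$. A polyomino is a connected set $P\subset\mathbb{Z}^2$ of tiles such that for every diagonal pair $p_1,p_2\in P$ there is a tile of $P$ adjacent to both. Width $w$ and height $h$ are the dimensions of the smallest axis-parallel rectangle containing $P$. A bounding box of $P$ is a closed zig-zag ring of auxiliary tiles (inner and outer lane, consecutive tiles touching only at corners) enclosing $P$ without touching it. A binary counter storing an $n$-bit number is a line of $n$ base tiles, next to each of which there is either a tile (bit 1) or an empty pixel (bit 0). Complexity measures: steps = total number of robot moves; additional space = number of visited pixels outside the bounding rectangle of the input polyomino; auxiliary tiles = maximum number of tiles on the grid minus the number of tiles of the input polyomino (here counted in addition to the already built bounding box).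
   Formalization: The bounding box is assumed to lie within an arbitrary constant distance k of P's bounding rectangle (the O-constants may depend on k, the robot does not; a far box makes the bounds false); the robot starts on any box tile; the O(log N) tile bound is claimed for N ≥ 2. *)

theory Defs
  imports Complex_Main
begin

section \<open>The grid\<close>

type_synonym pixel = "int \<times> int"

definition adjacent :: "pixel \<Rightarrow> pixel \<Rightarrow> bool" where
  "adjacent p q \<longleftrightarrow> \<bar>fst p - fst q\<bar> + \<bar>snd p - snd q\<bar> = 1"

definition diagonal_pair :: "pixel \<Rightarrow> pixel \<Rightarrow> bool" where
  "diagonal_pair p q \<longleftrightarrow> \<bar>fst p - fst q\<bar> = 1 \<and> \<bar>snd p - snd q\<bar> = 1"

text \<open>Pixels, regarded as closed unit squares, that meet in an edge, in a corner, or coincide.\<close>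

definition touching :: "pixel \<Rightarrow> pixel \<Rightarrow> bool" where
  "touching p q \<longleftrightarrow> \<bar>fst p - fst q\<bar> \<le> 1 \<and> \<bar>snd p - snd q\<bar> \<le> 1"

definition linked_in :: "pixel set \<Rightarrow> (pixel \<times> pixel) set" where
  "linked_in S = {(p, q). p \<in> S \<and> q \<in> S \<and> adjacent p q}\<^sup>*"

definition polyomino :: "pixel set \<Rightarrow> bool" where
  "polyomino P \<longleftrightarrow>
     finite P \<and> P \<noteq> {} \<and>
     (\<forall>p\<in>P. \<forall>q\<in>P. (p, q) \<in> linked_in P) \<and>
     (\<forall>p\<in>P. \<forall>q\<in>P. diagonal_pair p q \<longrightarrow> (\<exists>r\<in>P. adjacent r p \<and> adjacent r q))"

definition xmin :: "pixel set \<Rightarrow> int" where "xmin P = Min (fst ` P)"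
definition xmax :: "pixel set \<Rightarrow> int" where "xmax P = Max (fst ` P)"
definition ymin :: "pixel set \<Rightarrow> int" where "ymin P = Min (snd ` P)"
definition ymax :: "pixel set \<Rightarrow> int" where "ymax P = Max (snd ` P)"

definition bounding_rectangle :: "pixel set \<Rightarrow> pixel set" where
  "bounding_rectangle P = {xmin P..xmax P} \<times> {ymin P..ymax P}"

definition width :: "pixel set \<Rightarrow> nat" where
  "width P = nat (xmax P - xmin P + 1)"

definition height :: "pixel set \<Rightarrow> nat" where
  "height P = nat (ymax P - ymin P + 1)"


section \<open>Bounding boxes\<close>

definition lane :: "int \<Rightarrow> int \<Rightarrow> int \<Rightarrow> int \<Rightarrow> pixel set" where
  "lane a b c d = {(x, y). a \<le> x \<and> x \<le> b \<and> c \<le> y \<and> y \<le> d \<and>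
                           (x = a \<or> x = b \<or> y = c \<or> y = d)}"

text \<open>
  A cyclic sequence of distinct tiles in which consecutive tiles form a diagonal pair, that is,
  touch in a corner only. A diagonal step preserves the parity of \<open>x + y\<close>, so no two tiles of
  the ring share an edge.
\<close>

definition closed_zigzag :: "pixel set \<Rightarrow> bool" where
  "closed_zigzag B \<longleftrightarrow>
     (\<exists>ts. set ts = B \<and> distinct ts \<and> 3 \<le> length ts \<and>
           (\<forall>i<length ts. diagonal_pair (ts ! i) (ts ! ((i + 1) mod length ts))))"

text \<open>From \<open>P\<close>, only finitely many pixels can be reached along grid edges avoiding \<open>B\<close>.\<close>

definition encloses :: "pixel set \<Rightarrow> pixel set \<Rightarrow> bool" where
  "encloses B P \<longleftrightarrow> (\<forall>p\<in>P. p \<notin> B \<and> finite {q. (p, q) \<in> linked_in (- B)})"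

text \<open>
  The ring runs in two neighbouring lanes around a rectangle with \<open>P\<close> in its interior. The number
  \<open>k\<close> bounds the distance of the inner lane from the bounding rectangle of \<open>P\<close>; without such a
  bound, the size of the box would be unrelated to the width and height of \<open>P\<close>.
\<close>

definition bounding_box :: "nat \<Rightarrow> pixel set \<Rightarrow> pixel set \<Rightarrow> bool" where
  "bounding_box k P B \<longleftrightarrow>
     closed_zigzag B \<and> encloses B P \<and> (\<forall>p\<in>P. \<forall>q\<in>B. \<not> touching p q) \<and>
     (\<exists>a b c d.
        a < xmin P \<and> xmin P - a \<le> int k \<and> xmax P < b \<and> b - xmax P \<le> int k \<and>
        c < ymin P \<and> ymin P - c \<le> int k \<and> ymax P < d \<and> d - ymax P \<le> int k \<and>
        B \<subseteq> lane a b c d \<union> lane (a - 1) (b + 1) (c - 1) (d + 1))"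


section \<open>Robots\<close>

datatype dir = Up | Down | Left | Right

fun move :: "dir \<Rightarrow> pixel \<Rightarrow> pixel" where
  "move Up (x, y) = (x, y + 1)"
| "move Down (x, y) = (x, y - 1)"
| "move Left (x, y) = (x - 1, y)"
| "move Right (x, y) = (x + 1, y)"

record robot =
  states :: "nat set"
  start :: nat
  halting :: "nat set"
  delta :: "nat \<Rightarrow> bool \<Rightarrow> nat \<times> bool \<times> dir"

definition finite_automaton :: "robot \<Rightarrow> bool" where
  "finite_automaton R \<longleftrightarrow>
     finite (states R) \<and> start R \<in> states R \<and> halting R \<subseteq> states R \<and>
     (\<forall>p\<in>states R. \<forall>b. fst (delta R p b) \<in> states R)"

record config =
  state :: nat
  pos :: pixel
  tiles :: "pixel set"

definition step :: "robot \<Rightarrow> config \<Rightarrow> config" where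
  "step R s =
     (let (q, c, d) = delta R (state s) (pos s \<in> tiles s)
      in \<lparr>state = q, pos = move d (pos s),
          tiles = (if c then insert (pos s) (tiles s) else tiles s - {pos s})\<rparr>)"

definition initial :: "robot \<Rightarrow> pixel \<Rightarrow> pixel set \<Rightarrow> config" where
  "initial R p T = \<lparr>state = start R, pos = p, tiles = T\<rparr>"

definition run :: "robot \<Rightarrow> config \<Rightarrow> nat \<Rightarrow> config" where
  "run R s t = (step R ^^ t) s"

definition halts_at :: "robot \<Rightarrow> config \<Rightarrow> nat \<Rightarrow> bool" where
  "halts_at R s t \<longleftrightarrow>
     state (run R s t) \<in> halting R \<and> (\<forall>i<t. state (run R s i) \<notin> halting R)"

definition visited :: "robot \<Rightarrow> config \<Rightarrow> nat \<Rightarrow> pixel set" where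
  "visited R s t = (\<lambda>i. pos (run R s i)) ` {..t}"

definition additional_space :: "robot \<Rightarrow> config \<Rightarrow> nat \<Rightarrow> pixel set \<Rightarrow> nat" where
  "additional_space R s t P = card (visited R s t - bounding_rectangle P)"

definition max_tiles :: "robot \<Rightarrow> config \<Rightarrow> nat \<Rightarrow> nat" where
  "max_tiles R s t = Max ((\<lambda>i. card (tiles (run R s i))) ` {..t})"


section \<open>Binary counters\<close>

definition perpendicular :: "dir \<Rightarrow> dir \<Rightarrow> bool" where
  "perpendicular d e \<longleftrightarrow> (d \<in> {Up, Down} \<longleftrightarrow> e \<in> {Left, Right})"

text \<open>
  The tile set \<open>T\<close> contains a counter with \<open>n\<close> bits whose least significant base tile is at \<open>p\<close>.
  The base tiles run from \<open>p\<close> in direction \<open>d\<close> and form a maximal line of tiles in that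
  direction; the bits are on the side \<open>e\<close> of the line.
\<close>

definition binary_counter ::
  "pixel set \<Rightarrow> pixel \<Rightarrow> dir \<Rightarrow> dir \<Rightarrow> nat \<Rightarrow> nat \<Rightarrow> bool" where
  "binary_counter T p d e n v \<longleftrightarrow>
     perpendicular d e \<and>
     (\<forall>q. move d q = p \<longrightarrow> q \<notin> T) \<and>
     (\<forall>i<n. (move d ^^ i) p \<in> T) \<and>
     (move d ^^ n) p \<notin> T \<and>
     v = (\<Sum>i<n. if move e ((move d ^^ i) p) \<in> T then 2 ^ i else 0)"

end

theory Submission
  imports Defs
begin

text \<open>
  The robot may destroy both the polyomino and the box, so it counts as follows. It first walks
  along the ring to the lower left corner and from there on a staircase inside the box until it
  meets the ring again, which tells it the longer side up to a constant; if necessary it exchanges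
  the roles of the two axes, so that the box is essentially at least as wide as high. It then
  pushes the tiles of every column down to a heap above the lower side of the ring. This takes
  \<open>O(h)\<close> steps per tile, hence \<open>O(N h)\<close> steps, and the heaps represent \<open>N\<close> in unary.

  Finally it repeatedly walks over the heaps from left to right and removes every second tile,
  where the parity is carried from each heap to the next one. A pass replaces the
  number \<open>n\<close> of tiles in the heaps by \<open>n div 2\<close>, and the final parity is the next binary digit,
  which is appended to a counter that never moves. A pass takes \<open>O(w + n h)\<close> steps; since \<open>n\<close>
  is halved each time, all passes together take \<open>O(w log N + N h)\<close> steps.

  A tile is recognised as a tile of the ring by looking to its right: no tile is adjacent to
  two diagonal neighbours of the ring, but some tile is adjacent to two diagonal neighbours of the
  polyomino.
\<close>

section \<open>Machines with resource bounds\<close>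

text \<open>The budget \<open>N min(w,h)\<close> leaves no room for a walk along the longer side per
  tile. A tile therefore travels only inside its own column, and \<open>N\<close> becomes binary
  later, when one walk along the longer side yields a whole digit. Sweeping an almost empty column
  still takes \<open>O(h)\<close> steps; this is harmless because a connected polyomino meets every
  column of its bounding rectangle, whence \<open>w \<le> N\<close>, and for fixed \<open>k\<close>
  the box adds only boundedly many columns.

  The lower side of the ring zigzags between two rows. In each swept column its tile is put into the
  lower of the two, which costs no tile. It then is a floor under the heap, even an empty one, and
  the row below it is a free corridor. In the first column after the polyomino the floor is removed;
  this hole marks the end of every later pass.

  The obstacle is that compacting destroys the evidence used by the ring test. The test therefore
  reads only the current column and the next one to the right, and the tile directly above a tile
  just removed is taken without a test: it cannot belong to the ring, which does not touch the
  polyomino.\<close>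

type_synonym 'q cfg = "'q \<times> pixel \<times> pixel set"

type_synonym 'q table = "'q \<Rightarrow> bool \<Rightarrow> 'q \<times> bool \<times> dir"

definition mstep :: "'q table \<Rightarrow> 'q cfg \<Rightarrow> 'q cfg" where
  "mstep D s = (case s of (q, p, T) \<Rightarrow> case D q (p \<in> T) of (q', c, d) \<Rightarrow>
     (q', move d p, if c then insert p T else T - {p}))"

text \<open>The number is only an upper bound for the number of steps. Stop states, the area and the
  tile bound concern every configuration but the last one.\<close>

inductive goes :: "'q table \<Rightarrow> 'q set \<Rightarrow> pixel set \<Rightarrow> nat \<Rightarrow> 'q cfg \<Rightarrow> nat \<Rightarrow> 'q cfg \<Rightarrow> bool"
  for D stop A M where
  goes_refl: "goes D stop A M s n s"
| goes_step: "\<lbrakk>q \<notin> stop; p \<in> A; finite T; card T \<le> M; goes D stop A M (mstep D (q, p, T)) n s'\<rbrakk>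
    \<Longrightarrow> goes D stop A M (q, p, T) (Suc n) s'"

lemma goes_mono: "goes D stop A M s n s' \<Longrightarrow> n \<le> m \<Longrightarrow> goes D stop A M s m s'"
proof (induction arbitrary: m rule: goes.induct)
  case (goes_refl s n)
  then show ?case by (simp add: goes.goes_refl)
next
  case (goes_step q p T n s')
  then obtain m' where "m = Suc m'" "n \<le> m'" by (cases m) auto
  with goes_step show ?case by (simp add: goes.goes_step)
qed

lemma goes_trans:
  "goes D stop A M s n s' \<Longrightarrow> goes D stop A M s' m s'' \<Longrightarrow> goes D stop A M s (n + m) s''"
proof (induction rule: goes.induct)
  case (goes_refl s n)
  then show ?case by (simp add: goes_mono)
next
  case (goes_step q p T n s')
  then show ?case by (simp add: goes.goes_step)
qed

lemma goes_run:
  assumes "goes D stop A M s n s'"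
  shows "\<exists>t\<le>n. (mstep D ^^ t) s = s' \<and>
    (\<forall>i<t. fst ((mstep D ^^ i) s) \<notin> stop \<and> fst (snd ((mstep D ^^ i) s)) \<in> A \<and>
           card (snd (snd ((mstep D ^^ i) s))) \<le> M)"
  using assms
proof (induction rule: goes.induct)
  case (goes_refl s n)
  then show ?case by (intro exI[of _ 0]) simp
next
  case (goes_step q p T n s')
  then obtain t where t: "t \<le> n" "(mstep D ^^ t) (mstep D (q, p, T)) = s'"
    "\<And>i. i < t \<Longrightarrow> fst ((mstep D ^^ i) (mstep D (q, p, T))) \<notin> stop \<and>
      fst (snd ((mstep D ^^ i) (mstep D (q, p, T)))) \<in> A \<and>
      card (snd (snd ((mstep D ^^ i) (mstep D (q, p, T))))) \<le> M"
    by blast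
  show ?case
  proof (intro exI[of _ "Suc t"] conjI allI impI)
    show "Suc t \<le> Suc n" "(mstep D ^^ Suc t) (q, p, T) = s'"
      using t by (simp_all add: funpow_swap1)
    fix i assume "i < Suc t"
    then show "fst ((mstep D ^^ i) (q, p, T)) \<notin> stop"
      "fst (snd ((mstep D ^^ i) (q, p, T))) \<in> A"
      "card (snd (snd ((mstep D ^^ i) (q, p, T)))) \<le> M"
      using t(3)[of "i - 1"] goes_step by (cases i; simp add: funpow_swap1)+
  qed
qed

text \<open>Applied with \<open>prod.swap\<close> and \<open>flip\<close>, this transports a run to
  the grid with exchanged axes. Tile counts survive because \<open>g\<close> is injective.\<close>

lemma goes_simulation:
  assumes "goes D stop A M s n s'"
    and D: "\<And>q b q' c d. q \<notin> stop \<Longrightarrow> D q b = (q', c, d) \<Longrightarrow> D' (f q) b = (f q', c, \<sigma> d)"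
    and stop: "\<And>q. q \<notin> stop \<Longrightarrow> f q \<notin> stop'"
    and g: "inj g" "\<And>d p. g (move d p) = move (\<sigma> d) (g p)"
  shows "goes D' stop' (g ` A) M (f (fst s), g (fst (snd s)), g ` snd (snd s)) n
           (f (fst s'), g (fst (snd s')), g ` snd (snd s'))"
  using assms(1)
proof (induction rule: goes.induct)
  case (goes_refl s n)
  show ?case by (rule goes.goes_refl)
next
  case (goes_step q p T n s')
  obtain q' c d where qcd: "D q (p \<in> T) = (q', c, d)" by (cases "D q (p \<in> T)")
  have mem: "(g p \<in> g ` T) = (p \<in> T)" using g(1) by (simp add: inj_image_mem_iff)
  have "mstep D' (f q, g p, g ` T) =
    (f (fst (mstep D (q, p, T))), g (fst (snd (mstep D (q, p, T)))), g ` snd (snd (mstep D (q, p, T))))"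
    using D[OF goes_step(1) qcd] mem
    by (simp add: mstep_def qcd g image_set_diff[OF g(1)])
  then show ?case
    using goes_step stop card_image[OF inj_on_subset[OF g(1), of T]]
    by (auto intro!: goes.goes_step)
qed

section \<open>The counting automaton\<close>

text \<open>The reflection in the diagonal \<open>x = y\<close>, acting on directions.\<close>

fun flip :: "dir \<Rightarrow> dir" where
  "flip Up = Right" | "flip Down = Left" | "flip Left = Down" | "flip Right = Up"

datatype (plugins only:) phase = F0 | F1 | F2

datatype (plugins only:) tctx = CDiag bool | CSweep phase

text \<open>
  \<open>Nav\<close> follows the ring down, left and down again; the flag distinguishes the first visit of the
  corner from the second one. \<open>Diag\<close> is the staircase (the flag says that the next move is
  upward), \<open>Dec\<close> reads off the longer side, and \<open>Flip\<close> exchanges the axes. \<open>Tst\<close> is the ring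
  test, with results \<open>TP\<close> (polyomino) and \<open>TR\<close> (ring). \<open>Sw\<close> compacts the columns from left to
  right; its phase records whether tiles have been seen in no column so far (\<open>F0\<close>), in an earlier
  column only (\<open>F1\<close>), or in this column (\<open>F2\<close>), and an empty column in phase \<open>F1\<close> is the end of
  the polyomino. \<open>Car\<close> is shared by compacting and halving. \<open>Ps\<close>, \<open>Hv\<close>, \<open>Hd\<close>, \<open>He\<close> perform a
  halving pass; their flags are the carried parity and whether any tile has been seen. \<open>Rt\<close> returns
  to the counter and \<open>Ap\<close> appends a digit.
\<close>

datatype (plugins only:) label =
    Nav0 bool phase | Nav1 bool phase | Nav2 bool phase | Nav3 bool phase | Nav4 bool phase
  | Nav5 bool phase
  | Dia0 | Dia1 | Dia2 | Diag bool
  | Tst1 tctx | Tst2 tctx | Tst3 tctx | Tst4 tctx | Tst5 tctx | Tst6 tctx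
  | Tst7 tctx | TP tctx | TR tctx
  | Dec1 | Dec2 | Dec3 | Flip
  | Put0 | Put1 | Put2
  | Sw0 phase | Sw1 phase | Sw2 phase | Sw3 phase | Sw4 | Sw5 phase | Sw6 phase
  | Car0 bool | Car1 bool | Car2 bool
  | Bk | Ps0 bool bool | Ps1 bool bool
  | HvR bool | Hv0 bool | Hv1 | Hd bool bool | He bool bool
  | Rt bool bool | Ap0 bool | Ap1 bool | Ap2 bool | Ap3 | Fin | Halt

text \<open>Every transition moves, so looking at a pixel means stepping onto it and back in later
  states; writing \<open>b\<close> leaves the pixel as it was. \<open>Hv0\<close> and
  \<open>Hv1\<close> meet the first and the second tile of a pair, while \<open>HvR\<close> starts a
  column into which an unpaired tile is carried.\<close>

primrec dl :: "label table" where
  "dl (Nav0 g j) b = (Nav1 g j, b, if j = F1 then Left else Down)"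
| "dl (Nav1 g j) b = (Nav2 g j, b, if j = F1 then Down else Left)"
| "dl (Nav2 g j) b = (if b then (Nav1 g j, b, if j = F1 then Left else Down)
                      else (Nav3 g j, b, if j = F1 then Up else Right))"
| "dl (Nav3 g j) b = (Nav4 g j, b, if j = F1 then Up else Right)"
| "dl (Nav4 g j) b = (if b then (Nav1 g j, b, if j = F1 then Left else Down)
                      else (Nav5 g j, b, if j = F1 then Right else Up))"
| "dl (Nav5 g j) b = (case j of F0 \<Rightarrow> Nav0 g F1 | F1 \<Rightarrow> Nav0 g F2 | F2 \<Rightarrow> if g then Put0 else Dia0,
                      b, if j = F1 then Down else Left)"
| "dl Dia0 b = (Dia1, b, Right)"
| "dl Dia1 b = (Dia2, b, Up)"
| "dl Dia2 b = (Diag False, b, Up)"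
| "dl (Diag s) b = (if b then (Tst1 (CDiag s), b, Right)
                    else (Diag (\<not> s), b, if s then Up else Right))"
| "dl (Tst1 k) b = (if b then (TP k, b, Left) else (Tst2 k, b, Up))"
| "dl (Tst2 k) b = (if b then (Tst3 k, b, Left) else (Tst4 k, b, Down))"
| "dl (Tst3 k) b = (if b then TP k else TR k, b, Down)"
| "dl (Tst4 k) b = (Tst5 k, b, Down)"
| "dl (Tst5 k) b = (if b then (Tst6 k, b, Left) else (Tst7 k, b, Up))"
| "dl (Tst6 k) b = (if b then TP k else TR k, b, Up)"
| "dl (Tst7 k) b = (TP k, b, Left)"
| "dl (TP k) b = (case k of CDiag s \<Rightarrow> (Diag (\<not> s), b, if s then Up else Right)
                           | CSweep f \<Rightarrow> (Car0 True, b, Down))"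
| "dl (TR k) b = (case k of CDiag s \<Rightarrow> (Dec1, b, Right) | CSweep f \<Rightarrow> (Sw5 f, b, Down))"
| "dl Dec1 b = (Dec2, b, Right)"
| "dl Dec2 b = (if b then Dec3 else Flip, b, Left)"
| "dl Dec3 b = (Nav0 True F0, b, Left)"
| "dl Flip b = (Nav0 True F0, b, Left)"
| "dl Put0 b = (Put1, b, Down)"
| "dl Put1 b = (Put2, b, Left)"
| "dl Put2 b = (Sw0 F0, True, Right)"
| "dl (Sw0 f) b = (Sw1 f, b, Up)"
| "dl (Sw1 f) b = (Sw2 f, True, Up)"
| "dl (Sw2 f) b = (Sw3 f, False, Up)"
| "dl (Sw3 f) b = (if b then (Tst1 (CSweep f), b, Right) else (Sw3 f, b, Up))"
| "dl Sw4 b = (if b then (Car0 True, b, Down) else (Sw3 F2, b, Up))"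
| "dl (Sw5 f) b = (if b then (if f = F1 then (Bk, False, Down) else (Sw6 f, b, Down))
                   else (Sw5 f, b, Down))"
| "dl (Sw6 f) b = (if b then (Sw6 f, b, Down) else (Sw0 (if f = F0 then F0 else F1), b, Right))"
| "dl (Car0 k) b = (if b then (Car1 k, b, Up) else (Car0 k, b, Down))"
| "dl (Car1 k) b = (Car2 k, True, Up)"
| "dl (Car2 k) b = (if b then (if k then Sw4 else Hv0 True, False, Up) else (Car2 k, b, Up))"
| "dl Bk b = (if b then (Ps0 False False, b, Right) else (Bk, b, Left))"
| "dl (Ps0 r z) b = (Ps1 r z, b, Up)"
| "dl (Ps1 r z) b = (if b then (if r then HvR z else Hv0 z, b, Up) else (Rt r z, b, Down))"
| "dl (HvR z) b = (if b then (Hv0 True, b, Up) else (Hd True z, b, Down))"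
| "dl (Hv0 z) b = (if b then (Hv1, False, Up) else (Hd False z, b, Down))"
| "dl Hv1 b = (if b then (Car0 False, b, Down) else (Hd True True, b, Down))"
| "dl (Hd r z) b = (if b then (He r z, b, Down) else (Hd r z, b, Down))"
| "dl (He r z) b = (if b then (He r z, b, Down) else (Ps0 r z, b, Right))"
| "dl (Rt r z) b = (if b then (if z then Ap0 r else Fin, b, Left) else (Rt r z, b, Left))"
| "dl (Ap0 r) b = (if b then (Ap0 r, b, Left) else (Ap1 r, True, Down))"
| "dl (Ap1 r) b = (Ap2 r, b, Right)"
| "dl (Ap2 r) b = (Ap3, r, Up)"
| "dl Ap3 b = (if b then (Ap3, b, Right) else (Ps1 False False, b, Up))"
| "dl Fin b = (Halt, b, Right)"
| "dl Halt b = (Halt, b, Up)"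

text \<open>The flag tells whether the axes are exchanged; the same table then runs with reflected
  directions, so both orientations share one analysis. The move at \<open>Flip\<close> is a leftward
  one in the orientation being left.\<close>

definition dl2 :: "(bool \<times> label) table" where
  "dl2 s b = (case s of (o', l) \<Rightarrow> if l = Flip then ((\<not> o', Nav0 True F0), b, if o' then Down else Left)
     else (case dl l b of (l', c, d) \<Rightarrow> ((o', l'), c, if o' then flip d else d)))"

lemma finite_phase: "finite (UNIV :: phase set)"
proof (rule finite_subset)
  have "p \<in> {F0, F1, F2}" for p by (cases p) auto
  then show "UNIV \<subseteq> {F0, F1, F2}" by blast
qed simp

lemma finite_tctx: "finite (UNIV :: tctx set)"
proof (rule finite_subset)
  have "k \<in> range CDiag \<union> range CSweep" for k by (cases k) auto
  then show "UNIV \<subseteq> range CDiag \<union> range CSweep" by blast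
qed (simp add: finite_phase)

lemma finite_label: "finite (UNIV :: label set)"
proof (rule finite_subset)
  let ?K = "{Dia0, Dia1, Dia2, Dec1, Dec2, Dec3, Flip, Put0, Put1, Put2, Sw4, Bk, Hv1, Ap3, Fin, Halt}"
  let ?BP = "\<lambda>c :: bool \<Rightarrow> phase \<Rightarrow> label. range (\<lambda>u. c (fst u) (snd u))"
  let ?BB = "\<lambda>c :: bool \<Rightarrow> bool \<Rightarrow> label. range (\<lambda>u. c (fst u) (snd u))"
  let ?S = "?K \<union> ?BP Nav0 \<union> ?BP Nav1 \<union> ?BP Nav2 \<union> ?BP Nav3 \<union> ?BP Nav4 \<union> ?BP Nav5
    \<union> ?BB Ps0 \<union> ?BB Ps1 \<union> ?BB Hd \<union> ?BB He \<union> ?BB Rt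
    \<union> range Diag \<union> range Car0 \<union> range Car1 \<union> range Car2 \<union> range HvR \<union> range Hv0
    \<union> range Ap0 \<union> range Ap1 \<union> range Ap2
    \<union> range Tst1 \<union> range Tst2 \<union> range Tst3 \<union> range Tst4 \<union> range Tst5 \<union> range Tst6
    \<union> range Tst7 \<union> range TP \<union> range TR
    \<union> range Sw0 \<union> range Sw1 \<union> range Sw2 \<union> range Sw3 \<union> range Sw5 \<union> range Sw6"
  have BP: "c g j \<in> ?BP c" for c g j by (rule range_eqI[of _ _ "(g, j)"]) simp
  have BB: "c g j \<in> ?BB c" for c g j by (rule range_eqI[of _ _ "(g, j)"]) simp
  have "l \<in> ?S" for l
    by (cases l) (simp_all only: Un_iff insert_iff rangeI BP BB simp_thms)
  then show "UNIV \<subseteq> ?S" by (intro subsetI)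
  have fp: "finite (UNIV :: (bool \<times> phase) set)"
    using finite_phase by (simp add: finite_Prod_UNIV)
  show "finite ?S"
    using fp by (simp add: finite_phase finite_tctx)
qed

section \<open>Elementary runs\<close>

lemma funpow_move:
  "(move Up ^^ n) (x, y) = (x, y + int n)"
  "(move Down ^^ n) (x, y) = (x, y - int n)"
  "(move Left ^^ n) (x, y) = (x - int n, y)"
  "(move Right ^^ n) (x, y) = (x + int n, y)"
  by (induction n) auto

locale arena =
  fixes A :: "pixel set" and M :: nat
begin

abbreviation go :: "label cfg \<Rightarrow> nat \<Rightarrow> label cfg \<Rightarrow> bool" where
  "go \<equiv> goes dl {Halt, Flip} A M"

definition fits :: "pixel set \<Rightarrow> bool" where
  "fits T \<longleftrightarrow> finite T \<and> card T \<le> M"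

lemma fits_subset: "fits T \<Longrightarrow> S \<subseteq> T \<Longrightarrow> fits S"
  unfolding fits_def by (meson card_mono finite_subset le_trans)

lemma go_step:
  "\<lbrakk>q \<noteq> Halt; q \<noteq> Flip; p \<in> A; fits T; go (mstep dl (q, p, T)) n s\<rbrakk> \<Longrightarrow> go (q, p, T) (Suc n) s"
  unfolding fits_def by (rule goes_step) auto

lemma go1:
  "\<lbrakk>q \<noteq> Halt; q \<noteq> Flip; p \<in> A; fits T; mstep dl (q, p, T) = s\<rbrakk> \<Longrightarrow> go (q, p, T) 1 s"
  using go_step[of q p T 0 s] goes_refl by fastforce

lemmas go_trans [trans] = goes_trans[of dl "{Halt, Flip}" A M]
lemmas go_mono = goes_mono[of dl "{Halt, Flip}" A M]

lemma go_weaken: "go s n s' \<Longrightarrow> n \<le> m \<Longrightarrow> s' = t \<Longrightarrow> go s m t"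
  using go_mono by blast

lemmas mstep_simps = mstep_def insert_absorb

lemma walk:
  assumes "\<And>i. i < n \<Longrightarrow> ((move d ^^ i) p \<in> T) = b \<and> (move d ^^ i) p \<in> A"
    and "q \<noteq> Halt" "q \<noteq> Flip" "fits T" "dl q b = (q, b, d)"
  shows "go (q, p, T) n (q, (move d ^^ n) p, T)"
  using assms(1)
proof (induction n arbitrary: p)
  case 0
  show ?case by (simp add: goes_refl)
next
  case (Suc n)
  have p: "(p \<in> T) = b" "p \<in> A" using Suc.prems[of 0] by auto
  have "((move d ^^ i) (move d p) \<in> T) = b \<and> (move d ^^ i) (move d p) \<in> A" if "i < n" for i
    using Suc.prems[of "Suc i"] that by (simp add: funpow_swap1)
  then have "go (q, move d p, T) n (q, (move d ^^ n) (move d p), T)" by (rule Suc.IH)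
  moreover have "mstep dl (q, p, T) = (q, move d p, T)"
    using p assms(5) by (cases b) (auto simp: mstep_simps)
  ultimately show ?case
    using p assms by (auto intro!: go_step simp: funpow_swap1)
qed

lemma walk_up:
  assumes "y \<le> y'" "\<And>v. y \<le> v \<Longrightarrow> v < y' \<Longrightarrow> ((x, v) \<in> T) = b \<and> (x, v) \<in> A"
    and "q \<noteq> Halt" "q \<noteq> Flip" "fits T" "dl q b = (q, b, Up)"
  shows "go (q, (x, y), T) (nat (y' - y)) (q, (x, y'), T)"
  using walk[of "nat (y' - y)" Up "(x, y)" T b q] assms by (simp add: funpow_move)

lemma walk_down:
  assumes "y' \<le> y" "\<And>v. y' < v \<Longrightarrow> v \<le> y \<Longrightarrow> ((x, v) \<in> T) = b \<and> (x, v) \<in> A"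
    and "q \<noteq> Halt" "q \<noteq> Flip" "fits T" "dl q b = (q, b, Down)"
  shows "go (q, (x, y), T) (nat (y - y')) (q, (x, y'), T)"
  using walk[of "nat (y - y')" Down "(x, y)" T b q] assms by (simp add: funpow_move)

lemma walk_left:
  assumes "x' \<le> x" "\<And>u. x' < u \<Longrightarrow> u \<le> x \<Longrightarrow> ((u, y) \<in> T) = b \<and> (u, y) \<in> A"
    and "q \<noteq> Halt" "q \<noteq> Flip" "fits T" "dl q b = (q, b, Left)"
  shows "go (q, (x, y), T) (nat (x - x')) (q, (x', y), T)"
  using walk[of "nat (x - x')" Left "(x, y)" T b q] assms by (simp add: funpow_move)

lemma walk_right:
  assumes "x \<le> x'" "\<And>u. x \<le> u \<Longrightarrow> u < x' \<Longrightarrow> ((u, y) \<in> T) = b \<and> (u, y) \<in> A"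
    and "q \<noteq> Halt" "q \<noteq> Flip" "fits T" "dl q b = (q, b, Right)"
  shows "go (q, (x, y), T) (nat (x' - x)) (q, (x', y), T)"
  using walk[of "nat (x' - x)" Right "(x, y)" T b q] assms by (simp add: funpow_move)

text \<open>Positive if a diagonal neighbour on the right is joined to \<open>(x, y)\<close> by no
  common neighbour. Columns on the left are not read because the sweep has already rearranged
  them.\<close>

definition ring_test :: "pixel set \<Rightarrow> int \<Rightarrow> int \<Rightarrow> bool" where
  "ring_test T x y \<longleftrightarrow> (x + 1, y) \<notin> T \<and>
     (if (x + 1, y + 1) \<in> T then (x, y + 1) \<notin> T else (x + 1, y - 1) \<in> T \<and> (x, y - 1) \<notin> T)"

lemma test_ring:
  assumes "\<And>u v. x \<le> u \<Longrightarrow> u \<le> x + 1 \<Longrightarrow> y - 1 \<le> v \<Longrightarrow> v \<le> y + 1 \<Longrightarrow> (u, v) \<in> A" and "fits T"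
  shows "go (Tst1 k, (x + 1, y), T) 6 (if ring_test T x y then TR k else TP k, (x, y), T)"
proof -
  have A: "(x + 1, y) \<in> A" "(x + 1, y + 1) \<in> A" "(x, y + 1) \<in> A" "(x + 1, y - 1) \<in> A"
    "(x, y - 1) \<in> A" using assms(1) by simp_all
  have "go (Tst1 k, (x + 1, y), T) (Suc (Suc (Suc (Suc (Suc (Suc 0))))))
    (if ring_test T x y then TR k else TP k, (x, y), T)"
    using A assms(2)
    apply (cases "(x + 1, y) \<in> T"; cases "(x + 1, y + 1) \<in> T"; cases "(x, y + 1) \<in> T";
        cases "(x + 1, y - 1) \<in> T"; cases "(x, y - 1) \<in> T";
        simp add: ring_test_def)
    apply ((rule goes_refl | (rule go_step; simp add: mstep_simps))+)
    done
  then show ?thesis by (simp add: numeral_eq_Suc)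
qed

text \<open>The gap in column \<open>x\<close> between a tile below it and a tile above it is moved up by one.\<close>

lemma carry:
  assumes "lo \<le> s" "s < hi" "(x, lo - 1) \<in> T" "(x, hi) \<in> T"
    and gap: "\<And>v. lo \<le> v \<Longrightarrow> v < hi \<Longrightarrow> (x, v) \<notin> T"
    and A: "\<And>v. lo - 1 \<le> v \<Longrightarrow> v \<le> hi \<Longrightarrow> (x, v) \<in> A"
    and fits: "finite T" "card T < M"
  shows "go (Car0 k, (x, s), T) (2 * nat (hi - lo) + 3)
    (if k then Sw4 else Hv0 True, (x, hi + 1), insert (x, lo) T - {(x, hi)})"
proof -
  let ?T = "insert (x, lo) T"
  have fT: "fits T" and fT': "fits ?T" using fits by (auto simp: fits_def card_insert_if)
  have "go (Car0 k, (x, s), T) (nat (s - (lo - 1))) (Car0 k, (x, lo - 1), T)"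
    by (rule walk_down[where b = False]) (use assms fT in auto)
  also have "go (Car0 k, (x, lo - 1), T) 1 (Car1 k, (x, lo), T)"
    by (rule go1) (use assms fT in \<open>auto simp: mstep_simps\<close>)
  also have "go (Car1 k, (x, lo), T) 1 (Car2 k, (x, lo + 1), ?T)"
    by (rule go1) (use assms fT in \<open>auto simp: mstep_simps\<close>)
  also have "go (Car2 k, (x, lo + 1), ?T) (nat (hi - (lo + 1))) (Car2 k, (x, hi), ?T)"
    by (rule walk_up[where b = False]) (use assms fT' in auto)
  also have "go (Car2 k, (x, hi), ?T) 1 (if k then Sw4 else Hv0 True, (x, hi + 1), ?T - {(x, hi)})"
    by (rule go1) (use assms fT' in \<open>auto simp: mstep_simps\<close>)
  finally show ?thesis by (rule go_mono) (use assms in auto)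
qed

end

section \<open>Halving the heaps\<close>

context arena
begin

definition col :: "pixel set \<Rightarrow> int \<Rightarrow> int set \<Rightarrow> pixel set" where
  "col R x S = R \<union> Pair x ` S"

text \<open>The way to the next column leads through the row below the heaps: down onto the heap,
  down through it, and from below into the next column. The tile in row \<open>y0\<close> stops the
  fall even over an empty heap.\<close>

lemma descend:
  assumes "y0 \<le> t" "t \<le> v"
    and "\<And>u. t < u \<Longrightarrow> u \<le> v \<Longrightarrow> (x, u) \<notin> T" "\<And>u. y0 \<le> u \<Longrightarrow> u \<le> t \<Longrightarrow> (x, u) \<in> T"
    and "(x, y0 - 1) \<notin> T" "(x + 1, y0 - 1) \<notin> T"
    and A: "\<And>u. y0 - 1 \<le> u \<Longrightarrow> u \<le> v \<Longrightarrow> (x, u) \<in> A" "(x + 1, y0 - 1) \<in> A" and "fits T"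
  shows "go (Hd r z, (x, v), T) (nat (v - y0) + 3) (Ps1 r z, (x + 1, y0), T)"
proof -
  have "go (Hd r z, (x, v), T) (nat (v - t)) (Hd r z, (x, t), T)"
    by (rule walk_down[where b = False]) (use assms in auto)
  also have "go (Hd r z, (x, t), T) 1 (He r z, (x, t - 1), T)"
    by (rule go1) (use assms in \<open>auto simp: mstep_simps\<close>)
  also have "go (He r z, (x, t - 1), T) (nat ((t - 1) - (y0 - 1))) (He r z, (x, y0 - 1), T)"
    by (rule walk_down[where b = True]) (use assms in auto)
  also have "go (He r z, (x, y0 - 1), T) 1 (Ps0 r z, (x + 1, y0 - 1), T)"
    by (rule go1) (use assms in \<open>auto simp: mstep_simps\<close>)
  also have "go (Ps0 r z, (x + 1, y0 - 1), T) 1 (Ps1 r z, (x + 1, y0), T)"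
    by (rule go1) (use assms in \<open>auto simp: mstep_simps\<close>)
  finally show ?thesis by (rule go_mono) (use assms in auto)
qed

text \<open>Below the gap the halved part of the heap, above it \<open>n\<close> tiles that are still to be halved.\<close>

lemma halve_rest:
  assumes "y0 + int j < s" "s + int n \<le> y0 + int K + 1"
    and R: "\<And>v. y0 - 1 \<le> v \<Longrightarrow> v \<le> y0 + int K + 1 \<Longrightarrow> (x, v) \<notin> R" "(x + 1, y0 - 1) \<notin> R"
    and A: "\<And>u. y0 - 1 \<le> u \<Longrightarrow> u \<le> y0 + int K + 1 \<Longrightarrow> (x, u) \<in> A" "(x + 1, y0 - 1) \<in> A"
    and "fits (col R x ({y0..y0 + int j} \<union> {s..<s + int n}))"
  shows "go (Hv0 z, (x, s), col R x ({y0..y0 + int j} \<union> {s..<s + int n}))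
     (n * (2 * K + 6) + nat (s - y0) + 6)
     (Ps1 (odd n) (z \<or> n > 0), (x + 1, y0), col R x {y0..y0 + int (j + n div 2)})"
  using assms(1,2,7)
proof (induction n arbitrary: j s z rule: less_induct)
  case (less n)
  let ?T = "col R x ({y0..y0 + int j} \<union> {s..<s + int n})"
  have mem: "(x, v) \<in> col R x S \<longleftrightarrow> v \<in> S" if "y0 - 1 \<le> v" "v \<le> y0 + int K + 1" for v S
    using R(1)[OF that] by (auto simp: col_def)
  have mem': "(x + 1, y0 - 1) \<notin> col R x S" for S
    using R(2) by (auto simp: col_def)
  consider "n = 0" | "n = 1" | "n \<ge> 2" by linarith
  then show ?case
  proof cases
    case 1
    have T: "?T = col R x {y0..y0 + int j}" using 1 by simp
    have "go (Hv0 z, (x, s), ?T) 1 (Hd False z, (x, s - 1), ?T)"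
      by (rule go1) (use less.prems A mem[of s] 1 in \<open>auto simp: mstep_simps\<close>)
    also have "go (Hd False z, (x, s - 1), ?T) (nat (s - 1 - y0) + 3) (Ps1 False z, (x + 1, y0), ?T)"
      by (rule descend[where t = "y0 + int j"]) (use less.prems A mem mem' 1 in auto)
    finally show ?thesis by (rule go_weaken) (use 1 in auto)
  next
    case 2
    let ?T' = "col R x {y0..y0 + int j}"
    have T: "?T - {(x, s)} = ?T'"
      using 2 less.prems R by (auto simp: col_def)
    have f: "fits ?T'" by (rule fits_subset[OF less.prems(3)]) (auto simp: col_def)
    have "go (Hv0 z, (x, s), ?T) 1 (Hv1, (x, s + 1), ?T')"
      by (rule go1) (use less.prems A mem[of s] 2 T in \<open>auto simp: mstep_simps\<close>)
    also have "go (Hv1, (x, s + 1), ?T') 1 (Hd True True, (x, s), ?T')"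
      by (rule go1) (use less.prems A mem[of "s + 1"] 2 f in \<open>auto simp: mstep_simps\<close>)
    also have "go (Hd True True, (x, s), ?T') (nat (s - y0) + 3) (Ps1 True True, (x + 1, y0), ?T')"
      by (rule descend[where t = "y0 + int j"]) (use less.prems A mem mem' 2 f in auto)
    finally have "go (Hv0 z, (x, s), ?T) (n * (2 * K + 6) + nat (s - y0) + 6) (Ps1 True True, (x + 1, y0), ?T')"
      by (rule go_mono) (use 2 in auto)
    then show ?thesis using 2 by simp
  next
    \<comment> \<open>Of two tiles the first disappears and the second moves down onto the part
      already halved.\<close>
    case 3
    let ?T1 = "col R x ({y0..y0 + int j} \<union> {s + 1..<s + int n})"
    let ?T2 = "col R x ({y0..y0 + int (j + 1)} \<union> {s + 2..<s + 2 + int (n - 2)})"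
    have T1: "?T - {(x, s)} = ?T1"
      using 3 less.prems R by (auto simp: col_def)
    have "(x, s) \<in> ?T" using 3 by (auto simp: col_def)
    \<comment> \<open>Deleting the first tile of the pair provides the spare tile that
      \<open>carry\<close> needs.\<close>
    then have "card ?T1 < card ?T"
      using less.prems(3) card_Diff1_less[of ?T "(x, s)"] by (simp only: T1 fits_def)
    moreover have f1: "fits ?T1" by (rule fits_subset[OF less.prems(3)]) (auto simp: col_def)
    ultimately have c1: "finite ?T1" "card ?T1 < M"
      using less.prems(3) unfolding fits_def by linarith+
    have T2: "insert (x, y0 + int j + 1) ?T1 - {(x, s + 1)} = ?T2"
    proof -
      have "insert (y0 + int j + 1) ({y0..y0 + int j} \<union> {s + 1..<s + int n}) - {s + 1}
        = {y0..y0 + int (j + 1)} \<union> {s + 2..<s + 2 + int (n - 2)}"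
        using 3 less.prems by auto
      moreover have "(x, s + 1) \<notin> R" using 3 less.prems R(1)[of "s + 1"] by auto
      ultimately show ?thesis unfolding col_def by auto
    qed
    have "fits (insert (x, y0 + int j + 1) ?T1)"
      using c1 by (auto simp: fits_def card_insert_if)
    then have f2: "fits ?T2"
      by (rule fits_subset) (use T2 in blast)
    have "go (Hv0 z, (x, s), ?T) 1 (Hv1, (x, s + 1), ?T1)"
      by (rule go1) (use less.prems A mem[of s] 3 T1 in \<open>auto simp: mstep_simps\<close>)
    also have "go (Hv1, (x, s + 1), ?T1) 1 (Car0 False, (x, s), ?T1)"
      by (rule go1) (use less.prems A mem[of "s + 1"] 3 c1 f1 in \<open>auto simp: mstep_simps\<close>)
    also have "go (Car0 False, (x, s), ?T1) (2 * nat (s + 1 - (y0 + int j + 1)) + 3)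
      (if False then Sw4 else Hv0 True, (x, s + 1 + 1), insert (x, y0 + int j + 1) ?T1 - {(x, s + 1)})"
      by (rule carry) (use less.prems A mem 3 c1 f1 in auto)
    also have "\<dots> = (Hv0 True, (x, s + 2), ?T2)" unfolding T2 by simp
    also have "go (Hv0 True, (x, s + 2), ?T2) ((n - 2) * (2 * K + 6) + nat (s + 2 - y0) + 6)
      (Ps1 (odd (n - 2)) (True \<or> n - 2 > 0), (x + 1, y0), col R x {y0..y0 + int (j + 1 + (n - 2) div 2)})"
      by (rule less.IH) (use less.prems 3 f2 in auto)
    finally have *: "go (Hv0 z, (x, s), ?T)
      (1 + 1 + (2 * nat (s + 1 - (y0 + int j + 1)) + 3) + ((n - 2) * (2 * K + 6) + nat (s + 2 - y0) + 6))
      (Ps1 (odd (n - 2)) (True \<or> n - 2 > 0), (x + 1, y0), col R x {y0..y0 + int (j + 1 + (n - 2) div 2)})" .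
    obtain n' where n': "n = n' + 2" using 3 by (metis add.commute le_Suc_ex)
    have "1 + 1 + (2 * nat (s + 1 - (y0 + int j + 1)) + 3) + ((n - 2) * (2 * K + 6) + nat (s + 2 - y0) + 6)
      \<le> n * (2 * K + 6) + nat (s - y0) + 6"
      using less.prems n' by (simp add: algebra_simps)
    from go_mono[OF * this] show ?thesis unfolding n' by simp
  qed
qed

text \<open>A carried tile no longer exists on the grid; only \<open>r\<close> represents it. If
  \<open>r\<close> holds, the lowest tile of the heap completes the pair and stays, and the
  \<open>m - 1\<close> tiles above it are halved:
  \<open>1 + (m - 1) div 2 = (m + 1) div 2\<close>.\<close>

lemma halve_column:
  assumes "m \<le> K"
    and R: "\<And>v. y0 - 1 \<le> v \<Longrightarrow> v \<le> y0 + int K + 1 \<Longrightarrow> (x, v) \<notin> R" "(x + 1, y0 - 1) \<notin> R"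
    and A: "\<And>u. y0 - 1 \<le> u \<Longrightarrow> u \<le> y0 + int K + 1 \<Longrightarrow> (x, u) \<in> A" "(x + 1, y0 - 1) \<in> A"
    and f: "fits (col R x {y0..y0 + int m})"
  shows "go (Ps1 r z, (x, y0), col R x {y0..y0 + int m}) (m * (2 * K + 6) + 10)
     (Ps1 (odd (m + of_bool r)) (z \<or> m > 0), (x + 1, y0),
      col R x {y0..y0 + int ((m + of_bool r) div 2)})"
proof -
  let ?T = "col R x {y0..y0 + int m}"
  have mem: "(x, v) \<in> col R x S \<longleftrightarrow> v \<in> S" if "y0 - 1 \<le> v" "v \<le> y0 + int K + 1" for v S
    using R(1)[OF that] by (auto simp: col_def)
  have mem': "(x + 1, y0 - 1) \<notin> col R x S" for S
    using R(2) by (auto simp: col_def)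
  have p1: "go (Ps1 r z, (x, y0), ?T) 1 (if r then HvR z else Hv0 z, (x, y0 + 1), ?T)"
    by (rule go1) (use A mem f in \<open>auto simp: mstep_simps\<close>)
  consider "\<not> r" | "r" "m = 0" | "r" "m > 0" by blast
  then show ?thesis
  proof cases
    case 1
    have T: "?T = col R x ({y0..y0 + int 0} \<union> {y0 + 1..<y0 + 1 + int m})"
      by (rule arg_cong[where f = "col R x"]) auto
    have "go (Hv0 z, (x, y0 + 1), ?T) (m * (2 * K + 6) + nat (y0 + 1 - y0) + 6)
      (Ps1 (odd m) (z \<or> m > 0), (x + 1, y0), col R x {y0..y0 + int (0 + m div 2)})"
      unfolding T by (rule halve_rest) (use assms T in auto)
    from go_trans[OF p1[unfolded if_not_P[OF 1]] this] show ?thesis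
      by (rule go_weaken) (use 1 in auto)
  next
    case 2
    then have "go (Ps1 r z, (x, y0), ?T) 1 (HvR z, (x, y0 + 1), ?T)" using p1 by simp
    also have "go (HvR z, (x, y0 + 1), ?T) 1 (Hd True z, (x, y0), ?T)"
      by (rule go1) (use A mem[of "y0 + 1"] f 2 in \<open>auto simp: mstep_simps\<close>)
    also have "go (Hd True z, (x, y0), ?T) (nat (y0 - y0) + 3) (Ps1 True z, (x + 1, y0), ?T)"
      by (rule descend[where t = y0]) (use A mem mem' 2 f in auto)
    finally show ?thesis by (rule go_weaken) (use 2 in auto)
  next
    case 3
    have T: "?T = col R x ({y0..y0 + int 1} \<union> {y0 + 2..<y0 + 2 + int (m - 1)})"
      by (rule arg_cong[where f = "col R x"]) (use 3 in auto)
    have "go (Ps1 r z, (x, y0), ?T) 1 (HvR z, (x, y0 + 1), ?T)" using p1 3 by simp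
    also have "go (HvR z, (x, y0 + 1), ?T) 1 (Hv0 True, (x, y0 + 2), ?T)"
      by (rule go1) (use A assms(1) mem[of "y0 + 1"] f 3 in \<open>auto simp: mstep_simps\<close>)
    also have "go (Hv0 True, (x, y0 + 2), ?T) ((m - 1) * (2 * K + 6) + nat (y0 + 2 - y0) + 6)
      (Ps1 (odd (m - 1)) (True \<or> m - 1 > 0), (x + 1, y0), col R x {y0..y0 + int (1 + (m - 1) div 2)})"
      unfolding T by (rule halve_rest) (use assms T 3 in auto)
    finally have *: "go (Ps1 r z, (x, y0), ?T) (1 + 1 + ((m - 1) * (2 * K + 6) + nat (y0 + 2 - y0) + 6))
       (Ps1 (odd (m - 1)) (True \<or> m - 1 > 0), (x + 1, y0), col R x {y0..y0 + int (1 + (m - 1) div 2)})" .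
    obtain m' where m': "m = Suc m'" using 3 by (cases m) auto
    show ?thesis
      using go_weaken[OF *, of "m * (2 * K + 6) + 10"] 3 unfolding m' by simp
  qed
qed

end

section \<open>Repeated halving and the resulting counter\<close>

lemma digit_sum: "(\<Sum>i<n. if odd (N div 2 ^ i) then 2 ^ i else 0) = N mod 2 ^ n" for N :: nat
proof (induction n)
  case (Suc n)
  have "N mod 2 ^ Suc n = 2 ^ n * (N div 2 ^ n mod 2) + N mod 2 ^ n"
    using mod_mult2_eq[of N "2 ^ n" 2] by (simp add: mult.commute)
  then show ?case using Suc by (simp add: odd_iff_mod_2_eq_one)
qed simp

text \<open>Row \<open>y0\<close> is the floor, row \<open>y0 - 1\<close> the corridor, and row
  \<open>y0 - 2\<close> receives the digits. The height bound depends on the column because the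
  first column may lie under the left side of the ring, where only an empty heap fits. The hole in
  \<open>R0_end\<close> stops a pass.\<close>

locale combing = arena A M for A M +
  fixes xl xr y0 :: int and K L :: nat and hmax :: "int \<Rightarrow> nat" and R0 :: "pixel set"
  assumes lr: "xl \<le> xr" and hmax: "\<And>u. hmax u \<le> K"
    and A_row: "\<And>u v. xl - 2 - int L \<le> u \<Longrightarrow> u \<le> xr + 1 \<Longrightarrow> y0 - 2 \<le> v \<Longrightarrow> v \<le> y0 \<Longrightarrow> (u, v) \<in> A"
    and A_col: "\<And>u v. xl \<le> u \<Longrightarrow> u \<le> xr \<Longrightarrow> y0 - 1 \<le> v \<Longrightarrow> v \<le> y0 + int K + 1 \<Longrightarrow> (u, v) \<in> A"
    and R0_low: "\<And>u v. (u, v) \<in> R0 \<Longrightarrow> y0 \<le> v"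
    and R0_col: "\<And>u v. xl \<le> u \<Longrightarrow> u \<le> xr \<Longrightarrow> v \<le> y0 + int (hmax u) + 1 \<Longrightarrow> (u, v) \<notin> R0"
    and R0_end: "(xr + 1, y0) \<notin> R0"
begin

definition comb :: "(int \<Rightarrow> nat) \<Rightarrow> pixel set" where
  "comb h = {(u, v). xl \<le> u \<and> u \<le> xr \<and> y0 \<le> v \<and> v \<le> y0 + int (h u)}"

text \<open>There is one base tile more than there are digits: the first is placed before the sweep
  and marks the end of the corridor on the way back. The finished counter therefore has a leading
  zero.\<close>

definition digits :: "nat \<Rightarrow> nat \<Rightarrow> pixel set" where
  "digits N i = (\<lambda>j. (xl - 1 - int j, y0 - 1)) ` {..i} \<union>
     (\<lambda>j. (xl - 1 - int j, y0 - 2)) ` {j. j < i \<and> odd (N div 2 ^ j)}"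

text \<open>In one column \<open>2 * ((m + r) div 2)\<close> plus the outgoing parity equals
  \<open>m + r\<close>. Adding these equations telescopes the parities, so all heaps together behave
  like a single number that is halved.\<close>

lemma pass:
  assumes "xl \<le> x" "x \<le> xr + 1" "\<And>u. h u \<le> hmax u" "fits (R \<union> comb h)"
    and R: "\<And>u v. xl \<le> u \<Longrightarrow> u \<le> xr + 1 \<Longrightarrow> y0 - 1 \<le> v \<Longrightarrow>
       u \<le> xr \<and> v \<le> y0 + int (hmax u) + 1 \<or> v \<le> y0 \<Longrightarrow> (u, v) \<notin> R"
  shows "\<exists>h' r' z'. go (Ps1 r z, (x, y0), R \<union> comb h)
      ((\<Sum>u = x..xr. h u) * (2 * K + 6) + 10 * nat (xr + 1 - x))
      (Ps1 r' z', (xr + 1, y0), R \<union> comb h') \<and> (\<forall>u. h' u \<le> h u) \<and>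
    2 * (\<Sum>u = x..xr. h' u) + of_bool r' = (\<Sum>u = x..xr. h u) + of_bool r \<and>
    z' = (z \<or> (\<Sum>u = x..xr. h u) > 0) \<and> (\<forall>u<x. h' u = h u)"
  using assms(1-4)
proof (induction "nat (xr + 1 - x)" arbitrary: x h r z)
  case 0
  then have "x = xr + 1" by simp
  then show ?case
    by (intro exI[of _ h] exI[of _ r] exI[of _ z]) (auto simp: goes_refl)
next
  case (Suc n)
  define m where "m = h x"
  define h1 where "h1 = h(x := (m + of_bool r) div 2)"
  let ?R = "R \<union> (comb h - {x} \<times> UNIV)"
  have x: "xl \<le> x" "x \<le> xr" using Suc by auto
  have T: "R \<union> comb h = col ?R x {y0..y0 + int m}"
    unfolding col_def comb_def m_def using x by auto
  have T1: "col ?R x {y0..y0 + int ((m + of_bool r) div 2)} = R \<union> comb h1"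
    unfolding col_def comb_def m_def h1_def using x by (auto split: if_splits)
  have le: "h1 u \<le> h u" for u
    by (auto simp: h1_def m_def)
  have "comb h1 \<subseteq> comb h" unfolding comb_def using le by (force intro: order_trans)
  then have f1: "fits (R \<union> comb h1)" by (intro fits_subset[OF Suc.prems(4)]) auto
  \<comment> \<open>The bound \<open>hmax x\<close> replaces \<open>K\<close> here, since only that
    much room above the floor is known to be free.\<close>
  have step: "go (Ps1 r z, (x, y0), R \<union> comb h) (m * (2 * hmax x + 6) + 10)
     (Ps1 (odd (m + of_bool r)) (z \<or> m > 0), (x + 1, y0), R \<union> comb h1)"
    unfolding T T1[symmetric]
  proof (rule halve_column)
    show "m \<le> hmax x" unfolding m_def using Suc by simp
    show "(x, v) \<notin> ?R" if "y0 - 1 \<le> v" "v \<le> y0 + int (hmax x) + 1" for v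
      using R[of x v] x that by auto
    show "(x + 1, y0 - 1) \<notin> ?R"
      using R[of "x + 1" "y0 - 1"] x by (auto simp: comb_def)
    show "(x, u) \<in> A" if "y0 - 1 \<le> u" "u \<le> y0 + int (hmax x) + 1" for u
      using A_col[of x u] hmax[of x] x that by auto
    show "(x + 1, y0 - 1) \<in> A" by (rule A_row) (use x in auto)
    show "fits (col ?R x {y0..y0 + int m})" using Suc.prems(4) T by simp
  qed
  have n: "n = nat (xr + 1 - (x + 1))" using Suc(2) by simp
  have h1K: "h1 u \<le> hmax u" for u using le[of u] Suc.prems(3)[of u] by linarith
  obtain h' r' z' where IH: "go (Ps1 (odd (m + of_bool r)) (z \<or> m > 0), (x + 1, y0), R \<union> comb h1)
      ((\<Sum>u = x + 1..xr. h1 u) * (2 * K + 6) + 10 * nat (xr + 1 - (x + 1)))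
      (Ps1 r' z', (xr + 1, y0), R \<union> comb h')" "\<And>u. h' u \<le> h1 u"
    "2 * (\<Sum>u = x + 1..xr. h' u) + of_bool r' = (\<Sum>u = x + 1..xr. h1 u) + of_bool (odd (m + of_bool r))"
    "z' = ((z \<or> m > 0) \<or> (\<Sum>u = x + 1..xr. h1 u) > 0)" "\<And>u. u < x + 1 \<Longrightarrow> h' u = h1 u"
    using Suc.hyps(1)[OF n, of h1 "odd (m + of_bool r)" "z \<or> m > 0"] Suc.prems h1K f1 x by auto
  have ins: "{x..xr} = insert x {x + 1..xr}" using x by auto
  have sum_h: "(\<Sum>u = x..xr. h u) = m + (\<Sum>u = x + 1..xr. h u)"
    unfolding ins m_def by simp
  have sum_h': "(\<Sum>u = x..xr. h' u) = (m + of_bool r) div 2 + (\<Sum>u = x + 1..xr. h' u)"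
    unfolding ins using IH(5)[of x] by (simp add: h1_def)
  have sum_h1: "(\<Sum>u = x + 1..xr. h1 u) = (\<Sum>u = x + 1..xr. h u)"
    by (rule sum.cong) (auto simp: h1_def)
  have W: "nat (xr + 1 - x) = Suc (nat (xr + 1 - (x + 1)))" using x by simp
  have "m * (2 * hmax x + 6) \<le> m * (2 * K + 6)" using hmax[of x] by simp
  then have cost: "m * (2 * hmax x + 6) + 10 + ((\<Sum>u = x + 1..xr. h1 u) * (2 * K + 6) + 10 * nat (xr + 1 - (x + 1)))
    \<le> (\<Sum>u = x..xr. h u) * (2 * K + 6) + 10 * nat (xr + 1 - x)"
    unfolding sum_h sum_h1 W by (simp add: distrib_right)
  show ?case
  proof (rule exI[of _ h'], rule exI[of _ r'], rule exI[of _ z'], intro conjI allI impI)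
    show "go (Ps1 r z, (x, y0), R \<union> comb h)
      ((\<Sum>u = x..xr. h u) * (2 * K + 6) + 10 * nat (xr + 1 - x))
      (Ps1 r' z', (xr + 1, y0), R \<union> comb h')"
      by (rule go_mono[OF go_trans[OF step IH(1)] cost])
    show "h' u \<le> h u" for u using IH(2) le order_trans by blast
    \<comment> \<open>\<open>b\<close> is the parity handed over from this column to the next; it
      cancels.\<close>
    have *: "2 * d + b = m + r1 \<Longrightarrow> 2 * s + r2 = s1 + b \<Longrightarrow> 2 * (d + s) + r2 = m + s1 + r1"
      for d b r1 s r2 s1 :: nat by (simp add: distrib_left)
    have "2 * ((m + of_bool r) div 2) + of_bool (odd (m + of_bool r)) = m + of_bool r"
      by (auto simp: of_bool_def)
    then show "2 * (\<Sum>u = x..xr. h' u) + of_bool r' = (\<Sum>u = x..xr. h u) + of_bool r"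
      unfolding sum_h sum_h' using IH(3)[unfolded sum_h1] by (rule *)
    show "z' = (z \<or> (\<Sum>u = x..xr. h u) > 0)"
      unfolding IH(4) sum_h sum_h1 by auto
    show "h' u = h u" if "u < x" for u using IH(5)[of u] that by (auto simp: h1_def)
  qed
qed

lemma digits_Suc:
  "digits N (Suc i) = insert (xl - 2 - int i, y0 - 1)
     (if odd (N div 2 ^ i) then insert (xl - 1 - int i, y0 - 2) (digits N i) else digits N i)"
proof -
  have "{j. j < Suc i \<and> odd (N div 2 ^ j)} =
    (if odd (N div 2 ^ i) then insert i {j. j < i \<and> odd (N div 2 ^ j)} else {j. j < i \<and> odd (N div 2 ^ j)})"
    by (auto simp: less_Suc_eq)
  then show ?thesis by (simp add: digits_def atMost_Suc algebra_simps insert_commute)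
qed

lemma mem_digits:
  "(u, y0 - 1) \<in> digits N i \<longleftrightarrow> xl - 1 - int i \<le> u \<and> u \<le> xl - 1"
  "(u, y0 - 2) \<in> digits N i \<longleftrightarrow> (\<exists>j<i. u = xl - 1 - int j \<and> odd (N div 2 ^ j))"
proof -
  have "u = xl - 1 - int (nat (xl - 1 - u))" if "u \<le> xl - 1" using that by simp
  moreover have "nat (xl - 1 - u) \<in> {..i}" if "xl - 1 - int i \<le> u" using that by simp
  ultimately show "(u, y0 - 1) \<in> digits N i \<longleftrightarrow> xl - 1 - int i \<le> u \<and> u \<le> xl - 1"
    unfolding digits_def by (auto intro!: image_eqI[of _ _ "nat (xl - 1 - u)"])
  show "(u, y0 - 2) \<in> digits N i \<longleftrightarrow> (\<exists>j<i. u = xl - 1 - int j \<and> odd (N div 2 ^ j))"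
    unfolding digits_def by auto
qed

lemma digits_row: "(u, v) \<in> digits N i \<Longrightarrow> v < y0 \<and> u < xl"
  unfolding digits_def by auto

lemma finite_digits: "finite (digits N i)"
  unfolding digits_def by auto

text \<open>Digit \<open>i\<close> goes below a base tile that exists already, and the new base tile
  is put one place further left, so the base stays one ahead of the digits. The base line guides the
  robot back to column \<open>xl\<close>.\<close>

lemma append_digit:
  assumes "i < L" "r = odd (N div 2 ^ i)" "\<And>u v. (u, v) \<in> R \<Longrightarrow> y0 \<le> v"
    and f: "finite (R \<union> digits N i)" "card (R \<union> digits N i) + 2 \<le> M"
  shows "go (Rt r True, (xl - 1, y0 - 1), R \<union> digits N i) (2 * i + 6)
    (Ps1 False False, (xl, y0), R \<union> digits N (Suc i))"
proof -
  let ?T = "R \<union> digits N i"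
  let ?T1 = "insert (xl - 2 - int i, y0 - 1) ?T"
  let ?T2 = "R \<union> digits N (Suc i)"
  have mem: "(u, y0 - 1) \<in> R \<union> digits N n \<longleftrightarrow> xl - 1 - int n \<le> u \<and> u \<le> xl - 1" for u n
    using assms(3)[of u "y0 - 1"] mem_digits(1) by auto
  have mem2: "(u, y0 - 2) \<in> R \<union> digits N i \<longleftrightarrow> (\<exists>j<i. u = xl - 1 - int j \<and> odd (N div 2 ^ j))" for u
    using assms(3)[of u "y0 - 2"] mem_digits(2) by auto
  have fT: "fits ?T" using f by (simp add: fits_def)
  have T2: "?T2 = (if r then insert (xl - 1 - int i, y0 - 2) ?T1 else ?T1 - {(xl - 1 - int i, y0 - 2)})"
    using mem2[of "xl - 1 - int i"] assms(2) by (auto simp: digits_Suc)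
  have f1: "finite ?T1" "card ?T1 + 1 \<le> M" using f by (auto simp: card_insert_if)
  then have fT1: "fits ?T1" by (simp add: fits_def)
  have fT2: "fits ?T2" unfolding T2
  proof (cases r)
    case True
    then show "fits (if r then insert (xl - 1 - int i, y0 - 2) ?T1 else ?T1 - {(xl - 1 - int i, y0 - 2)})"
      using f1 by (auto simp: fits_def card_insert_if)
  next
    case False
    then show "fits (if r then insert (xl - 1 - int i, y0 - 2) ?T1 else ?T1 - {(xl - 1 - int i, y0 - 2)})"
      using fits_subset[OF fT1] by auto
  qed
  have "go (Rt r True, (xl - 1, y0 - 1), ?T) 1 (Ap0 r, (xl - 2, y0 - 1), ?T)"
    by (rule go1) (use fT A_row[of "xl - 1" "y0 - 1"] lr mem[of "xl - 1"] in \<open>auto simp: mstep_simps\<close>)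
  also have "go (Ap0 r, (xl - 2, y0 - 1), ?T) (nat (xl - 2 - (xl - 2 - int i)))
      (Ap0 r, (xl - 2 - int i, y0 - 1), ?T)"
    by (rule walk_left[where b = True]) (use fT A_row lr mem assms(1) in auto)
  also have "go (Ap0 r, (xl - 2 - int i, y0 - 1), ?T) 1 (Ap1 r, (xl - 2 - int i, y0 - 2), ?T1)"
    by (rule go1) (use fT A_row lr mem[of "xl - 2 - int i" i] assms(1) in \<open>auto simp: mstep_simps\<close>)
  also have "go (Ap1 r, (xl - 2 - int i, y0 - 2), ?T1) 1 (Ap2 r, (xl - 1 - int i, y0 - 2), ?T1)"
  proof (rule go1)
    have nm: "(xl - 2 - int i, y0 - 2) \<notin> ?T1" using mem2[of "xl - 2 - int i"] by auto
    show "mstep dl (Ap1 r, (xl - 2 - int i, y0 - 2), ?T1) = (Ap2 r, (xl - 1 - int i, y0 - 2), ?T1)"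
      using nm by (simp add: mstep_def)
  qed (use fT1 A_row lr assms(1) in auto)
  also have "go (Ap2 r, (xl - 1 - int i, y0 - 2), ?T1) 1 (Ap3, (xl - 1 - int i, y0 - 1), ?T2)"
    by (rule go1) (use fT1 A_row lr assms(1) T2 in \<open>auto simp: mstep_def\<close>)
  also have "go (Ap3, (xl - 1 - int i, y0 - 1), ?T2) (nat (xl - (xl - 1 - int i))) (Ap3, (xl, y0 - 1), ?T2)"
    by (rule walk_right[where b = True]) (use fT2 A_row lr mem[of _ "Suc i"] assms(1) in auto)
  also have "go (Ap3, (xl, y0 - 1), ?T2) 1 (Ps1 False False, (xl, y0), ?T2)"
    by (rule go1) (use fT2 A_row lr mem[of xl "Suc i"] in \<open>auto simp: mstep_simps\<close>)
  finally show ?thesis by (rule go_mono) auto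
qed

text \<open>Invariant: \<open>i\<close> digits are written and the heaps hold
  \<open>N div 2 ^ i\<close>. The factor 2 in the step bound is the geometric series of the halved
  sizes; the other term allows \<open>L + 1 - i\<close> passes, the last of which finds the heaps
  empty. A pass leaves no new tiles and a digit adds at most two, which explains
  \<open>2 * (L - i)\<close>.\<close>

lemma main_loop:
  assumes "i \<le> L" "N < 2 ^ L" "\<And>u. h u \<le> hmax u" "(\<Sum>u = xl..xr. h u) = N div 2 ^ i"
    and f: "finite (R0 \<union> comb h \<union> digits N i)" "card (R0 \<union> comb h \<union> digits N i) + 2 * (L - i) \<le> M"
  shows "\<exists>n h'. n \<le> L \<and> N < 2 ^ n \<and> fits (R0 \<union> comb h' \<union> digits N n) \<and>
    go (Ps1 False False, (xl, y0), R0 \<union> comb h \<union> digits N i)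
      (2 * (N div 2 ^ i) * (2 * K + 6) + (L + 1 - i) * (11 * nat (xr + 1 - xl) + 2 * L + 20))
      (Halt, (xl - 1, y0 - 1), R0 \<union> comb h' \<union> digits N n)"
  using assms(1,3-6)
proof (induction "L - i" arbitrary: i h rule: less_induct)
  case less
  let ?W = "nat (xr + 1 - xl)"
  let ?R = "R0 \<union> digits N i"
  have eq: "R0 \<union> comb g \<union> digits N j = (R0 \<union> digits N j) \<union> comb g" for g j by blast
  have T0: "fits (?R \<union> comb h)" using less.prems by (simp add: fits_def eq)
  have R: "(u, v) \<notin> ?R" if "xl \<le> u" "u \<le> xr + 1" "y0 - 1 \<le> v"
    "u \<le> xr \<and> v \<le> y0 + int (hmax u) + 1 \<or> v \<le> y0" for u v
  proof -
    have "u \<le> xr \<or> u = xr + 1 \<and> (v = y0 \<or> v < y0)" using that by linarith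
    then show ?thesis
      using that R0_col[of u v] R0_low[of u v] R0_end digits_row[of u v N i] by auto
  qed
  obtain h' r' z' where P: "go (Ps1 False False, (xl, y0), ?R \<union> comb h)
      ((N div 2 ^ i) * (2 * K + 6) + 10 * ?W) (Ps1 r' z', (xr + 1, y0), ?R \<union> comb h')"
    "\<And>u. h' u \<le> h u" "2 * (\<Sum>u = xl..xr. h' u) + of_bool r' = N div 2 ^ i"
    "z' = (N div 2 ^ i > 0)"
    using pass[of xl h ?R False False] lr less.prems T0 R by auto
  let ?T = "?R \<union> comb h'"
  have ch: "comb h' \<subseteq> comb h" unfolding comb_def using P(2) by (force intro: order_trans)
  have T: "fits ?T" by (rule fits_subset[OF T0]) (use ch in auto)
  have low: "(u, v) \<notin> comb h'" if "v < y0" for u v using that by (auto simp: comb_def)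
  have row: "(u, y0 - 1) \<in> ?T \<longleftrightarrow> xl - 1 - int i \<le> u \<and> u \<le> xl - 1" for u
    using mem_digits(1) R0_low[of u "y0 - 1"] low[of "y0 - 1" u] by auto
  have top: "(xr + 1, y0) \<notin> ?T"
    using R[of "xr + 1" y0] lr by (auto simp: comb_def)
  note P(1)
  also have "go (Ps1 r' z', (xr + 1, y0), ?T) 1 (Rt r' z', (xr + 1, y0 - 1), ?T)"
    by (rule go1) (use T A_row lr top in \<open>auto simp: mstep_simps\<close>)
  also have "go (Rt r' z', (xr + 1, y0 - 1), ?T) (nat (xr + 1 - (xl - 1))) (Rt r' z', (xl - 1, y0 - 1), ?T)"
    by (rule walk_left[where b = False]) (use T A_row lr row in auto)
  finally have A: "go (Ps1 False False, (xl, y0), ?R \<union> comb h)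
    ((N div 2 ^ i) * (2 * K + 6) + 10 * ?W + 1 + nat (xr + 1 - (xl - 1))) (Rt r' z', (xl - 1, y0 - 1), ?T)" .
  show ?case
  proof (cases "N div 2 ^ i = 0")
    case True
    then have z: "\<not> z'" and Ni: "N < 2 ^ i" using P(4) by (auto simp: div_eq_0_iff)
    note A
    \<comment> \<open>As every step moves, the detour over \<open>Fin\<close> lets the robot halt on
      the least significant base tile.\<close>
    also have "go (Rt r' z', (xl - 1, y0 - 1), ?T) 1 (Fin, (xl - 2, y0 - 1), ?T)"
      by (rule go1) (use T A_row lr row[of "xl - 1"] z in \<open>auto simp: mstep_simps\<close>)
    also have "go (Fin, (xl - 2, y0 - 1), ?T) 1 (Halt, (xl - 1, y0 - 1), ?T)"
      by (rule go1) (use T A_row lr in \<open>auto simp: mstep_simps\<close>)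
    finally have B: "go (Ps1 False False, (xl, y0), ?R \<union> comb h)
      ((N div 2 ^ i) * (2 * K + 6) + 10 * ?W + 1 + nat (xr + 1 - (xl - 1)) + 1 + 1)
      (Halt, (xl - 1, y0 - 1), ?T)" .
    have "1 * (11 * ?W + 2 * L + 20) \<le> (L + 1 - i) * (11 * ?W + 2 * L + 20)"
      by (rule mult_right_mono) (use less.prems in auto)
    moreover have "10 * ?W + 1 + nat (xr + 1 - (xl - 1)) + 1 + 1 \<le> 1 * (11 * ?W + 2 * L + 20)"
      using lr by simp
    ultimately have "(N div 2 ^ i) * (2 * K + 6) + 10 * ?W + 1 + nat (xr + 1 - (xl - 1)) + 1 + 1
      \<le> 2 * (N div 2 ^ i) * (2 * K + 6) + (L + 1 - i) * (11 * ?W + 2 * L + 20)"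
      unfolding True mult_0 mult_0_right add_0 by (rule le_trans[rotated])
    from go_mono[OF B this] show ?thesis
      using less.prems(1) Ni T by (intro exI[of _ i] exI[of _ h']) (simp add: eq)
  next
    case False
    then have z: "z'" and "\<not> N < 2 ^ i" using P(4) by (auto simp: div_eq_0_iff)
    then have iL: "i < L" using assms(2) less.prems(1) by (metis le_neq_implies_less)
    have r: "r' = odd (N div 2 ^ i)"
      using P(3) by (metis even_mult_iff even_add dvd_refl of_bool_eq_iff odd_of_bool_self)
    have half: "N div 2 ^ Suc i = N div 2 ^ i div 2"
      by (simp add: div_mult2_eq power_Suc2 del: power_Suc)
    have s: "(\<Sum>u = xl..xr. h' u) = N div 2 ^ Suc i"
      unfolding half P(3)[symmetric] by (cases r') auto
    have fin: "finite (R0 \<union> comb h' \<union> digits N i)"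
      using T by (simp add: fits_def eq)
    have "card (R0 \<union> comb h' \<union> digits N i) \<le> card (R0 \<union> comb h \<union> digits N i)"
      by (rule card_mono[OF less.prems(4)]) (use ch in auto)
    then have c: "card (R0 \<union> comb h' \<union> digits N i) + 2 * (L - i) \<le> M"
      using less.prems(5) by linarith
    let ?T2 = "R0 \<union> comb h' \<union> digits N (Suc i)"
    have c2: "finite ?T2" "card ?T2 + 2 * (L - Suc i) \<le> M"
    proof -
      have "card ?T2 \<le> card (R0 \<union> comb h' \<union> digits N i) + 2"
      proof -
        have "?T2 \<subseteq> insert (xl - 2 - int i, y0 - 1) (insert (xl - 1 - int i, y0 - 2) (R0 \<union> comb h' \<union> digits N i))"
          by (auto simp: digits_Suc split: if_splits)
        then have "card ?T2 \<le> card (insert (xl - 2 - int i, y0 - 1)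
            (insert (xl - 1 - int i, y0 - 2) (R0 \<union> comb h' \<union> digits N i)))"
          using fin by (intro card_mono) auto
        also have "\<dots> \<le> card (R0 \<union> comb h' \<union> digits N i) + 2"
          using fin by (auto simp: card_insert_if)
        finally show ?thesis .
      qed
      with c iL show "card ?T2 + 2 * (L - Suc i) \<le> M" by linarith
      show "finite ?T2" using fin by (simp add: finite_digits)
    qed
    have "go (Rt r' True, (xl - 1, y0 - 1), R0 \<union> comb h' \<union> digits N i) (2 * i + 6)
      (Ps1 False False, (xl, y0), R0 \<union> comb h' \<union> digits N (Suc i))"
      by (rule append_digit) (use iL r R0_low fin c in \<open>auto simp: comb_def\<close>)
    then have B: "go (Rt r' z', (xl - 1, y0 - 1), ?T) (2 * i + 6) (Ps1 False False, (xl, y0), ?T2)"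
      using z by (simp add: eq)
    have "L - Suc i < L - i" using iL by simp
    then have "\<exists>n h''. n \<le> L \<and> N < 2 ^ n \<and> fits (R0 \<union> comb h'' \<union> digits N n) \<and> go (Ps1 False False, (xl, y0), ?T2)
        (2 * (N div 2 ^ Suc i) * (2 * K + 6) + (L + 1 - Suc i) * (11 * ?W + 2 * L + 20))
        (Halt, (xl - 1, y0 - 1), R0 \<union> comb h'' \<union> digits N n)"
    proof (rule less.hyps)
      show "h' u \<le> hmax u" for u using P(2)[of u] less.prems(2)[of u] by linarith
    qed (use iL s c2 in auto)
    then obtain n h'' where n: "n \<le> L" "N < 2 ^ n" "fits (R0 \<union> comb h'' \<union> digits N n)"
      and C: "go (Ps1 False False, (xl, y0), ?T2)
        (2 * (N div 2 ^ Suc i) * (2 * K + 6) + (L + 1 - Suc i) * (11 * ?W + 2 * L + 20))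
        (Halt, (xl - 1, y0 - 1), R0 \<union> comb h'' \<union> digits N n)"
      by blast
    have h1: "2 * (N div 2 ^ Suc i) \<le> N div 2 ^ i"
      by (simp add: div_mult2_eq power_Suc2 del: power_Suc)
    have h2: "L + 1 - i = Suc (L + 1 - Suc i)" using iL by simp
    have "(N div 2 ^ i) * (2 * K + 6) + 10 * ?W + 1 + nat (xr + 1 - (xl - 1)) + (2 * i + 6) +
       (2 * (N div 2 ^ Suc i) * (2 * K + 6) + (L + 1 - Suc i) * (11 * ?W + 2 * L + 20))
      \<le> 2 * (N div 2 ^ i) * (2 * K + 6) + (L + 1 - i) * (11 * ?W + 2 * L + 20)"
    proof -
      have *: "q + 10 * w + 1 + w' + (2 * i + 6) + (p + c) \<le> 2 * q + (11 * w + 2 * L + 20 + c)"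
        if "p \<le> q" "w' \<le> w + 1" for p q w w' c :: nat
        using that iL by linarith
      show ?thesis
        unfolding h2 mult_Suc mult.assoc[of 2 "N div 2 ^ i"]
        by (rule *) (use mult_right_mono[OF h1, of "2 * K + 6"] lr in auto)
    qed
    from go_mono[OF go_trans[OF go_trans[OF A B] C] this]
    show ?thesis using n by (intro exI[of _ n] exI[of _ h'']) (simp add: eq)
  qed
qed

text \<open>Nothing is written below the last base tile, so bit \<open>n\<close> is zero. The line
  is maximal because the corridor to its right is empty.\<close>

lemma counter:
  assumes "N < 2 ^ n"
  shows "binary_counter (R0 \<union> comb h \<union> digits N n) (xl - 1, y0 - 1) Left Down (Suc n) N"
proof -
  define T where "T = R0 \<union> comb h \<union> digits N n"
  have row: "(u, y0 - 1) \<in> T \<longleftrightarrow> xl - 1 - int n \<le> u \<and> u \<le> xl - 1" for u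
    using mem_digits(1) R0_low[of u "y0 - 1"] by (auto simp: comb_def T_def)
  have bit: "(xl - 1 - int i, y0 - 2) \<in> T \<longleftrightarrow> i < n \<and> odd (N div 2 ^ i)" for i
    using mem_digits(2) R0_low[of "xl - 1 - int i" "y0 - 2"] by (auto simp: comb_def T_def)
  have "N div 2 ^ n = 0" using assms by simp
  then have "(\<Sum>i<Suc n. if i < n \<and> odd (N div 2 ^ i) then 2 ^ i else 0) = N"
    using digit_sum[of N n] assms by simp
  moreover have "q = (xl, y0 - 1)" if "move Left q = (xl - 1, y0 - 1)" for q
    using that by (cases q) auto
  ultimately show ?thesis
    unfolding binary_counter_def perpendicular_def T_def[symmetric]
    by (auto simp: funpow_move bit row simp del: sum.lessThan_Suc)
qed

end

section \<open>Compacting the columns\<close>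

text \<open>A column \<open>x\<close> with a sentinel in row \<open>y0\<close>, a ring tile in row \<open>t\<close> and the tiles \<open>C\<close> in
  between.\<close>

locale sweep_column = arena A M for A M +
  fixes x y0 t :: int and C :: "int set" and R :: "pixel set"
  assumes C: "finite C" "\<And>v. v \<in> C \<Longrightarrow> y0 + 3 \<le> v \<and> v \<le> t - 2"
    and t: "y0 + 2 \<le> t" "(x, t) \<in> R" "(x, y0) \<in> R"
    and R: "\<And>v. y0 < v \<Longrightarrow> v < t \<Longrightarrow> (x, v) \<notin> R" "(x, y0 - 1) \<notin> R"
    and A: "\<And>u v. x \<le> u \<Longrightarrow> u \<le> x + 1 \<Longrightarrow> y0 - 1 \<le> v \<Longrightarrow> v \<le> t + 1 \<Longrightarrow> (u, v) \<in> A"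
    and test_C: "\<And>v. v \<in> C \<Longrightarrow> \<not> ring_test (col R x C) x v"
    and test_t: "ring_test (col R x C) x t"
begin

text \<open>The tiles up to row \<open>z\<close> have been moved to the heap.\<close>

definition swept :: "int \<Rightarrow> pixel set" where
  "swept z = col R x ({y0 + 1..y0 + int (card {v \<in> C. v \<le> z})} \<union> {v \<in> C. z < v})"

text \<open>The tiles start three rows above \<open>y0\<close>, so at most \<open>z - y0 - 2\<close>
  of them lie up to row \<open>z\<close>. The heap thus never reaches a pixel that the ring test at
  the next tile reads.\<close>

lemma heap_bound:
  assumes "z < n" "n \<in> C \<or> n = t"
  shows "int (card {v \<in> C. v \<le> z}) + y0 + 2 \<le> n" "z \<in> C \<Longrightarrow> int (card {v \<in> C. v \<le> z}) + y0 + 2 \<le> z"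
proof -
  have *: "int (card {v \<in> C. v \<le> z}) \<le> max 0 (z - y0 - 2)"
  proof -
    have "card {v \<in> C. v \<le> z} \<le> card {y0 + 3..z}"
      by (rule card_mono) (use C in auto)
    then show ?thesis by auto
  qed
  show "int (card {v \<in> C. v \<le> z}) + y0 + 2 \<le> n"
    using * assms C(2)[of n] t by auto
  show "int (card {v \<in> C. v \<le> z}) + y0 + 2 \<le> z" if "z \<in> C"
    using * C(2)[OF that] by auto
qed

lemma swept_mem:
  assumes "y0 \<le> v" "v \<le> t"
  shows "(x, v) \<in> swept z \<longleftrightarrow> v \<le> y0 + int (card {v \<in> C. v \<le> z}) \<or> v \<in> C \<and> z < v \<or> v = t"
proof -
  have "card {v \<in> C. v \<le> z} = 0 \<or> int (card {v \<in> C. v \<le> z}) + y0 + 2 \<le> t"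
    using heap_bound(1)[of "min z (t - 1)" t]
    using C(2) by (smt (verit, best) Collect_cong)
  then show ?thesis
    unfolding swept_def col_def using assms R(1)[of v] t by (cases "v = y0"; cases "v = t") auto
qed

text \<open>The last assumption says that the tile directly below \<open>n\<close> has not been
  moved away. It might be the only common neighbour of \<open>n\<close> and its lower right
  neighbour; without it, a polyomino tile could look like a ring tile.\<close>

lemma ring_test_swept:
  assumes "z < n" "n \<in> C \<or> n = t" "n - 1 \<in> C \<Longrightarrow> z < n - 1"
  shows "ring_test (swept z) x n = (n = t)"
proof -
  have "(x + 1, v) \<in> swept z \<longleftrightarrow> (x + 1, v) \<in> col R x C" for v
    by (auto simp: swept_def col_def)
  moreover have "(x, n + 1) \<in> swept z \<longleftrightarrow> (x, n + 1) \<in> col R x C"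
    using heap_bound(1)[OF assms(1,2)] assms by (auto simp: swept_def col_def)
  moreover have "(x, n - 1) \<in> swept z \<longleftrightarrow> (x, n - 1) \<in> col R x C"
    using heap_bound(1)[OF assms(1,2)] assms by (auto simp: swept_def col_def)
  ultimately have "ring_test (swept z) x n = ring_test (col R x C) x n"
    unfolding ring_test_def by simp
  then show ?thesis using assms(2) test_C test_t C(2)[of t] by auto
qed

lemma sweep_up:
  assumes "z < n" "n \<in> C \<or> n = t" "\<And>v. z < v \<Longrightarrow> v < n \<Longrightarrow> v \<notin> C" "n - 1 \<in> C \<Longrightarrow> z < n - 1"
    and s: "y0 + int (card {v \<in> C. v \<le> z}) < s" "z < s" "s \<le> n" and f: "fits (swept z)"
  shows "go (Sw3 f, (x, s), swept z) (nat (n - s) + 8)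
    (if n = t then Sw5 f else Car0 True, (x, n - 1), swept z)"
proof -
  have nt: "n \<le> t" using assms(2) C(2)[of n] by auto
  have n: "(x, n) \<in> swept z"
    using swept_mem[of n z] heap_bound[OF assms(1,2)] assms nt by auto
  have "go (Sw3 f, (x, s), swept z) (nat (n - s)) (Sw3 f, (x, n), swept z)"
  proof (rule walk_up[where b = False])
    fix v assume v: "s \<le> v" "v < n"
    then show "((x, v) \<in> swept z) = False \<and> (x, v) \<in> A"
      using swept_mem[of v z] assms(3)[of v] s nt A[of x v] by auto
  qed (use s f in auto)
  also have "go (Sw3 f, (x, n), swept z) 1 (Tst1 (CSweep f), (x + 1, n), swept z)"
    by (rule go1) (use f n A[of x n] s nt in \<open>auto simp: mstep_simps\<close>)
  also have "go (Tst1 (CSweep f), (x + 1, n), swept z) 6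
    (if ring_test (swept z) x n then TR (CSweep f) else TP (CSweep f), (x, n), swept z)"
    by (rule test_ring) (use A s nt f in auto)
  also have "go (if ring_test (swept z) x n then TR (CSweep f) else TP (CSweep f), (x, n), swept z) 1
    (if n = t then Sw5 f else Car0 True, (x, n - 1), swept z)"
    by (rule go1) (use f n A[of x n] s nt ring_test_swept[OF assms(1,2,4)] in \<open>auto simp: mstep_simps\<close>)
  finally show ?thesis by (rule go_mono) simp
qed

lemma swept_step:
  assumes "z < n" "n \<in> C" "\<And>v. z < v \<Longrightarrow> v < n \<Longrightarrow> v \<notin> C"
  shows "insert (x, y0 + int (card {v \<in> C. v \<le> z}) + 1) (swept z) - {(x, n)} = swept n"
    and "card {v \<in> C. v \<le> n} = Suc (card {v \<in> C. v \<le> z})"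
proof -
  have "{v \<in> C. v \<le> n} = insert n {v \<in> C. v \<le> z}"
    using assms(1,2) by (auto simp: not_less[symmetric] dest: assms(3) intro: ccontr)
  then show c: "card {v \<in> C. v \<le> n} = Suc (card {v \<in> C. v \<le> z})"
    using C(1) assms(1) by simp
  have "n < t" "y0 < n" using C(2)[OF assms(2)] by auto
  then have "(x, n) \<notin> R" using R(1) by simp
  moreover have "{v \<in> C. z < v} = insert n {v \<in> C. n < v}"
    using assms(1,2) by (auto simp: not_less[symmetric] dest: assms(3) intro: ccontr)
  moreover have "n \<noteq> y0 + int (card {v \<in> C. v \<le> z}) + 1" "\<not> n \<le> y0 + int (card {v \<in> C. v \<le> z})"
    using heap_bound(1)[OF assms(1)] assms(2) by auto
  moreover have "{y0 + 1..y0 + int (Suc (card {v \<in> C. v \<le> z}))} =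
      insert (y0 + int (card {v \<in> C. v \<le> z}) + 1) {y0 + 1..y0 + int (card {v \<in> C. v \<le> z})}"
    by auto
  ultimately show "insert (x, y0 + int (card {v \<in> C. v \<le> z}) + 1) (swept z) - {(x, n)} = swept n"
    unfolding swept_def col_def c by auto
qed

lemma next_tile:
  assumes "z < t"
  obtains n where "z < n" "n \<in> C \<or> n = t" "\<And>v. z < v \<Longrightarrow> v < n \<Longrightarrow> v \<notin> C"
proof -
  define S where "S = {v \<in> C. z < v} \<union> {t}"
  have "finite S" "S \<noteq> {}" using C(1) by (auto simp: S_def)
  then have m: "Min S \<in> S" "\<And>v. v \<in> S \<Longrightarrow> Min S \<le> v" by auto
  show ?thesis
  proof (rule that[of "Min S"])
    show "z < Min S" "Min S \<in> C \<or> Min S = t" using m(1) assms by (auto simp: S_def)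
    show "v \<notin> C" if "z < v" "v < Min S" for v using m(2)[of v] that by (force simp: S_def)
  qed
qed

text \<open>After a carry the robot stands just above the place of the tile it took. A tile there is
  taken at once, since the ring test would be unreliable; it belongs to \<open>C\<close> because row
  \<open>t\<close> is at least two above \<open>n\<close>. Otherwise the next tile is at least two
  rows above \<open>n\<close>, and the test is sound.\<close>

lemma sweep_carry:
  assumes "z < n" "n \<in> C" "\<And>v. z < v \<Longrightarrow> v < n \<Longrightarrow> v \<notin> C"
    and "y0 + int (card {v \<in> C. v \<le> z}) < s" "s < n" "z \<le> s" and f: "finite (swept z)" "card (swept z) < M"
  shows "go (Car0 True, (x, s), swept z) (card {v \<in> C. z < v} * (3 * nat (t - y0) + 14))
    (Sw5 F2, (x, t - 1), swept t)"
  using assms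
proof (induction "card {v \<in> C. z < v}" arbitrary: z n s rule: less_induct)
  case less
  let ?m = "card {v \<in> C. v \<le> z}"
  have nt: "y0 + 3 \<le> n" "n \<le> t - 2" using C(2) less.prems(2) by auto
  have b: "int ?m + y0 + 2 \<le> n" using heap_bound(1) less.prems by auto
  note st = swept_step[OF less.prems(1-3)]
  have sub: "swept n \<subseteq> insert (x, y0 + int ?m + 1) (swept z - {(x, n)})"
    by (subst st(1)[symmetric]) auto
  have mn: "(x, n) \<in> swept z" using swept_mem[of n z] less.prems(1,2) nt by auto
  have fin: "finite (swept n)" by (rule finite_subset[OF sub]) (use less.prems(7) in simp)
  have "card (swept n) \<le> card (insert (x, y0 + int ?m + 1) (swept z - {(x, n)}))"
    by (rule card_mono[OF _ sub]) (use less.prems(7) in simp)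
  also have "\<dots> \<le> Suc (card (swept z - {(x, n)}))" using less.prems(7) by (simp add: card_insert_if)
  also have "\<dots> = card (swept z)"
    by (rule card_Suc_Diff1[OF less.prems(7) mn])
  finally have f': "finite (swept n)" "card (swept n) < M" "fits (swept n)"
    using less.prems(8) fin by (auto simp: fits_def)
  have c1: "go (Car0 True, (x, s), swept z) (2 * nat (n - (y0 + int ?m + 1)) + 3)
    (if True then Sw4 else Hv0 True, (x, n + 1), insert (x, y0 + int ?m + 1) (swept z) - {(x, n)})"
  proof (rule carry)
    show "(x, y0 + int ?m + 1 - 1) \<in> swept z" using swept_mem[of "y0 + int ?m" z] b nt by auto
    show "(x, n) \<in> swept z" using swept_mem[of n z] less.prems nt by auto
    show "(x, v) \<notin> swept z" if "y0 + int ?m + 1 \<le> v" "v < n" for v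
      using swept_mem[of v z] less.prems(3)[of v] that nt by auto
    show "(x, v) \<in> A" if "y0 + int ?m + 1 - 1 \<le> v" "v \<le> n" for v
      using A[of x v] that nt by auto
  qed (use less.prems in auto)
  have "2 * nat (n - (y0 + int ?m + 1)) + 3 \<le> 2 * nat (t - y0) + 3" using nt by simp
  from go_weaken[OF c1 this] have c1: "go (Car0 True, (x, s), swept z) (2 * nat (t - y0) + 3) (Sw4, (x, n + 1), swept n)"
    using st(1) by simp
  have "{v \<in> C. z < v} = insert n {v \<in> C. n < v}"
    using less.prems(1,2) by (auto simp: not_less[symmetric] dest: less.prems(3) intro: ccontr)
  then have card: "card {v \<in> C. z < v} = Suc (card {v \<in> C. n < v})" using C(1) by simp
  have n1: "(x, n + 1) \<in> swept n \<longleftrightarrow> n + 1 \<in> C"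
    using swept_mem[of "n + 1" n] nt b st(2) by auto
  have An: "(x, n + 1) \<in> A" using A nt by auto
  show ?case
  proof (cases "n + 1 \<in> C")
    case True
    have "go (Sw4, (x, n + 1), swept n) 1 (Car0 True, (x, n), swept n)"
      by (rule go1) (use f' An n1 True in \<open>auto simp: mstep_simps\<close>)
    from go_trans[OF c1 this] have c2: "go (Car0 True, (x, s), swept z) (2 * nat (t - y0) + 3 + 1) (Car0 True, (x, n), swept n)" .
    have "go (Car0 True, (x, n), swept n) (card {v \<in> C. n < v} * (3 * nat (t - y0) + 14)) (Sw5 F2, (x, t - 1), swept t)"
      by (rule less.hyps[where n = "n + 1"]) (use card True f' b st(2) in auto)
    from go_mono[OF go_trans[OF c2 this]] show ?thesis unfolding card mult_Suc by simp
  next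
    case False
    obtain k where k: "n < k" "k \<in> C \<or> k = t" "\<And>v. n < v \<Longrightarrow> v < k \<Longrightarrow> v \<notin> C"
      using next_tile[of n] nt by auto
    have k1: "n + 1 < k" using k(1,2) False nt by (cases "k = n + 1") auto
    have kt: "k \<le> t" using k(2) C(2)[of k] by auto
    have "go (Sw4, (x, n + 1), swept n) 1 (Sw3 F2, (x, n + 2), swept n)"
      by (rule go1) (use f' An n1 False in \<open>auto simp: mstep_simps\<close>)
    from go_trans[OF c1 this] have c2: "go (Car0 True, (x, s), swept z) (2 * nat (t - y0) + 3 + 1) (Sw3 F2, (x, n + 2), swept n)" .
    have "go (Sw3 F2, (x, n + 2), swept n) (nat (k - (n + 2)) + 8)
      (if k = t then Sw5 F2 else Car0 True, (x, k - 1), swept n)"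
      by (rule sweep_up) (use k k1 f' b st(2) in auto)
    from go_trans[OF c2 this] have c3: "go (Car0 True, (x, s), swept z)
      (2 * nat (t - y0) + 3 + 1 + (nat (k - (n + 2)) + 8))
      (if k = t then Sw5 F2 else Car0 True, (x, k - 1), swept n)" .
    \<comment> \<open>The factor 3: down and up for the carry, and once more up for the search of
      the next tile.\<close>
    have le: "2 * nat (t - y0) + 3 + 1 + (nat (k - (n + 2)) + 8) \<le> 3 * nat (t - y0) + 14"
      using kt nt by auto
    note c3 = go_mono[OF c3 le]
    show ?thesis
    proof (cases "k = t")
      case True
      then have "{v \<in> C. n < v} = {}" using k(3) C(2) by force
      then have e: "{v \<in> C. t < v} = {}" "{v \<in> C. v \<le> n} = {v \<in> C. v \<le> t}" "{v \<in> C. n < v} = {}" using nt by force+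
      have "swept n = swept t" unfolding swept_def e by simp
      with c3 True show ?thesis unfolding card mult_Suc by (auto elim: go_mono)
    next
      case False
      then have kC: "k \<in> C" using k by auto
      have "go (Car0 True, (x, k - 1), swept n) (card {v \<in> C. n < v} * (3 * nat (t - y0) + 14)) (Sw5 F2, (x, t - 1), swept t)"
        by (rule less.hyps[where n = k]) (use card kC k k1 f' b st(2) in auto)
      with c3 False show ?thesis unfolding card mult_Suc by (auto intro: go_trans)
    qed
  qed
qed

lemma card_heap:
  assumes "finite (col R x C)"
  shows "card (col R x {y0 + 1..y0 + int (card C)}) \<le> card (col R x C)"
proof -
  have "card (Pair x ` {y0 + 1..y0 + int (card C)}) = card (Pair x ` C)"
    by (simp add: card_image inj_on_def)
  moreover have "R \<inter> Pair x ` C = {}" using R(1) C(2) by force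
  moreover have "finite R" using assms by (simp add: col_def)
  ultimately show ?thesis
    unfolding col_def using C(1) card_Un_le[of R "Pair x ` {y0 + 1..y0 + int (card C)}"]
    by (simp add: card_Un_disjoint)
qed

text \<open>\<open>Sw1\<close> and \<open>Sw2\<close> lay the floor: whichever of the rows
  \<open>y0\<close> and \<open>y0 + 1\<close> held the lower ring tile, afterwards it is in row
  \<open>y0\<close>.\<close>

lemma sweep_one:
  fixes f :: phase
  assumes T0: "insert (x, y0) T0 - {(x, y0 + 1)} = col R x C" "(x, y0 - 1) \<notin> T0"
    and f: "finite T0" "card T0 + 2 \<le> M"
    and r: "(x + 1, y0 - 1) \<notin> R"
  defines "f' \<equiv> (if C = {} then f else F2)"
  shows "go (Sw0 f, (x, y0 - 1), T0) ((card C + 1) * (3 * nat (t - y0) + 20))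
    (if f' = F1 then (Bk, (x, y0 - 1), R - {(x, y0)})
     else (Sw0 (if f' = F0 then F0 else F1), (x + 1, y0 - 1), col R x {y0 + 1..y0 + int (card C)}))"
proof -
  let ?T1 = "insert (x, y0) T0"
  have z: "{v \<in> C. v \<le> y0 + 1} = {}" "{v \<in> C. y0 + 1 < v} = C" using C(2) by force+
  have z0: "card {v \<in> C. v \<le> y0 + 1} = 0" unfolding z by simp
  have S0: "swept (y0 + 1) = col R x C" unfolding swept_def z by simp
  have f1: "finite ?T1" "card ?T1 < M" using f by (auto simp: card_insert_if)
  then have fT1: "fits ?T1" by (simp add: fits_def)
  have fS: "finite (col R x C)" "card (col R x C) < M"
    unfolding T0(1)[symmetric] using f1 card_Diff1_le[of ?T1 "(x, y0 + 1)"] by auto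
  then have fitS: "fits (col R x C)" by (simp add: fits_def)
  have "go (Sw0 f, (x, y0 - 1), T0) 1 (Sw1 f, (x, y0), T0)"
    by (rule go1) (use A[of x "y0 - 1"] t f T0 in \<open>auto simp: mstep_simps fits_def\<close>)
  also have "go (Sw1 f, (x, y0), T0) 1 (Sw2 f, (x, y0 + 1), ?T1)"
    by (rule go1) (use A[of x y0] t f in \<open>auto simp: mstep_def fits_def\<close>)
  also have "go (Sw2 f, (x, y0 + 1), ?T1) 1 (Sw3 f, (x, y0 + 2), swept (y0 + 1))"
    by (rule go1) (use A[of x "y0 + 1"] t fT1 in \<open>auto simp: mstep_def T0(1)[symmetric] S0\<close>)
  finally have a1: "go (Sw0 f, (x, y0 - 1), T0) (1 + 1 + 1) (Sw3 f, (x, y0 + 2), swept (y0 + 1))" .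
  obtain k where k: "y0 + 1 < k" "k \<in> C \<or> k = t" "\<And>v. y0 + 1 < v \<Longrightarrow> v < k \<Longrightarrow> v \<notin> C"
    using next_tile[of "y0 + 1"] t by auto
  have kt: "k \<le> t" using k(2) C(2)[of k] by auto
  have a2: "go (Sw3 f, (x, y0 + 2), swept (y0 + 1)) (nat (k - (y0 + 2)) + 8)
    (if k = t then Sw5 f else Car0 True, (x, k - 1), swept (y0 + 1))"
    by (rule sweep_up) (use k fitS S0 z0 C(2)[of "k - 1"] in auto)
  have D: "nat (k - (y0 + 2)) \<le> nat (t - y0)" using kt by auto
  have St: "swept t = col R x {y0 + 1..y0 + int (card C)}"
  proof -
    have e: "{v \<in> C. v \<le> t} = C" "{v \<in> C. t < v} = {}" using C(2) by force+
    show ?thesis unfolding swept_def e by simp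
  qed
  have a3: "go (Sw0 f, (x, y0 - 1), T0) (card C * (3 * nat (t - y0) + 14) + nat (t - y0) + 11)
    (Sw5 f', (x, t - 1), swept t) \<and> fits (swept t)"
  proof (cases "C = {}")
    case True
    then have kt: "k = t" "f' = f" using k by (auto simp: f'_def)
    have "swept (y0 + 1) = swept t" using S0 St True by (simp add: col_def)
    with go_mono[OF go_trans[OF a1 a2]] fitS S0 kt D show ?thesis by (auto elim: go_mono)
  next
    case False
    then have f': "f' = F2" by (auto simp: f'_def)
    have "k \<in> C"
    proof (rule ccontr)
      assume "k \<notin> C"
      then have "k = t" using k by auto
      then show False using k(3) False C(2) by force
    qed
    moreover from this have "k \<noteq> t" using C(2)[of k] by auto
    moreover have "go (Car0 True, (x, k - 1), swept (y0 + 1)) (card {v \<in> C. y0 + 1 < v} * (3 * nat (t - y0) + 14))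
      (Sw5 F2, (x, t - 1), swept t)"
      by (rule sweep_carry) (use \<open>k \<in> C\<close> k z0 C(2)[of k] fS S0 in auto)
    ultimately have b: "go (Sw0 f, (x, y0 - 1), T0)
      (1 + 1 + 1 + (nat (k - (y0 + 2)) + 8) + card C * (3 * nat (t - y0) + 14)) (Sw5 F2, (x, t - 1), swept t)"
      using go_trans[OF go_trans[OF a1 a2]] z by auto
    have "go (Sw0 f, (x, y0 - 1), T0) (card C * (3 * nat (t - y0) + 14) + nat (t - y0) + 11)
       (Sw5 f', (x, t - 1), swept t)"
      unfolding f' by (rule go_mono[OF b]) (use D in auto)
    moreover have "fits (swept t)"
    proof -
      have "finite R" using fS by (simp add: col_def)
      then show ?thesis using fS card_heap by (simp add: fits_def St col_def)
    qed
    ultimately show ?thesis by blast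
  qed
  then have fits: "fits (swept t)" by blast
  have cb: "int (card C) + y0 + 2 \<le> t"
  proof -
    have "{v \<in> C. v \<le> t - 1} = C" using C(2) by force
    then show ?thesis using heap_bound(1)[of "t - 1" t] by simp
  qed
  have mem: "(x, v) \<in> swept t \<longleftrightarrow> v \<le> y0 + int (card C) \<or> v = t" if "y0 \<le> v" "v \<le> t" for v
  proof -
    have "{v \<in> C. v \<le> t} = C" "{v \<in> C. t < v} = {}" using C(2) by force+
    then show ?thesis using swept_mem[OF that, of t] that by auto
  qed
  have low: "(x, y0 - 1) \<notin> swept t" using R(2) by (auto simp: St col_def)
  have low': "(x + 1, y0 - 1) \<notin> swept t" using r by (auto simp: St col_def)
  let ?h = "y0 + int (card C)"
  note a3[THEN conjunct1]
  also have "go (Sw5 f', (x, t - 1), swept t) (nat (t - 1 - ?h)) (Sw5 f', (x, ?h), swept t)"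
    by (rule walk_down[where b = False]) (use mem cb A fits in auto)
  finally have a4: "go (Sw0 f, (x, y0 - 1), T0)
    (card C * (3 * nat (t - y0) + 14) + nat (t - y0) + 11 + nat (t - 1 - ?h)) (Sw5 f', (x, ?h), swept t)" .
  have hm: "(x, ?h) \<in> swept t" "(x, ?h) \<in> A" using mem[of ?h] cb A[of x ?h] by auto
  show ?thesis
  proof (cases "f' = F1")
    \<comment> \<open>The heap is empty, so the first tile met on the way down is the floor;
      removing it makes the hole that ends later passes.\<close>
    case True
    then have C0: "C = {}" by (auto simp: f'_def split: if_splits)
    note a4
    also have "go (Sw5 f', (x, ?h), swept t) 1 (Bk, (x, y0 - 1), R - {(x, y0)})"
      by (rule go1) (use hm fits True C0 St in \<open>auto simp: mstep_def col_def\<close>)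
    finally show ?thesis using True C0 by (auto elim!: go_mono)
  next
    case False
    note a4
    also have "go (Sw5 f', (x, ?h), swept t) 1 (Sw6 f', (x, ?h - 1), swept t)"
      by (rule go1) (use hm fits False in \<open>auto simp: mstep_simps\<close>)
    also have "go (Sw6 f', (x, ?h - 1), swept t) (nat (?h - 1 - (y0 - 1))) (Sw6 f', (x, y0 - 1), swept t)"
      by (rule walk_down[where b = True]) (use mem cb A fits in auto)
    also have "go (Sw6 f', (x, y0 - 1), swept t) 1 (Sw0 (if f' = F0 then F0 else F1), (x + 1, y0 - 1), swept t)"
      by (rule go1) (use low fits A[of x "y0 - 1"] t in \<open>auto simp: mstep_simps\<close>)
    finally have a5: "go (Sw0 f, (x, y0 - 1), T0)
      (card C * (3 * nat (t - y0) + 14) + nat (t - y0) + 11 + nat (t - 1 - ?h) + 1 + nat (?h - 1 - (y0 - 1)) + 1)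
      (Sw0 (if f' = F0 then F0 else F1), (x + 1, y0 - 1), swept t)" .
    have "card C * (3 * nat (t - y0) + 14) + nat (t - y0) + 11 + nat (t - 1 - ?h) + 1 + nat (?h - 1 - (y0 - 1)) + 1
      \<le> (card C + 1) * (3 * nat (t - y0) + 20)"
      using cb by (simp add: distrib_left)
    from go_mono[OF a5 this] show ?thesis unfolding St using False by simp
  qed
qed

end

section \<open>Polyominoes in a box\<close>

lemma adjacent_fst: "adjacent p q \<Longrightarrow> \<bar>fst p - fst q\<bar> \<le> 1"
  unfolding adjacent_def by arith

text \<open>A discrete intermediate value argument: along a path the column changes by at most one
  per step.\<close>

lemma linked_columns:
  assumes "(p, q) \<in> linked_in P" "p \<in> P" "fst p \<le> x" "x \<le> fst q"
  shows "\<exists>v. (x, v) \<in> P"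
  using assms(1,4) unfolding linked_in_def
proof (induction rule: rtrancl_induct)
  case base
  then have "x = fst p" using assms(3) by simp
  then show ?case using assms(2) by (metis prod.collapse)
next
  case (step q r)
  have r: "r \<in> P" "\<bar>fst q - fst r\<bar> \<le> 1" using step(2) adjacent_fst by auto
  show ?case
  proof (cases "x \<le> fst q")
    case True
    then show ?thesis by (rule step.IH)
  next
    case False
    then have "x = fst r" using r step.prems by linarith
    then show ?thesis using r by (metis prod.collapse)
  qed
qed

text \<open>Coordinates of a box whose inner lane runs around the rectangle from
  \<open>(a, c)\<close> to \<open>(b, d)\<close>. Parity fixes the ring except next to the outer
  corners, where it may cut the corner or make a detour over two outer pixels;
  \<open>corners\<close> says that these two occur together.\<close>

locale boxed =
  fixes P B :: "pixel set" and a b c d :: int and e :: bool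
  assumes poly: "polyomino P" and B_finite: "finite B"
    and P_in: "\<And>x y. (x, y) \<in> P \<Longrightarrow> a + 2 \<le> x \<and> x \<le> b - 2 \<and> c + 2 \<le> y \<and> y \<le> d - 2"
    and B_only: "\<And>x y. (x, y) \<in> B \<Longrightarrow> even (x + y) = e \<and> a - 1 \<le> x \<and> x \<le> b + 1 \<and>
      c - 1 \<le> y \<and> y \<le> d + 1 \<and> \<not> (a < x \<and> x < b \<and> c < y \<and> y < d) \<and>
      \<not> ((x = a - 1 \<or> x = b + 1) \<and> (y = c - 1 \<or> y = d + 1))"
    and B_in: "\<And>x y. even (x + y) = e \<Longrightarrow>
      a \<le> x \<and> x \<le> b \<and> (y = c \<or> y = d) \<or> a < x \<and> x < b \<and> (y = c - 1 \<or> y = d + 1) \<or>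
      c \<le> y \<and> y \<le> d \<and> (x = a \<or> x = b) \<or> c < y \<and> y < d \<and> (x = a - 1 \<or> x = b + 1) \<Longrightarrow> (x, y) \<in> B"
    and corners: "(a - 1, c) \<in> B \<longleftrightarrow> (a, c - 1) \<in> B" "(b + 1, c) \<in> B \<longleftrightarrow> (b, c - 1) \<in> B"
      "(a - 1, d) \<in> B \<longleftrightarrow> (a, d + 1) \<in> B"
begin

lemma P_finite: "finite P" and P_ne: "P \<noteq> {}"
  using poly by (auto simp: polyomino_def)

lemma P_diag:
  assumes "(x, y) \<in> P" "(x + 1, y') \<in> P" "\<bar>y - y'\<bar> = 1"
  shows "(x + 1, y) \<in> P \<or> (x, y') \<in> P"
proof -
  have "diagonal_pair (x, y) (x + 1, y')" using assms(3) by (simp add: diagonal_pair_def)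
  then obtain r where r: "r \<in> P" "adjacent r (x, y)" "adjacent r (x + 1, y')"
    using poly assms unfolding polyomino_def by blast
  obtain u v where uv: "r = (u, v)" by (cases r)
  have "\<bar>u - x\<bar> + \<bar>v - y\<bar> = 1" "\<bar>u - (x + 1)\<bar> + \<bar>v - y'\<bar> = 1"
    using r by (auto simp: adjacent_def uv)
  then have "u = x + 1 \<and> v = y \<or> u = x \<and> v = y'"
    using assms(3) by (smt (verit))
  then show ?thesis using r uv by auto
qed

lemma box_size: "a + 4 \<le> b" "c + 4 \<le> d"
proof -
  obtain x y where "(x, y) \<in> P" using P_ne by auto
  from P_in[OF this] show "a + 4 \<le> b" "c + 4 \<le> d" by auto
qed

lemma P_column: "xmin P \<le> x \<Longrightarrow> x \<le> xmax P \<Longrightarrow> \<exists>v. (x, v) \<in> P"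
proof -
  assume x: "xmin P \<le> x" "x \<le> xmax P"
  have "xmin P \<in> fst ` P" "xmax P \<in> fst ` P"
    unfolding xmin_def xmax_def using P_finite P_ne by auto
  then obtain p q where "p \<in> P" "fst p = xmin P" "q \<in> P" "fst q = xmax P" by auto
  then show ?thesis using linked_columns[of p q P x] poly x by (auto simp: polyomino_def)
qed

lemma x_range: "(x, y) \<in> P \<Longrightarrow> xmin P \<le> x \<and> x \<le> xmax P"
  unfolding xmin_def xmax_def using P_finite by (auto intro!: Min_le Max_ge simp: image_iff Bex_def)

lemma x_bounds: "a + 2 \<le> xmin P" "xmax P \<le> b - 2" "xmin P \<le> xmax P"
proof -
  have "xmin P \<in> fst ` P" "xmax P \<in> fst ` P"
    unfolding xmin_def xmax_def using P_finite P_ne by auto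
  then show "a + 2 \<le> xmin P" "xmax P \<le> b - 2" using P_in by auto
  show "xmin P \<le> xmax P" using P_ne x_range by (metis all_not_in_conv order_trans prod.collapse)
qed

definition colh :: "int \<Rightarrow> nat" where
  "colh u = card {v. (u, v) \<in> P}"

lemma finite_column: "finite {v. (u, v) \<in> P}"
  by (rule finite_subset[of _ "snd ` P"]) (use P_finite in force)+

lemma colh_le: "colh u \<le> nat (d - c - 3)"
proof -
  have "colh u \<le> card {c + 2..d - 2}"
    unfolding colh_def by (rule card_mono) (use P_in in auto)
  then show ?thesis by simp
qed

lemma sum_colh:
  assumes "l \<le> xmin P" "xmax P \<le> r"
  shows "(\<Sum>u = l..r. colh u) = card P"
proof -
  have "P = (SIGMA u:{l..r}. {v. (u, v) \<in> P})"
    using x_range assms by force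
  then have "card P = card (SIGMA u:{l..r}. {v. (u, v) \<in> P})" by simp
  also have "\<dots> = (\<Sum>u = l..r. colh u)"
    unfolding colh_def by (rule card_SigmaI) (use finite_column in auto)
  finally show ?thesis by simp
qed

text \<open>The strip to the left of the lower side is room for the counter; \<open>L\<close> will
  bound the number of digits.\<close>

definition area :: "nat \<Rightarrow> pixel set" where
  "area L = {(x, y). a - 4 \<le> x \<and> x \<le> b + 4 \<and> c - 4 \<le> y \<and> y \<le> d + 4 \<or>
     a - 4 - int L \<le> x \<and> x \<le> b + 4 \<and> c - 4 \<le> y \<and> y \<le> c}"

end

section \<open>The sweep over all columns of the box\<close>

locale boxed_run = boxed P B a b c d e for P B a b c d e +
  fixes L M :: nat

sublocale boxed_run \<subseteq> arena "area L" M .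

context boxed_run
begin

lemma in_area: "a - 4 \<le> x \<Longrightarrow> x \<le> b + 4 \<Longrightarrow> c - 4 \<le> y \<Longrightarrow> y \<le> d + 4 \<Longrightarrow> (x, y) \<in> area L"
  by (simp add: area_def)

text \<open>The ring is too far away to supply the diagonal neighbour, so that one lies in
  \<open>P\<close>, and the diagonal condition on polyominoes gives a common neighbour. The vertical
  neighbours must still be in place for the test to see it.\<close>

lemma P_not_ring:
  assumes "(x, y) \<in> P" and "\<And>v. (x + 1, v) \<in> T \<longleftrightarrow> (x + 1, v) \<in> P \<union> B"
    and "(x, y + 1) \<in> P \<Longrightarrow> (x, y + 1) \<in> T" "(x, y - 1) \<in> P \<Longrightarrow> (x, y - 1) \<in> T"
  shows "\<not> ring_test T x y"
proof -
  have "(x + 1, v) \<notin> B" if "y - 1 \<le> v" "v \<le> y + 1" for v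
    using P_in[OF assms(1)] B_only[of "x + 1" v] that by auto
  then show ?thesis
    using P_diag[OF assms(1), of "y + 1"] P_diag[OF assms(1), of "y - 1"] assms(2-4)
    unfolding ring_test_def by auto
qed

text \<open>\<open>(x + 1, y)\<close> has the wrong parity for the ring and is too close to it for
  the polyomino.\<close>

lemma B_ring:
  assumes "(x, y) \<in> B" and "\<And>v. (x + 1, v) \<in> T \<longleftrightarrow> (x + 1, v) \<in> P \<union> B"
    and "(x, y + 1) \<notin> T" "(x, y - 1) \<notin> T" and "(x + 1, y + 1) \<in> B \<or> (x + 1, y - 1) \<in> B"
  shows "ring_test T x y"
proof -
  have "(x + 1, y) \<notin> B" using B_only[OF assms(1)] B_only[of "x + 1" y] by auto
  moreover have "(x + 1, y) \<notin> P" using B_only[OF assms(1)] P_in[of "x + 1" y] by auto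
  moreover have "(x + 1, y + 1) \<notin> P" using B_only[OF assms(1)] P_in[of "x + 1" "y + 1"] by auto
  ultimately show ?thesis using assms(2-5) unfolding ring_test_def by auto
qed

text \<open>The row in which the upward search ends. If the sweep starts in column \<open>a\<close>,
  then \<open>(a, c - 1)\<close> is a ring tile, hence by parity also \<open>(a, c + 1)\<close>, and
  the left side already stops the search. In later columns the upper side does.\<close>

definition ring_top :: "int \<Rightarrow> int" where
  "ring_top x = (if x = a then c + 1 else if even (x + d) = e then d else d + 1)"

text \<open>The grid when the robot enters column \<open>x\<close>. The extra tile at
  \<open>(l - 1, c - 2)\<close> is the first base tile of the counter.\<close>

definition sweeping :: "int \<Rightarrow> int \<Rightarrow> pixel set" where
  "sweeping l x = insert (l - 1, c - 2) {(u, v).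
     if l \<le> u \<and> u < x then c - 1 \<le> v \<and> v \<le> c - 1 + int (colh u) \<or> (u, v) \<in> B \<and> c < v
     else (u, v) \<in> P \<union> B}"

text \<open>Where \<open>navigate\<close> ends. The column varies with the parity and with the way
  in which the ring turns at the lower left corner.\<close>

definition start_col :: "int \<Rightarrow> bool" where
  "start_col l \<longleftrightarrow> a \<le> l \<and> l \<le> a + 2 \<and> (l, c - 1) \<in> B"

text \<open>Parity puts exactly one ring tile into the two lower rows. In column \<open>a\<close>,
  where the ring may cut the corner, \<open>start_col\<close> supplies it.\<close>

lemma column_tiles:
  assumes l: "start_col l" "l \<le> x" "x < b"
  shows "(x, ring_top x) \<in> B" "c + 1 \<le> ring_top x" "ring_top x \<le> d + 1"
    "\<And>v. (x, v) \<in> B \<Longrightarrow> c < v \<Longrightarrow> ring_top x \<le> v"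
    "(x, c - 1) \<in> B \<longleftrightarrow> (x, c) \<notin> B"
    "\<And>v. (x, v) \<in> P \<Longrightarrow> v \<le> ring_top x - 2"
proof -
  note bs = box_size
  have lB: "even (l + (c - 1)) = e" using l(1) B_only unfolding start_col_def by blast
  have xa: "a \<le> x" using l by (auto simp: start_col_def)
  show 1: "(x, ring_top x) \<in> B"
  proof (cases "x = a")
    case True
    then have "l = a" using l by (auto simp: start_col_def)
    then show ?thesis using True lB bs by (intro B_in) (auto simp: ring_top_def)
  next
    case False
    then show ?thesis using xa l bs by (intro B_in) (auto simp: ring_top_def)
  qed
  show "c + 1 \<le> ring_top x" "ring_top x \<le> d + 1" using bs by (auto simp: ring_top_def)
  show "ring_top x \<le> v" if "(x, v) \<in> B" "c < v" for v
  proof (rule ccontr)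
    assume "\<not> ring_top x \<le> v"
    then show False using B_only[OF that(1)] that(2) xa l(3)
      by (cases "v = d") (auto simp: ring_top_def split: if_splits)
  qed
  show "(x, c - 1) \<in> B \<longleftrightarrow> (x, c) \<notin> B"
  proof (cases "x = a")
    case True
    then have "l = a" using l by (auto simp: start_col_def)
    then have "(x, c - 1) \<in> B" using True l(1) by (auto simp: start_col_def)
    then show ?thesis using B_only[of x c] B_only[of x "c - 1"] by auto
  next
    case False
    show ?thesis
    proof (cases "even (x + c) = e")
      case True
      then have "(x, c) \<in> B" using xa l(3) by (intro B_in) auto
      then show ?thesis using B_only[of x "c - 1"] True by auto
    next
      case no: False
      then have "(x, c - 1) \<in> B" using xa l(3) False by (intro B_in) auto
      then show ?thesis using B_only[of x c] no by auto
    qed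
  qed
  show "v \<le> ring_top x - 2" if "(x, v) \<in> P" for v
    using P_in[OF that] by (auto simp: ring_top_def)
qed

text \<open>Supplies the diagonal neighbour on the right on which a positive ring test
  depends.\<close>

lemma ring_top_next:
  assumes l: "start_col l" "l \<le> x" "x < b"
  shows "(x + 1, ring_top x + 1) \<in> B \<or> (x + 1, ring_top x - 1) \<in> B"
proof -
  note bs = box_size
  have top: "even (x + ring_top x) = e" using column_tiles(1)[OF l] B_only by blast
  have xa: "a \<le> x" using l by (auto simp: start_col_def)
  show ?thesis
  proof (cases "x = a")
    case True
    have "(x + 1, ring_top x - 1) \<in> B" by (rule B_in) (use True bs top in \<open>auto simp: ring_top_def\<close>)
    then show ?thesis ..
  next
    case False
    show ?thesis
    proof (cases "ring_top x = d + 1")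
      case True
      have "(x + 1, ring_top x - 1) \<in> B"
        by (rule B_in) (use True xa l bs top in auto)
      then show ?thesis ..
    next
      case no: False
      then have d: "ring_top x = d" using False by (auto simp: ring_top_def split: if_splits)
      show ?thesis
      proof (cases "x + 1 = b")
        case True
        have "(x + 1, ring_top x - 1) \<in> B" by (rule B_in) (use True d bs top in auto)
        then show ?thesis ..
      next
        case False
        have "(x + 1, ring_top x + 1) \<in> B" by (rule B_in) (use False d xa l(3) bs top in auto)
        then show ?thesis ..
      qed
    qed
  qed
qed

text \<open>Turns the global picture into an instance of \<open>sweep_column\<close> with floor row
  \<open>c - 1\<close>. Laying the floor keeps the number of tiles because exactly one of the rows
  \<open>c - 1\<close> and \<open>c\<close> was occupied.\<close>

lemma sweep_at:
  assumes l: "start_col l" "l \<le> x" "x < b"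
    and f: "finite (sweeping l x)" "card (sweeping l x) + 2 \<le> M"
  defines "C \<equiv> {v. (x, v) \<in> P}"
    and "R \<equiv> insert (x, c - 1) {(u, v) \<in> sweeping l x. \<not> (u = x \<and> c - 1 \<le> v \<and> v < ring_top x)}"
  shows "sweep_column (area L) x (c - 1) (ring_top x) C R"
    and "insert (x, c - 1) (sweeping l x) - {(x, c - 1 + 1)} = col R x C"
    and "col R x {c - 1 + 1..c - 1 + int (card C)} = sweeping l (x + 1)"
    and "card (insert (x, c - 1) (sweeping l x) - {(x, c - 1 + 1)}) = card (sweeping l x)"
    and "(x, c - 1 - 1) \<notin> sweeping l x" "(x + 1, c - 1 - 1) \<notin> R"
proof -
  note bs = box_size
  note ct = column_tiles[OF l]
  have xa: "a \<le> x" using l by (auto simp: start_col_def)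
  have memx: "(x, v) \<in> sweeping l x \<longleftrightarrow> (x, v) \<in> P \<union> B" for v
    using l by (auto simp: sweeping_def)
  have memx1: "(x + 1, v) \<in> sweeping l x \<longleftrightarrow> (x + 1, v) \<in> P \<union> B" for v
    using l by (auto simp: sweeping_def)
  have Bx: "(x, v) \<in> B \<Longrightarrow> v < ring_top x \<Longrightarrow> v = c - 1 \<or> v = c" for v
    using ct(4)[of v] B_only[of x v] by force
  have low: "(u, c - 2) \<notin> P \<union> B" for u using P_in[of u "c - 2"] B_only[of u "c - 2"] by auto
  show e1: "insert (x, c - 1) (sweeping l x) - {(x, c - 1 + 1)} = col R x C"
  proof (rule set_eqI, clarify)
    fix u v
    show "((u, v) \<in> insert (x, c - 1) (sweeping l x) - {(x, c - 1 + 1)}) = ((u, v) \<in> col R x C)"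
    proof (cases "u = x")
      case True
      have "c < ring_top x" using ct(2) by simp
      then show ?thesis
        using True memx[of v] Bx[of v] ct(6)[of v] P_in[of x v] B_only[of x v]
        unfolding col_def R_def C_def by auto
    next
      case False
      then show ?thesis unfolding col_def R_def C_def by auto
    qed
  qed
  have cardC: "card C = colh x" by (simp add: C_def colh_def)
  have chl: "int (colh x) + c - 1 < ring_top x"
  proof (cases "x = a")
    case True
    then have "C = {}" using P_in[of x] by (auto simp: C_def)
    then show ?thesis using cardC ct(2) by simp
  next
    case False
    then show ?thesis using colh_le[of x] bs by (auto simp: ring_top_def)
  qed
  show "col R x {c - 1 + 1..c - 1 + int (card C)} = sweeping l (x + 1)"
  proof (rule set_eqI, clarify)
    fix u v
    show "((u, v) \<in> col R x {c - 1 + 1..c - 1 + int (card C)}) = ((u, v) \<in> sweeping l (x + 1))"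
    proof (cases "u = x")
      case True
      have "(x, v) \<in> R \<longleftrightarrow> v = c - 1 \<or> (x, v) \<in> B \<and> c < v"
        unfolding R_def using memx[of v] ct(2) ct(4)[of v] ct(6)[of v] B_only[of x v] P_in[of x v] by auto
      then have "(x, v) \<in> col R x {c - 1 + 1..c - 1 + int (card C)} \<longleftrightarrow>
          c - 1 \<le> v \<and> v \<le> c - 1 + int (colh x) \<or> (x, v) \<in> B \<and> c < v"
        unfolding col_def cardC by auto
      then show ?thesis using True l by (auto simp: sweeping_def)
    next
      case False
      have "(u, v) \<in> sweeping l x \<longleftrightarrow> (u, v) \<in> sweeping l (x + 1)"
        using False by (auto simp: sweeping_def)
      then show ?thesis using False unfolding col_def R_def by auto
    qed
  qed
  show "card (insert (x, c - 1) (sweeping l x) - {(x, c - 1 + 1)}) = card (sweeping l x)"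
  proof (cases "(x, c) \<in> B")
    case True
    then have "(x, c) \<in> sweeping l x" "(x, c - 1) \<notin> sweeping l x"
      using memx ct(5) P_in[of x "c - 1"] by auto
    then show ?thesis using f by simp
  next
    case False
    then have "(x, c) \<notin> sweeping l x" "(x, c - 1) \<in> sweeping l x"
      using memx ct(5) P_in[of x c] by auto
    then show ?thesis by (simp add: insert_absorb)
  qed
  show low1: "(x, c - 1 - 1) \<notin> sweeping l x" using memx[of "c - 2"] low by simp
  show low2: "(x + 1, c - 1 - 1) \<notin> R" using memx1[of "c - 2"] low by (auto simp: R_def)
  have colx1: "(x + 1, v) \<in> col R x C \<longleftrightarrow> (x + 1, v) \<in> P \<union> B" for v
    using memx1[of v] unfolding col_def R_def by auto
  have colx: "(x, v) \<in> col R x C \<longleftrightarrow> v = c - 1 \<or> v \<noteq> c \<and> (x, v) \<in> P \<union> B" for v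
    unfolding e1[symmetric] using memx[of v] by auto
  have top: "even (x + ring_top x) = e" using ct(1) B_only by blast
  show "sweep_column (area L) x (c - 1) (ring_top x) C R"
  proof
    show "finite C" unfolding C_def by (rule finite_column)
    show "c - 1 + 3 \<le> v \<and> v \<le> ring_top x - 2" if "v \<in> C" for v
      using that P_in[of x v] ct(6)[of v] by (auto simp: C_def)
    show "c - 1 + 2 \<le> ring_top x" using ct(2) by simp
    show "(x, ring_top x) \<in> R" using ct(1) memx by (auto simp: R_def)
    show "(x, c - 1) \<in> R" by (simp add: R_def)
    show "(x, v) \<notin> R" if "c - 1 < v" "v < ring_top x" for v using that by (auto simp: R_def)
    show "(x, c - 1 - 1) \<notin> R" using low1 by (auto simp: R_def)
    show "(u, v) \<in> area L" if "x \<le> u" "u \<le> x + 1" "c - 1 - 1 \<le> v" "v \<le> ring_top x + 1" for u v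
      by (rule in_area) (use that xa l ct(3) in auto)
    show "\<not> ring_test (col R x C) x v" if "v \<in> C" for v
      by (rule P_not_ring) (use that colx1 colx P_in[of x v] in \<open>auto simp: C_def\<close>)
    show "ring_test (col R x C) x (ring_top x)"
    proof (rule B_ring)
      show "(x, ring_top x) \<in> B" by (rule ct(1))
      show "(x + 1, v) \<in> col R x C \<longleftrightarrow> (x + 1, v) \<in> P \<union> B" for v by (rule colx1)
      show "(x, ring_top x + 1) \<notin> col R x C"
        using colx[of "ring_top x + 1"] top B_only[of x "ring_top x + 1"] ct(2) ct(6)[of "ring_top x + 1"] by auto
      show "(x, ring_top x - 1) \<notin> col R x C"
        using colx[of "ring_top x - 1"] top B_only[of x "ring_top x - 1"] ct(2) ct(6)[of "ring_top x - 1"] by auto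
      show "(x + 1, ring_top x + 1) \<in> B \<or> (x + 1, ring_top x - 1) \<in> B" by (rule ring_top_next[OF l])
    qed
  qed
qed

end

context boxed_run
begin

text \<open>The factor \<open>colh u + 1\<close> charges \<open>O(d - c)\<close> steps for each tile
  and once more for the column itself.\<close>

lemma sweep_all:
  assumes l: "start_col l" and M: "card P + card B + 3 \<le> M" and "l \<le> x" "x \<le> xmax P + 1"
  shows "finite (sweeping l x) \<and> card (sweeping l x) \<le> card P + card B + 1 \<and>
    go (Sw0 F0, (l, c - 2), sweeping l l) ((\<Sum>u = l..x - 1. colh u + 1) * (3 * nat (d - c + 2) + 20))
      (Sw0 (if x \<le> xmin P then F0 else F1), (x, c - 2), sweeping l x)"
  using assms(3,4)
proof (induction x rule: int_ge_induct)
  case base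
  have "sweeping l l = insert (l - 1, c - 2) (P \<union> B)" by (auto simp: sweeping_def)
  moreover have "card (insert (l - 1, c - 2) (P \<union> B)) \<le> card P + card B + 1"
    using card_Un_le[of P B] P_finite B_finite by (simp add: card_insert_if)
  moreover have "l \<le> xmin P" using l x_bounds by (auto simp: start_col_def)
  ultimately show ?case using P_finite B_finite by (simp add: goes_refl)
next
  case (step x)
  then have IH: "finite (sweeping l x)" "card (sweeping l x) \<le> card P + card B + 1"
    "go (Sw0 F0, (l, c - 2), sweeping l l) ((\<Sum>u = l..x - 1. colh u + 1) * (3 * nat (d - c + 2) + 20))
      (Sw0 (if x \<le> xmin P then F0 else F1), (x, c - 2), sweeping l x)" by auto
  have xb: "x < b" using step x_bounds by auto
  define C where "C = {v. (x, v) \<in> P}"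
  define R where "R = insert (x, c - 1) {(u, v) \<in> sweeping l x. \<not> (u = x \<and> c - 1 \<le> v \<and> v < ring_top x)}"
  have f: "card (sweeping l x) + 2 \<le> M" using IH M by linarith
  note sw = sweep_at[OF l step(1) xb IH(1) f, folded C_def R_def]
  interpret sc: sweep_column "area L" M x "c - 1" "ring_top x" C R by (rule sw(1))
  have fin: "finite (col R x C)" using sw(2) IH(1) by (metis finite_Diff finite_insert)
  have "card (sweeping l (x + 1)) \<le> card (sweeping l x)"
    using sc.card_heap[OF fin] sw by simp
  then have c1: "card (sweeping l (x + 1)) \<le> card P + card B + 1" using IH by linarith
  have f1: "finite (sweeping l (x + 1))"
    using fin unfolding sw(3)[symmetric] col_def by auto
  \<comment> \<open>Connectedness excludes empty columns between \<open>xmin P\<close> and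
    \<open>xmax P\<close>, so phase \<open>F1\<close> does not end the sweep too early.\<close>
  have C: "C \<noteq> {} \<longleftrightarrow> xmin P \<le> x"
    using P_column[of x] x_range[of x] step by (auto simp: C_def)
  let ?f = "if x \<le> xmin P then F0 else F1"
  have D: "nat (ring_top x - (c - 1)) \<le> nat (d - c + 2)"
    using column_tiles(3)[OF l step(1) xb] by simp
  have "go (Sw0 ?f, (x, c - 1 - 1), sweeping l x) ((card C + 1) * (3 * nat (ring_top x - (c - 1)) + 20))
    (if (if C = {} then ?f else F2) = F1 then (Bk, (x, c - 1 - 1), R - {(x, c - 1)})
     else (Sw0 (if (if C = {} then ?f else F2) = F0 then F0 else F1), (x + 1, c - 1 - 1), col R x {c - 1 + 1..c - 1 + int (card C)}))"
    by (rule sc.sweep_one) (use sw IH f in auto)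
  then have "go (Sw0 ?f, (x, c - 2), sweeping l x) ((card C + 1) * (3 * nat (ring_top x - (c - 1)) + 20))
    (Sw0 (if x + 1 \<le> xmin P then F0 else F1), (x + 1, c - 2), sweeping l (x + 1))"
    using C unfolding sw(3) by (auto split: if_splits)
  from go_trans[OF IH(3) this] have g: "go (Sw0 F0, (l, c - 2), sweeping l l)
    ((\<Sum>u = l..x - 1. colh u + 1) * (3 * nat (d - c + 2) + 20) + (card C + 1) * (3 * nat (ring_top x - (c - 1)) + 20))
    (Sw0 (if x + 1 \<le> xmin P then F0 else F1), (x + 1, c - 2), sweeping l (x + 1))" .
  have "{l..x + 1 - 1} = insert x {l..x - 1}" using step by auto
  then have s: "(\<Sum>u = l..x + 1 - 1. colh u + 1) = card C + 1 + (\<Sum>u = l..x - 1. colh u + 1)"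
    by (simp add: colh_def C_def)
  have "(card C + 1) * (3 * nat (ring_top x - (c - 1)) + 20) \<le> (card C + 1) * (3 * nat (d - c + 2) + 20)"
    using D by (intro mult_left_mono) auto
  then have "(\<Sum>u = l..x - 1. colh u + 1) * (3 * nat (d - c + 2) + 20) + (card C + 1) * (3 * nat (ring_top x - (c - 1)) + 20)
    \<le> (\<Sum>u = l..x + 1 - 1. colh u + 1) * (3 * nat (d - c + 2) + 20)"
    unfolding s distrib_right[of "card C + 1"] by linarith
  from go_mono[OF g this] show ?case using c1 f1 by blast
qed

text \<open>The sweep ends in column \<open>xmax P + 1\<close>, which is still left of
  \<open>b\<close>. What it leaves behind is an instance of \<open>combing\<close>; the halving
  passes contribute the term \<open>2 * N * (2 * H + 6)\<close>.\<close>

lemma count_from_corner: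
  assumes l: "start_col l" and L: "card P < 2 ^ L" and M: "card P + card B + 2 * L + 3 \<le> M"
  defines "N \<equiv> card P" and "W \<equiv> nat (b - a)" and "H \<equiv> nat (d - c)"
  shows "\<exists>T n. n \<le> L + 1 \<and> binary_counter T (l - 1, c - 2) Left Down n N \<and>
    go (Put0, (l, c - 1), P \<union> B) ((5 * N + W + 2) * (4 * H + 26) + (L + 2) * (11 * W + 2 * L + 30))
      (Halt, (l - 1, c - 2), T) \<and> finite T \<and> card T \<le> M"
proof -
  note bs = box_size and xb = x_bounds
  let ?r = "xmax P"
  let ?x = "?r + 1"
  have la: "a \<le> l" "l \<le> xmin P" "(l, c - 1) \<in> B" using l xb by (auto simp: start_col_def)
  have low: "(u, v) \<notin> P \<union> B" if "v \<le> c - 2" for u v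
    using P_in[of u v] B_only[of u v] that by auto
  have fits0: "fits (P \<union> B)" unfolding fits_def using P_finite B_finite card_Un_le[of P B] M by simp
  have S0: "sweeping l l = insert (l - 1, c - 2) (P \<union> B)" by (auto simp: sweeping_def)
  have "go (Put0, (l, c - 1), P \<union> B) 1 (Put1, (l, c - 2), P \<union> B)"
    by (rule go1) (use la in_area[of l "c - 1"] bs fits0 xb in \<open>auto simp: mstep_simps\<close>)
  also have "go (Put1, (l, c - 2), P \<union> B) 1 (Put2, (l - 1, c - 2), P \<union> B)"
    by (rule go1) (use la in_area[of l "c - 2"] bs fits0 xb low[of "c - 2" l] in \<open>auto simp: mstep_simps\<close>)
  also have "go (Put2, (l - 1, c - 2), P \<union> B) 1 (Sw0 F0, (l, c - 2), sweeping l l)"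
    by (rule go1) (use la in_area[of "l - 1" "c - 2"] bs fits0 xb in \<open>auto simp: mstep_def S0\<close>)
  finally have g0: "go (Put0, (l, c - 1), P \<union> B) (1 + 1 + 1) (Sw0 F0, (l, c - 2), sweeping l l)" .
  have sa: "finite (sweeping l ?x)" "card (sweeping l ?x) \<le> card P + card B + 1"
    "go (Sw0 F0, (l, c - 2), sweeping l l) ((\<Sum>u = l..?x - 1. colh u + 1) * (3 * nat (d - c + 2) + 20))
      (Sw0 (if ?x \<le> xmin P then F0 else F1), (?x, c - 2), sweeping l ?x)"
    using sweep_all[OF l, of ?x] M la xb by auto
  have F: "(if ?x \<le> xmin P then F0 else F1) = F1" using xb by simp
  have lx: "l \<le> ?x" "?x < b" using la xb by auto
  define C where "C = {v. (?x, v) \<in> P}"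
  define R where "R = insert (?x, c - 1) {(u, v) \<in> sweeping l ?x. \<not> (u = ?x \<and> c - 1 \<le> v \<and> v < ring_top ?x)}"
  have f: "card (sweeping l ?x) + 2 \<le> M" using sa M by linarith
  note sw = sweep_at[OF l lx sa(1) f, folded C_def R_def]
  note ct = column_tiles[OF l lx]
  interpret sc: sweep_column "area L" M ?x "c - 1" "ring_top ?x" C R by (rule sw(1))
  have C0: "C = {}" using x_range[of ?x] by (auto simp: C_def)
  have D: "nat (ring_top ?x - (c - 1)) \<le> nat (d - c + 2)" using ct(3) by simp
  have "go (Sw0 F1, (?x, c - 1 - 1), sweeping l ?x) ((card C + 1) * (3 * nat (ring_top ?x - (c - 1)) + 20))
    (if (if C = {} then F1 else F2) = F1 then (Bk, (?x, c - 1 - 1), R - {(?x, c - 1)})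
     else (Sw0 (if (if C = {} then F1 else F2) = F0 then F0 else F1), (?x + 1, c - 1 - 1), col R ?x {c - 1 + 1..c - 1 + int (card C)}))"
    by (rule sc.sweep_one) (use sw sa f in auto)
  then have "go (Sw0 F1, (?x, c - 2), sweeping l ?x) (3 * nat (ring_top ?x - (c - 1)) + 20) (Bk, (?x, c - 2), R - {(?x, c - 1)})"
    using C0 by simp
  from go_mono[OF this, of "3 * nat (d - c + 2) + 20"] D
  have g2: "go (Sw0 F1, (?x, c - 2), sweeping l ?x) (3 * nat (d - c + 2) + 20) (Bk, (?x, c - 2), R - {(?x, c - 1)})"
    by simp
  \<comment> \<open>The part of the ring that stays untouched during all passes.\<close>
  define R0 where "R0 = {(u, v) \<in> B. u < l \<or> u > ?x \<or> c < v}"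
  interpret cb: combing "area L" M l ?r "c - 1" H L colh R0
  proof
    show "l \<le> ?r" using la xb by auto
    show "colh u \<le> H" for u using colh_le[of u] by (auto simp: H_def)
    show "(u, v) \<in> area L" if "l - 2 - int L \<le> u" "u \<le> ?x" "c - 1 - 2 \<le> v" "v \<le> c - 1" for u v
      using that la xb unfolding area_def by auto
    show "(u, v) \<in> area L" if "l \<le> u" "u \<le> ?r" "c - 1 - 1 \<le> v" "v \<le> c - 1 + int H + 1" for u v
      by (rule in_area) (use that la xb bs in \<open>auto simp: H_def\<close>)
    show "c - 1 \<le> v" if "(u, v) \<in> R0" for u v using that B_only[of u v] by (auto simp: R0_def)
    show "(u, v) \<notin> R0" if u: "l \<le> u" "u \<le> ?r" "v \<le> c - 1 + int (colh u) + 1" for u v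
    proof
      assume "(u, v) \<in> R0"
      then have v: "(u, v) \<in> B" "c < v" using u by (auto simp: R0_def)
      have ub: "u < b" using u xb by auto
      have t: "ring_top u \<le> v" by (rule column_tiles(4)[OF l u(1) ub v])
      show False
      proof (cases "u = a")
        \<comment> \<open>The left side of the ring is only two rows above the floor here, but the
          polyomino does not reach column \<open>a\<close>, so the heap is empty.\<close>
        case True
        then have "{v. (u, v) \<in> P} = {}" using P_in[of u] by auto
        then have "colh u = 0" by (simp add: colh_def)
        then show False using u v by simp
      next
        case False
        then show False using t u colh_le[of u] bs by (auto simp: ring_top_def split: if_splits)
      qed
    qed
    show "(?x, c - 1) \<notin> R0" using lx by (auto simp: R0_def)
  qed
  have eq: "R - {(?x, c - 1)} = R0 \<union> cb.comb colh \<union> cb.digits N 0"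
  proof (rule set_eqI, clarify)
    fix u v
    have t: "c < ring_top ?x" using ct(2) by simp
    have dig: "(u, v) \<in> cb.digits N 0 \<longleftrightarrow> (u, v) = (l - 1, c - 2)" by (auto simp: cb.digits_def)
    have sx: "(u, v) \<in> sweeping l ?x \<longleftrightarrow> (u, v) = (l - 1, c - 2) \<or>
      (if l \<le> u \<and> u \<le> ?r then c - 1 \<le> v \<and> v \<le> c - 1 + int (colh u) \<or> (u, v) \<in> B \<and> c < v
       else (u, v) \<in> P \<union> B)" by (auto simp: sweeping_def)
    show "(u, v) \<in> R - {(?x, c - 1)} \<longleftrightarrow> (u, v) \<in> R0 \<union> cb.comb colh \<union> cb.digits N 0"
    proof (cases "u = ?x")
      case True
      have "(u, v) \<in> R - {(?x, c - 1)} \<longleftrightarrow> (?x, v) \<in> B \<and> ring_top ?x \<le> v"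
        using True la lx sx x_range[of ?x v] ct(6)[of v] B_only[of u v] t unfolding R_def by auto
      also have "\<dots> \<longleftrightarrow> (?x, v) \<in> B \<and> c < v" using ct(4)[of v] t by auto
      also have "\<dots> \<longleftrightarrow> (u, v) \<in> R0 \<union> cb.comb colh \<union> cb.digits N 0"
        using True la dig xb unfolding R0_def cb.comb_def by auto
      finally show ?thesis .
    next
      case False
      have "(u, v) \<in> R - {(?x, c - 1)} \<longleftrightarrow> (u, v) \<in> sweeping l ?x"
        using False by (auto simp: R_def)
      also have "\<dots> \<longleftrightarrow> (u, v) \<in> R0 \<union> cb.comb colh \<union> cb.digits N 0"
        unfolding sx using False la dig x_range[of u v] unfolding R0_def cb.comb_def by auto
      finally show ?thesis .
    qed
  qed
  let ?T = "R0 \<union> cb.comb colh \<union> cb.digits N 0"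
  have "?T \<subseteq> sweeping l ?x"
    unfolding eq[symmetric] R_def by auto
  then have fT: "finite ?T" "card ?T \<le> card P + card B + 1"
    using sa card_mono[of "sweeping l ?x" ?T] finite_subset[of ?T] by auto
  then have fitsT: "fits ?T" using M by (simp add: fits_def)
  have row: "(u, c - 2) \<in> ?T \<longleftrightarrow> u = l - 1" for u
    using low[of "c - 2" u] by (auto simp: R0_def cb.comb_def cb.digits_def)
  have "go (Bk, (?x, c - 2), ?T) (nat (?x - (l - 1))) (Bk, (l - 1, c - 2), ?T)"
  proof (rule walk_left[where b = False])
    fix u assume u: "l - 1 < u" "u \<le> ?x"
    show "((u, c - 2) \<in> ?T) = False \<and> (u, c - 2) \<in> area L"
      using row[of u] u in_area[of u "c - 2"] la xb bs by auto
  qed (use lx fitsT in auto)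
  also have "go (Bk, (l - 1, c - 2), ?T) 1 (Ps0 False False, (l, c - 2), ?T)"
    by (rule go1) (use row[of "l - 1"] fitsT in_area[of "l - 1" "c - 2"] la xb bs in \<open>auto simp: mstep_simps\<close>)
  also have "go (Ps0 False False, (l, c - 2), ?T) 1 (Ps1 False False, (l, c - 1), ?T)"
    by (rule go1) (use row[of l] fitsT in_area[of l "c - 2"] la xb bs in \<open>auto simp: mstep_simps\<close>)
  finally have g3: "go (Bk, (?x, c - 2), ?T) (nat (?x - (l - 1)) + 1 + 1) (Ps1 False False, (l, c - 1), ?T)" .
  have sumN: "(\<Sum>u = l..?r. colh u) = N"
    using sum_colh[of l ?r] la by (simp add: N_def)
  have "\<exists>n h'. n \<le> L \<and> N < 2 ^ n \<and> fits (R0 \<union> cb.comb h' \<union> cb.digits N n) \<and> go (Ps1 False False, (l, c - 1), ?T)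
      (2 * (N div 2 ^ 0) * (2 * H + 6) + (L + 1 - 0) * (11 * nat (?r + 1 - l) + 2 * L + 20))
      (Halt, (l - 1, c - 1 - 1), R0 \<union> cb.comb h' \<union> cb.digits N n)"
    by (rule cb.main_loop) (use L N_def sumN fT M in auto)
  then obtain n h' where n: "n \<le> L" "N < 2 ^ n" "fits (R0 \<union> cb.comb h' \<union> cb.digits N n)" and g4: "go (Ps1 False False, (l, c - 1), ?T)
      (2 * N * (2 * H + 6) + (L + 1) * (11 * nat (?r + 1 - l) + 2 * L + 20))
      (Halt, (l - 1, c - 2), R0 \<union> cb.comb h' \<union> cb.digits N n)" by auto
  define w where "w = nat (?r + 1 - l)"
  have w: "w \<le> W" "nat (?x - (l - 1)) = w + 1" using la xb by (auto simp: w_def W_def)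
  have S: "(\<Sum>u = l..?x - 1. colh u + 1) = N + w"
    using sumN by (simp only: sum.distrib) (simp add: w_def)
  have H2: "nat (d - c + 2) = H + 2" using bs by (simp add: H_def)
  have g: "go (Put0, (l, c - 1), P \<union> B)
    (1 + 1 + 1 + (N + w) * (3 * (H + 2) + 20) + (3 * (H + 2) + 20) + (w + 1 + 1 + 1) +
     (2 * N * (2 * H + 6) + (L + 1) * (11 * w + 2 * L + 20)))
    (Halt, (l - 1, c - 2), R0 \<union> cb.comb h' \<union> cb.digits N n)"
    using go_trans[OF go_trans[OF go_trans[OF go_trans[OF g0 sa(3)[unfolded F]] g2[unfolded eq]] g3] g4]
    unfolding S H2 w(2) w_def[symmetric] .
  have c1: "(N + w) * (3 * (H + 2) + 20) + (3 * (H + 2) + 20) + 2 * N * (2 * H + 6) \<le> (5 * N + W + 2) * (4 * H + 26)"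
  proof -
    have "(N + w) * (3 * (H + 2) + 20) \<le> (N + W) * (4 * H + 26)" using w by (intro mult_mono) auto
    moreover have "2 * N * (2 * H + 6) \<le> 2 * N * (4 * H + 26)" by (intro mult_left_mono) auto
    moreover have "(5 * N + W + 2) * (4 * H + 26) = (N + W) * (4 * H + 26) + 2 * N * (4 * H + 26) + (2 * N + 2) * (4 * H + 26)"
      by (simp add: algebra_simps)
    moreover have "3 * (H + 2) + 20 \<le> (2 * N + 2) * (4 * H + 26)" by simp
    ultimately show ?thesis by linarith
  qed
  have c2: "1 + 1 + 1 + (w + 1 + 1 + 1) + (L + 1) * (11 * w + 2 * L + 20) \<le> (L + 2) * (11 * W + 2 * L + 30)"
  proof -
    have "(L + 1) * (11 * w + 2 * L + 20) \<le> (L + 1) * (11 * W + 2 * L + 30)" using w by (intro mult_left_mono) auto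
    moreover have "(L + 2) * (11 * W + 2 * L + 30) = (L + 1) * (11 * W + 2 * L + 30) + (11 * W + 2 * L + 30)"
      by simp
    ultimately show ?thesis using w by linarith
  qed
  have "go (Put0, (l, c - 1), P \<union> B) ((5 * N + W + 2) * (4 * H + 26) + (L + 2) * (11 * W + 2 * L + 30))
    (Halt, (l - 1, c - 2), R0 \<union> cb.comb h' \<union> cb.digits N n)"
    by (rule go_mono[OF g]) (use c1 c2 in linarith)
  moreover have "binary_counter (R0 \<union> cb.comb h' \<union> cb.digits N n) (l - 1, c - 2) Left Down (Suc n) N"
    using cb.counter[OF n(2)] by simp
  ultimately show ?thesis using n by (auto simp: fits_def)
qed

end

section \<open>Walking along the ring\<close>

context arena
begin

text \<open>Phase \<open>F1\<close> walks to the left; it is the transposed downward walk.\<close>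

definition pt :: "phase \<Rightarrow> int \<Rightarrow> int \<Rightarrow> pixel" where
  "pt j u v = (if j = F1 then (v, u) else (u, v))"

definition after :: "bool \<Rightarrow> phase \<Rightarrow> label" where
  "after g j = (case j of F0 \<Rightarrow> Nav0 g F1 | F1 \<Rightarrow> Nav0 g F2 | F2 \<Rightarrow> if g then Put0 else Dia0)"

text \<open>The two diagonal neighbours with smaller \<open>v\<close> are inspected by detours, the
  one with smaller \<open>u\<close> first; if both are empty, the robot returns to its tile.\<close>

lemma nav_step:
  assumes q: "q \<in> {Nav0 g j, Nav2 g j, Nav4 g j}" and m: "pt j u v \<in> T" and f: "fits T"
    and A: "\<And>u' v'. \<bar>u' - u\<bar> \<le> 1 \<Longrightarrow> \<bar>v' - v\<bar> \<le> 1 \<Longrightarrow> pt j u' v' \<in> A"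
  shows "pt j (u - 1) (v - 1) \<in> T \<Longrightarrow> go (q, pt j u v, T) 2 (Nav2 g j, pt j (u - 1) (v - 1), T)"
    and "pt j (u - 1) (v - 1) \<notin> T \<Longrightarrow> pt j (u + 1) (v - 1) \<in> T \<Longrightarrow>
      go (q, pt j u v, T) 4 (Nav4 g j, pt j (u + 1) (v - 1), T)"
    and "pt j (u - 1) (v - 1) \<notin> T \<Longrightarrow> pt j (u + 1) (v - 1) \<notin> T \<Longrightarrow>
      go (q, pt j u v, T) 6 (after g j, pt j u v, T)"
proof -
  have m1: "mstep dl (q, pt j u v, T) = (Nav1 g j, pt j u (v - 1), T)"
    using q m by (auto simp: mstep_simps pt_def split: if_splits)
  have m2: "mstep dl (Nav1 g j, pt j u (v - 1), T) = (Nav2 g j, pt j (u - 1) (v - 1), T)"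
    by (cases "pt j u (v - 1) \<in> T") (auto simp: mstep_simps pt_def)
  have m3: "pt j (u - 1) (v - 1) \<notin> T \<Longrightarrow>
    mstep dl (Nav2 g j, pt j (u - 1) (v - 1), T) = (Nav3 g j, pt j u (v - 1), T)"
    by (auto simp: mstep_simps pt_def)
  have m4: "mstep dl (Nav3 g j, pt j u (v - 1), T) = (Nav4 g j, pt j (u + 1) (v - 1), T)"
    by (cases "pt j u (v - 1) \<in> T") (auto simp: mstep_simps pt_def)
  have m5: "pt j (u + 1) (v - 1) \<notin> T \<Longrightarrow>
    mstep dl (Nav4 g j, pt j (u + 1) (v - 1), T) = (Nav5 g j, pt j (u + 1) v, T)"
    by (auto simp: mstep_simps pt_def)
  have m6: "mstep dl (Nav5 g j, pt j (u + 1) v, T) = (after g j, pt j u v, T)"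
    by (cases "pt j (u + 1) v \<in> T") (auto simp: mstep_simps pt_def after_def split: phase.split)
  have nq: "q \<noteq> Halt" "q \<noteq> Flip" using q by auto
  have g2: "go (q, pt j u v, T) (1 + 1) (Nav2 g j, pt j (u - 1) (v - 1), T)"
    by (rule go_trans; rule go1) (use nq m1 m2 f A in auto)
  then show "go (q, pt j u v, T) 2 (Nav2 g j, pt j (u - 1) (v - 1), T)"
    by (simp add: numeral_2_eq_2)
  assume n: "pt j (u - 1) (v - 1) \<notin> T"
  have "go (Nav2 g j, pt j (u - 1) (v - 1), T) (1 + 1) (Nav4 g j, pt j (u + 1) (v - 1), T)"
    by (rule go_trans; rule go1) (use m3[OF n] m4 f A in auto)
  from go_trans[OF g2 this]
  show g4: "go (q, pt j u v, T) 4 (Nav4 g j, pt j (u + 1) (v - 1), T)" by (simp add: numeral_eq_Suc)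
  assume n': "pt j (u + 1) (v - 1) \<notin> T"
  have "go (Nav4 g j, pt j (u + 1) (v - 1), T) (1 + 1) (after g j, pt j u v, T)"
    by (rule go_trans; rule go1) (use m5[OF n'] m6 f A in auto)
  from go_trans[OF g4 this]
  show "go (q, pt j u v, T) 6 (after g j, pt j u v, T)" by (simp add: numeral_eq_Suc)
qed

text \<open>Each diagonal step lowers \<open>v\<close>, which \<open>lo\<close> bounds from below.
  The invariant \<open>I\<close> confines the walk to a part of the ring.\<close>

lemma nav_phase:
  assumes q: "q \<in> {Nav0 g j, Nav2 g j, Nav4 g j}" and f: "fits T" and I: "I u v"
    and m: "\<And>u v. I u v \<Longrightarrow> pt j u v \<in> T \<and> lo \<le> v"
    and A: "\<And>u v u' v'. I u v \<Longrightarrow> \<bar>u' - u\<bar> \<le> 1 \<Longrightarrow> \<bar>v' - v\<bar> \<le> 1 \<Longrightarrow> pt j u' v' \<in> A"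
    and I1: "\<And>u v. I u v \<Longrightarrow> pt j (u - 1) (v - 1) \<in> T \<Longrightarrow> I (u - 1) (v - 1)"
    and I2: "\<And>u v. I u v \<Longrightarrow> pt j (u + 1) (v - 1) \<in> T \<Longrightarrow> I (u + 1) (v - 1)"
  shows "\<exists>u' v'. I u' v' \<and> pt j (u' - 1) (v' - 1) \<notin> T \<and> pt j (u' + 1) (v' - 1) \<notin> T \<and>
    go (q, pt j u v, T) (4 * nat (v - lo) + 6) (after g j, pt j u' v', T)"
  using q I
proof (induction "nat (v - lo)" arbitrary: u v q rule: less_induct)
  case less
  have mm: "pt j u v \<in> T" "lo \<le> v" using m less.prems by auto
  have AA: "\<And>u' v'. \<bar>u' - u\<bar> \<le> 1 \<Longrightarrow> \<bar>v' - v\<bar> \<le> 1 \<Longrightarrow> pt j u' v' \<in> A"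
    using A less.prems by blast
  note st = nav_step[OF less.prems(1) mm(1) f AA]
  consider "pt j (u - 1) (v - 1) \<in> T" | "pt j (u - 1) (v - 1) \<notin> T" "pt j (u + 1) (v - 1) \<in> T"
    | "pt j (u - 1) (v - 1) \<notin> T" "pt j (u + 1) (v - 1) \<notin> T" by blast
  then show ?case
  proof cases
    case 1
    have I': "I (u - 1) (v - 1)" using I1 less.prems 1 by blast
    then have lt: "nat (v - 1 - lo) < nat (v - lo)" using m by force
    obtain u' v' where "I u' v'" "pt j (u' - 1) (v' - 1) \<notin> T" "pt j (u' + 1) (v' - 1) \<notin> T"
      and g: "go (Nav2 g j, pt j (u - 1) (v - 1), T) (4 * nat (v - 1 - lo) + 6) (after g j, pt j u' v', T)"
      using less.hyps[OF lt _ I', of "Nav2 g j"] by auto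
    moreover have "go (q, pt j u v, T) (4 * nat (v - lo) + 6) (after g j, pt j u' v', T)"
      by (rule go_mono[OF go_trans[OF st(1)[OF _ _ 1] g]]) (use lt in auto)
    ultimately show ?thesis by blast
  next
    case 2
    have I': "I (u + 1) (v - 1)" using I2 less.prems 2 by blast
    then have lt: "nat (v - 1 - lo) < nat (v - lo)" using m by force
    obtain u' v' where "I u' v'" "pt j (u' - 1) (v' - 1) \<notin> T" "pt j (u' + 1) (v' - 1) \<notin> T"
      and g: "go (Nav4 g j, pt j (u + 1) (v - 1), T) (4 * nat (v - 1 - lo) + 6) (after g j, pt j u' v', T)"
      using less.hyps[OF lt _ I', of "Nav4 g j"] by auto
    moreover have "go (q, pt j u v, T) (4 * nat (v - lo) + 6) (after g j, pt j u' v', T)"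
      by (rule go_mono[OF go_trans[OF st(2)[OF _ _ 2] g]]) (use lt in auto)
    ultimately show ?thesis by blast
  next
    case 3
    have "go (q, pt j u v, T) (4 * nat (v - lo) + 6) (after g j, pt j u v, T)"
      by (rule go_mono[OF st(3)[OF _ _ 3]]) auto
    then show ?thesis using less.prems 3 by blast
  qed
qed

end

context boxed
begin

lemma B_range: "(x, y) \<in> B \<Longrightarrow> a - 1 \<le> x \<and> x \<le> b + 1 \<and> c - 1 \<le> y \<and> y \<le> d + 1"
  using B_only by blast

lemma near_ring:
  assumes "(x, y) \<in> B" "\<bar>x' - x\<bar> \<le> 1" "\<bar>y' - y\<bar> \<le> 1"
  shows "(x', y') \<in> P \<union> B \<longleftrightarrow> (x', y') \<in> B"
  using B_only[OF assms(1)] P_in[of x' y'] assms(2,3) by auto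

text \<open>The local minima of the ring include the lower turning points of the zigzag along the
  upper side, so a single descent may get stuck there.\<close>

lemma lowest_tile:
  assumes xy: "(x, y) \<in> B" and n: "(x - 1, y - 1) \<notin> B" "(x + 1, y - 1) \<notin> B"
  shows "y = c - 1 \<and> a \<le> x \<and> x \<le> b \<or> d \<le> y \<and> a \<le> x \<and> x \<le> b \<and> \<not> (x \<le> a \<and> y \<le> d)"
proof -
  have p: "even (x - 1 + (y - 1)) = e" "even (x + 1 + (y - 1)) = e" using B_only[OF xy] by auto
  have "x = a - 1 \<Longrightarrow> y \<noteq> c" "x = b + 1 \<Longrightarrow> y \<noteq> c" using n xy corners(1,2) by auto
  moreover note box_size B_range[OF xy] B_only[OF xy, THEN conjunct2]
    n(1)[THEN contrapos_nn, OF B_in[OF p(1)]] n(2)[THEN contrapos_nn, OF B_in[OF p(2)]]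
  ultimately show ?thesis by (smt (verit))
qed

text \<open>The assumption \<open>I\<close> excludes the right side, on whose zigzag a leftward walk
  would get stuck.\<close>

lemma leftmost_tile:
  assumes xy: "(x, y) \<in> B" and n: "(x - 1, y - 1) \<notin> B" "(x - 1, y + 1) \<notin> B"
    and I: "y \<le> c \<and> x \<le> b \<or> d \<le> y \<and> x \<le> b \<or> x \<le> a"
  shows "x = a - 1"
proof (rule ccontr)
  assume xa: "x \<noteq> a - 1"
  have p: "even (x - 1 + (y - 1)) = e" "even (x - 1 + (y + 1)) = e" using B_only[OF xy] by auto
  have "x = a \<Longrightarrow> y \<noteq> c - 1 \<and> y \<noteq> d + 1" using n xy corners(1,3) by auto
  moreover note xa I box_size B_range[OF xy] B_only[OF xy, THEN conjunct2]
    n(1)[THEN contrapos_nn, OF B_in[OF p(1)]] n(2)[THEN contrapos_nn, OF B_in[OF p(2)]]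
  ultimately show False by (smt (verit))
qed

end

context boxed_run
begin

text \<open>A descent ends on the lower or on the upper side. From either one the leftward walk
  reaches the left side, and a descent begun there can end only in the lower left corner.\<close>

lemma navigate:
  assumes p: "(x, y) \<in> B" and f: "fits (P \<union> B)"
  shows "\<exists>l. start_col l \<and> go (Nav0 g F0, (x, y), P \<union> B) (4 * nat (b - a) + 8 * nat (d - c) + 50)
    (if g then Put0 else Dia0, (l, c - 1), P \<union> B)"
proof -
  note bs = box_size
  have inA: "(x', y') \<in> area L" if "(x, y) \<in> B" "\<bar>x' - x\<bar> \<le> 1" "\<bar>y' - y\<bar> \<le> 1" for x y x' y'
    by (rule in_area) (use B_only[OF that(1)] that(2,3) in auto)
  have "\<exists>u' v'. (u', v') \<in> B \<and> pt F0 (u' - 1) (v' - 1) \<notin> P \<union> B \<and> pt F0 (u' + 1) (v' - 1) \<notin> P \<union> B \<and>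
    go (Nav0 g F0, pt F0 x y, P \<union> B) (4 * nat (y - (c - 1)) + 6) (after g F0, pt F0 u' v', P \<union> B)"
  proof (rule nav_phase)
    show "(x, y) \<in> B" by (rule p)
    show "pt F0 u v \<in> P \<union> B \<and> c - 1 \<le> v" if "(u, v) \<in> B" for u v
      using that B_only[of u v] by (auto simp: pt_def)
    show "pt F0 u' v' \<in> area L" if "(u, v) \<in> B" "\<bar>u' - u\<bar> \<le> 1" "\<bar>v' - v\<bar> \<le> 1" for u v u' v'
      using inA[of u v u' v'] that by (simp add: pt_def)
    show "(u - 1, v - 1) \<in> B" if "(u, v) \<in> B" "pt F0 (u - 1) (v - 1) \<in> P \<union> B" for u v
      using that near_ring[of u v "u - 1" "v - 1"] by (auto simp: pt_def)
    show "(u + 1, v - 1) \<in> B" if "(u, v) \<in> B" "pt F0 (u + 1) (v - 1) \<in> P \<union> B" for u v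
      using that near_ring[of u v "u + 1" "v - 1"] by (auto simp: pt_def)
  qed (use f in auto)
  then obtain x1 y1 where 1: "(x1, y1) \<in> B" "(x1 - 1, y1 - 1) \<notin> B" "(x1 + 1, y1 - 1) \<notin> B"
    and g1: "go (Nav0 g F0, (x, y), P \<union> B) (4 * nat (y - (c - 1)) + 6) (Nav0 g F1, (x1, y1), P \<union> B)"
    by (auto simp: pt_def after_def)
  note t1 = lowest_tile[OF 1]
  let ?I1 = "\<lambda>u v. (v, u) \<in> B \<and> (u \<le> c \<and> v \<le> b \<or> d \<le> u \<and> v \<le> b \<or> v \<le> a)"
  have I1: "?I1 u' (v - 1)" if "?I1 u v" "(v - 1, u') \<in> B" "u' = u - 1 \<or> u' = u + 1" for u v u'
  proof -
    have "\<not> (a < v - 1 \<and> v - 1 < b \<and> c < u' \<and> u' < d)" using B_only[OF that(2)] by blast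
    with that(1,3) bs have "u' \<le> c \<and> v - 1 \<le> b \<or> d \<le> u' \<and> v - 1 \<le> b \<or> v - 1 \<le> a"
      by (smt (verit))
    with that(2) show ?thesis by blast
  qed
  have "\<exists>u' v'. ?I1 u' v' \<and> pt F1 (u' - 1) (v' - 1) \<notin> P \<union> B \<and> pt F1 (u' + 1) (v' - 1) \<notin> P \<union> B \<and>
    go (Nav0 g F1, pt F1 y1 x1, P \<union> B) (4 * nat (x1 - (a - 1)) + 6) (after g F1, pt F1 u' v', P \<union> B)"
  proof (rule nav_phase)
    show "?I1 y1 x1" using t1 1 by auto
    show "pt F1 u v \<in> P \<union> B \<and> a - 1 \<le> v" if "?I1 u v" for u v
      using that B_only[of v u] by (auto simp: pt_def)
    show "pt F1 u' v' \<in> area L" if "?I1 u v" "\<bar>u' - u\<bar> \<le> 1" "\<bar>v' - v\<bar> \<le> 1" for u v u' v'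
      using inA[of v u v' u'] that by (simp add: pt_def)
    show "?I1 (u - 1) (v - 1)" if "?I1 u v" "pt F1 (u - 1) (v - 1) \<in> P \<union> B" for u v
      by (rule I1) (use that near_ring[of v u "v - 1" "u - 1"] in \<open>auto simp: pt_def\<close>)
    show "?I1 (u + 1) (v - 1)" if "?I1 u v" "pt F1 (u + 1) (v - 1) \<in> P \<union> B" for u v
      by (rule I1) (use that near_ring[of v u "v - 1" "u + 1"] in \<open>auto simp: pt_def\<close>)
  qed (use f in auto)
  then obtain x2 y2 where 2: "?I1 y2 x2" "(x2 - 1, y2 - 1) \<notin> B" "(x2 - 1, y2 + 1) \<notin> B"
    and g2: "go (Nav0 g F1, (x1, y1), P \<union> B) (4 * nat (x1 - (a - 1)) + 6) (Nav0 g F2, (x2, y2), P \<union> B)"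
    by (auto simp: pt_def after_def)
  have x2: "x2 = a - 1" using leftmost_tile[of x2 y2] 2 by auto
  \<comment> \<open>The pixels with \<open>u > a\<close> occur when the walk turns into the lower
    side. Combined with \<open>lowest_tile\<close>, this leaves only row \<open>c - 1\<close> as the
    end.\<close>
  let ?I2 = "\<lambda>u v. (u, v) \<in> B \<and> (u \<le> a \<and> v \<le> d \<or> u = a + 1 \<and> v \<le> c \<or> u = a + 2 \<and> v = c - 1)"
  have I2: "?I2 u' (v - 1)" if "?I2 u v" "(u', v - 1) \<in> B" "u' = u - 1 \<or> u' = u + 1" for u v u'
  proof -
    have "\<not> (a < u' \<and> u' < b \<and> c < v - 1 \<and> v - 1 < d)" "c - 1 \<le> v - 1"
      using B_only[OF that(2)] by blast+
    with that(1,3) bs have "u' \<le> a \<and> v - 1 \<le> d \<or> u' = a + 1 \<and> v - 1 \<le> c \<or> u' = a + 2 \<and> v - 1 = c - 1"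
      by (smt (verit))
    with that(2) show ?thesis by blast
  qed
  have "\<exists>u' v'. ?I2 u' v' \<and> pt F2 (u' - 1) (v' - 1) \<notin> P \<union> B \<and> pt F2 (u' + 1) (v' - 1) \<notin> P \<union> B \<and>
    go (Nav0 g F2, pt F2 x2 y2, P \<union> B) (4 * nat (y2 - (c - 1)) + 6) (after g F2, pt F2 u' v', P \<union> B)"
  proof (rule nav_phase)
    show "?I2 x2 y2" using 2 x2 B_only[of x2 y2] by auto
    show "pt F2 u v \<in> P \<union> B \<and> c - 1 \<le> v" if "?I2 u v" for u v
      using that B_only[of u v] by (auto simp: pt_def)
    show "pt F2 u' v' \<in> area L" if "?I2 u v" "\<bar>u' - u\<bar> \<le> 1" "\<bar>v' - v\<bar> \<le> 1" for u v u' v'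
      using inA[of u v u' v'] that by (simp add: pt_def)
    show "?I2 (u - 1) (v - 1)" if "?I2 u v" "pt F2 (u - 1) (v - 1) \<in> P \<union> B" for u v
      by (rule I2) (use that near_ring[of u v "u - 1" "v - 1"] in \<open>auto simp: pt_def\<close>)
    show "?I2 (u + 1) (v - 1)" if "?I2 u v" "pt F2 (u + 1) (v - 1) \<in> P \<union> B" for u v
      by (rule I2) (use that near_ring[of u v "u + 1" "v - 1"] in \<open>auto simp: pt_def\<close>)
  qed (use f in auto)
  then obtain x3 y3 where 3: "?I2 x3 y3" "(x3 - 1, y3 - 1) \<notin> B" "(x3 + 1, y3 - 1) \<notin> B"
    and g3: "go (Nav0 g F2, (x2, y2), P \<union> B) (4 * nat (y2 - (c - 1)) + 6)
      (if g then Put0 else Dia0, (x3, y3), P \<union> B)"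
    by (auto simp: pt_def after_def)
  have y3: "y3 = c - 1" "a \<le> x3" "x3 \<le> a + 2" using lowest_tile[OF _ 3(2,3)] 3(1) bs by (smt (verit))+
  have "start_col x3" using y3 3 by (auto simp: start_col_def)
  moreover have "go (Nav0 g F0, (x, y), P \<union> B) (4 * nat (b - a) + 8 * nat (d - c) + 50)
    (if g then Put0 else Dia0, (x3, c - 1), P \<union> B)"
  proof (rule go_weaken[OF go_trans[OF go_trans[OF g1 g2] g3]])
    have "nat (y - (c - 1)) \<le> nat (d - c) + 2" "nat (x1 - (a - 1)) \<le> nat (b - a) + 2"
      "nat (y2 - (c - 1)) \<le> nat (d - c) + 2"
      using B_range[OF p] B_range[OF 1(1)] B_range[of x2 y2] 2(1) bs by auto
    then show "4 * nat (y - (c - 1)) + 6 + (4 * nat (x1 - (a - 1)) + 6) + (4 * nat (y2 - (c - 1)) + 6)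
      \<le> 4 * nat (b - a) + 8 * nat (d - c) + 50" by linarith
  qed (use y3 in simp)
  ultimately show ?thesis by blast
qed

end

section \<open>Comparing width and height\<close>

context boxed_run
begin

lemma diag_step:
  assumes xy: "(x, y) \<notin> B" "a \<le> x" "x \<le> b" "c \<le> y" "y \<le> d" and f: "fits (P \<union> B)"
  shows "go (Diag s, (x, y), P \<union> B) 8 (Diag (\<not> s), if s then (x, y + 1) else (x + 1, y), P \<union> B)"
proof (cases "(x, y) \<in> P")
  case True
  have inA: "(u, v) \<in> area L" if "x \<le> u" "u \<le> x + 1" "y - 1 \<le> v" "v \<le> y + 1" for u v
    by (rule in_area) (use that xy in auto)
  have "\<not> ring_test (P \<union> B) x y" by (rule P_not_ring) (use True in auto)
  then have t: "go (Tst1 (CDiag s), (x + 1, y), P \<union> B) 6 (TP (CDiag s), (x, y), P \<union> B)"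
    using test_ring[of x y "P \<union> B" "CDiag s"] inA f by auto
  have "go (Diag s, (x, y), P \<union> B) 1 (Tst1 (CDiag s), (x + 1, y), P \<union> B)"
    by (rule go1) (use True f inA[of x y] in \<open>auto simp: mstep_simps\<close>)
  also note t
  also have "go (TP (CDiag s), (x, y), P \<union> B) 1 (Diag (\<not> s), if s then (x, y + 1) else (x + 1, y), P \<union> B)"
    by (rule go1) (use True f inA[of x y] in \<open>auto simp: mstep_simps\<close>)
  finally show ?thesis by (rule go_mono) simp
next
  case False
  have "go (Diag s, (x, y), P \<union> B) 1 (Diag (\<not> s), if s then (x, y + 1) else (x + 1, y), P \<union> B)"
    by (rule go1) (use False xy f in_area[of x y] in \<open>auto simp: mstep_simps\<close>)
  then show ?thesis by (rule go_mono) simp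
qed

definition far_side :: "int \<Rightarrow> int \<Rightarrow> bool" where
  "far_side x y \<longleftrightarrow> x = b \<and> c < y \<and> y \<le> d \<or> y = d \<and> a < x \<and> x \<le> b"

text \<open>Consecutive pixels of the staircase differ in parity, so of the first two on the inner
  lane one is a ring tile, and the robot cannot slip through a gap of the zigzag. As
  \<open>x - y\<close> takes only two values, the side that is hit compares width and
  height.\<close>

lemma staircase:
  assumes "a < x" "x < b" "c < y" "y < d" "x - y = k + of_bool s" and f: "fits (P \<union> B)"
  shows "\<exists>x' y' s'. (x', y') \<in> B \<and> far_side x' y' \<and> k \<le> x' - y' \<and> x' - y' \<le> k + 1 \<and>
    go (Diag s, (x, y), P \<union> B) (8 * nat (b - x + d - y) + 8) (Diag s', (x', y'), P \<union> B)"
  using assms(1-5)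
proof (induction "nat (b - x + d - y)" arbitrary: x y s rule: less_induct)
  case less
  have nB: "(x, y) \<notin> B" using B_only[of x y] less.prems by auto
  define x1 y1 where "x1 = (if s then x else x + 1)" and "y1 = (if s then y + 1 else y)"
  have g1: "go (Diag s, (x, y), P \<union> B) 8 (Diag (\<not> s), (x1, y1), P \<union> B)"
    using diag_step[OF nB, of s] less.prems f by (cases s) (auto simp: x1_def y1_def)
  have r1: "x1 - y1 = k + of_bool (\<not> s)" "a < x1" "x1 \<le> b" "c < y1" "y1 \<le> d"
    using less.prems by (cases s; auto simp: x1_def y1_def)+
  have m1: "nat (b - x + d - y) = Suc (nat (b - x1 + d - y1))"
    using less.prems by (cases s) (auto simp: x1_def y1_def)
  show ?case
  proof (cases "x1 < b \<and> y1 < d")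
    case True
    then obtain x' y' s' where "(x', y') \<in> B" "far_side x' y'" "k \<le> x' - y'" "x' - y' \<le> k + 1"
      and g: "go (Diag (\<not> s), (x1, y1), P \<union> B) (8 * nat (b - x1 + d - y1) + 8) (Diag s', (x', y'), P \<union> B)"
      using less.hyps[of x1 y1 "\<not> s"] r1 m1 by auto
    moreover have "go (Diag s, (x, y), P \<union> B) (8 * nat (b - x + d - y) + 8) (Diag s', (x', y'), P \<union> B)"
      by (rule go_mono[OF go_trans[OF g1 g]]) (simp add: m1)
    ultimately show ?thesis by blast
  next
    case False
    then have fs: "far_side x1 y1" using r1 by (auto simp: far_side_def)
    show ?thesis
    proof (cases "(x1, y1) \<in> B")
      case True
      have "go (Diag s, (x, y), P \<union> B) (8 * nat (b - x + d - y) + 8) (Diag (\<not> s), (x1, y1), P \<union> B)"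
        by (rule go_mono[OF g1]) simp
      moreover have "k \<le> x1 - y1 \<and> x1 - y1 \<le> k + 1" using r1 by (cases s) auto
      ultimately show ?thesis using True fs by blast
    next
      case nB1: False
      define x2 y2 where "x2 = (if s then x1 + 1 else x1)" and "y2 = (if s then y1 else y1 + 1)"
      have g2: "go (Diag (\<not> s), (x1, y1), P \<union> B) 8 (Diag s, (x2, y2), P \<union> B)"
        using diag_step[OF nB1, of "\<not> s"] r1 f by (cases s) (auto simp: x2_def y2_def)
      have "even (x1 + y1) \<noteq> e"
      proof
        assume "even (x1 + y1) = e"
        then have "(x1, y1) \<in> B" by (rule B_in) (use fs in \<open>auto simp: far_side_def\<close>)
        with nB1 show False ..
      qed
      then have ev: "even (x2 + y2) = e" by (cases s) (auto simp: x2_def y2_def)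
      \<comment> \<open>Right and up alternate, so the step after reaching the lane runs along
        it.\<close>
      have fs2: "far_side x2 y2"
        using False less.prems r1 by (cases s) (auto simp: far_side_def x2_def y2_def x1_def y1_def)
      then have "(x2, y2) \<in> B" using B_in[OF ev] r1(2,4) by (auto simp: far_side_def)
      moreover have "go (Diag s, (x, y), P \<union> B) (8 * nat (b - x + d - y) + 8) (Diag s, (x2, y2), P \<union> B)"
        by (rule go_mono[OF go_trans[OF g1 g2]]) (simp add: m1)
      moreover have "k \<le> x2 - y2 \<and> x2 - y2 \<le> k + 1" using r1 by (cases s) (auto simp: x2_def y2_def)
      ultimately show ?thesis using fs2 by blast
    qed
  qed
qed

lemma far_side_ring:
  assumes xy: "(x, y) \<in> B" "far_side x y"
  shows "ring_test (P \<union> B) x y"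
proof (rule B_ring)
  note bs = box_size and B = B_only[OF xy(1)]
  show "(x, y) \<in> B" by (rule xy(1))
  show "(x, y + 1) \<notin> P \<union> B" using near_ring[OF xy(1), of x "y + 1"] B B_only[of x "y + 1"] by auto
  show "(x, y - 1) \<notin> P \<union> B" using near_ring[OF xy(1), of x "y - 1"] B B_only[of x "y - 1"] by auto
  have p: "even (x + 1 + (y + 1)) = e" "even (x + 1 + (y - 1)) = e" using B by auto
  have "x + 1 < b \<and> y = d \<or> x + 1 = b \<and> y = d \<or> x = b \<and> c + 1 < y \<and> y \<le> d \<or> x = b \<and> y = c + 1"
    using xy(2) bs by (auto simp: far_side_def)
  then show "(x + 1, y + 1) \<in> B \<or> (x + 1, y - 1) \<in> B"
    using B_in[OF p(1)] B_in[OF p(2)] bs xy(2) unfolding far_side_def by (smt (verit))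
qed simp

text \<open>A tile two columns to the right shows that the upper side was hit. The slack 4 is the
  sum of 2 for \<open>l - a\<close>, 1 for the two values of \<open>x - y\<close>, and 1 because the
  probe may also fail in column \<open>b - 1\<close>.\<close>

lemma decide:
  assumes l: "start_col l" and f: "fits (P \<union> B)"
  defines "n \<equiv> 8 * nat (b - a) + 8 * nat (d - c) + 30"
  shows "\<exists>x y. (x, y) \<in> B \<and>
    (go (Dia0, (l, c - 1), P \<union> B) n (Nav0 True F0, (x, y), P \<union> B) \<and> d - c \<le> b - a \<or>
     go (Dia0, (l, c - 1), P \<union> B) n (Flip, (x + 1, y), P \<union> B) \<and> b - a \<le> d - c + 4)"
proof -
  note bs = box_size
  have la: "a \<le> l" "l \<le> a + 2" "(l, c - 1) \<in> B" using l by (auto simp: start_col_def)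
  have st: "mstep dl (q, p, T) = (q', move d' p, T)" if "\<And>b. dl q b = (q', b, d')" for q q' d' p T
    using that by (cases "p \<in> T") (auto simp: mstep_simps)
  have "go (Dia0, (l, c - 1), P \<union> B) 1 (Dia1, (l + 1, c - 1), P \<union> B)"
    by (rule go1) (use st[of Dia0 Dia1 Right] f in_area[of l "c - 1"] la bs in auto)
  also have "go (Dia1, (l + 1, c - 1), P \<union> B) 1 (Dia2, (l + 1, c), P \<union> B)"
    by (rule go1) (use st[of Dia1 Dia2 Up] f in_area[of "l + 1" "c - 1"] la bs in auto)
  also have "go (Dia2, (l + 1, c), P \<union> B) 1 (Diag False, (l + 1, c + 1), P \<union> B)"
    by (rule go1) (use st[of Dia2 "Diag False" Up] f in_area[of "l + 1" c] la bs in auto)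
  finally have g1: "go (Dia0, (l, c - 1), P \<union> B) (1 + 1 + 1) (Diag False, (l + 1, c + 1), P \<union> B)" .
  obtain x y s where xy: "(x, y) \<in> B" "far_side x y" "l - c \<le> x - y" "x - y \<le> l - c + 1"
    and g2: "go (Diag False, (l + 1, c + 1), P \<union> B) (8 * nat (b - (l + 1) + d - (c + 1)) + 8) (Diag s, (x, y), P \<union> B)"
    using staircase[of "l + 1" "c + 1" "l - c" False] la bs f by auto
  have inA: "(u, v) \<in> area L" if "\<bar>u - x\<bar> \<le> 2" "\<bar>v - y\<bar> \<le> 2" for u v
    by (rule in_area) (use that B_range[OF xy(1)] in auto)
  have "go (Diag s, (x, y), P \<union> B) 1 (Tst1 (CDiag s), (x + 1, y), P \<union> B)"
    by (rule go1) (use xy f inA in \<open>auto simp: mstep_simps\<close>)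
  also have "go (Tst1 (CDiag s), (x + 1, y), P \<union> B) 6 (TR (CDiag s), (x, y), P \<union> B)"
    using test_ring[of x y "P \<union> B" "CDiag s"] far_side_ring[OF xy(1,2)] inA f by auto
  also have "go (TR (CDiag s), (x, y), P \<union> B) 1 (Dec1, (x + 1, y), P \<union> B)"
    by (rule go1) (use st[of "TR (CDiag s)" Dec1 Right] f inA in auto)
  also have "go (Dec1, (x + 1, y), P \<union> B) 1 (Dec2, (x + 2, y), P \<union> B)"
    by (rule go1) (use st[of Dec1 Dec2 Right] f inA in auto)
  finally have g3: "go (Diag s, (x, y), P \<union> B) (1 + 6 + 1 + 1) (Dec2, (x + 2, y), P \<union> B)" .
  have "nat (b - (l + 1) + d - (c + 1)) \<le> nat (b - a) + nat (d - c)" using la bs by auto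
  then have n: "1 + 1 + 1 + (8 * nat (b - (l + 1) + d - (c + 1)) + 8) + (1 + 6 + 1 + 1) + 1 + 1 \<le> n"
    unfolding n_def by linarith
  have g4: "go (Dia0, (l, c - 1), P \<union> B)
    (1 + 1 + 1 + (8 * nat (b - (l + 1) + d - (c + 1)) + 8) + (1 + 6 + 1 + 1)) (Dec2, (x + 2, y), P \<union> B)"
    by (rule go_trans[OF go_trans[OF g1 g2] g3])
  show ?thesis
  proof (cases "(x + 2, y) \<in> P \<union> B")
    case True
    note g4
    also have "go (Dec2, (x + 2, y), P \<union> B) 1 (Dec3, (x + 1, y), P \<union> B)"
      by (rule go1) (use True f inA in \<open>auto simp: mstep_simps\<close>)
    also have "go (Dec3, (x + 1, y), P \<union> B) 1 (Nav0 True F0, (x, y), P \<union> B)"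
      by (rule go1) (use st[of Dec3 "Nav0 True F0" Left] f inA in auto)
    finally have "go (Dia0, (l, c - 1), P \<union> B) n (Nav0 True F0, (x, y), P \<union> B)"
      by (rule go_mono) (use n in simp)
    moreover have "d - c \<le> b - a"
    proof -
      have "x \<noteq> b" using True P_in[of "x + 2" y] B_range[of "x + 2" y] by auto
      then have "y = d" "x < b" using xy(2) by (auto simp: far_side_def)
      then show ?thesis using xy la by auto
    qed
    ultimately show ?thesis using xy(1) by blast
  next
    case False
    have "go (Dec2, (x + 2, y), P \<union> B) 1 (Flip, (x + 1, y), P \<union> B)"
      by (rule go1) (use False f inA in \<open>auto simp: mstep_simps\<close>)
    from go_trans[OF g4 this] have "go (Dia0, (l, c - 1), P \<union> B) n (Flip, (x + 1, y), P \<union> B)"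
      by (rule go_mono) (use n in simp)
    moreover have "b - a \<le> d - c + 4"
    proof -
      have p: "even (x + 2 + y) = e" using B_only[OF xy(1)] by auto
      have "b - 2 < x"
      proof (rule ccontr)
        assume "\<not> b - 2 < x"
        then have "(x + 2, y) \<in> B" using xy(2) by (intro B_in[OF p]) (auto simp: far_side_def)
        then show False using False by blast
      qed
      then show ?thesis using xy la by (auto simp: far_side_def)
    qed
    ultimately show ?thesis using xy(1) by blast
  qed
qed

end

section \<open>The shape of a bounding box\<close>

lemma zigzag_parity:
  assumes "closed_zigzag B"
  obtains e where "\<And>x y. (x, y) \<in> B \<Longrightarrow> even (x + y) = e"
proof -
  obtain ts where ts: "set ts = B"
    "\<And>i. i < length ts \<Longrightarrow> diagonal_pair (ts ! i) (ts ! ((i + 1) mod length ts))"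
    using assms unfolding closed_zigzag_def by auto
  have "even (fst (ts ! i) + snd (ts ! i)) = even (fst (ts ! 0) + snd (ts ! 0))" if "i < length ts" for i
    using that
  proof (induction i)
    case (Suc i)
    then have "diagonal_pair (ts ! i) (ts ! Suc i)" using ts(2)[of i] by simp
    then have "even (fst (ts ! i) + snd (ts ! i)) = even (fst (ts ! Suc i) + snd (ts ! Suc i))"
      unfolding diagonal_pair_def by presburger
    with Suc show ?case by simp
  qed simp
  then have par: "even (fst q + snd q) = even (fst (ts ! 0) + snd (ts ! 0))" if "q \<in> B" for q
    using that ts(1) by (metis in_set_conv_nth)
  show ?thesis
    by (rule that[of "even (fst (ts ! 0) + snd (ts ! 0))"]) (use par in \<open>metis fst_conv snd_conv\<close>)
qed

lemma zigzag_degree: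
  assumes "closed_zigzag B" "q \<in> B"
  shows "\<exists>r\<in>B. \<exists>s\<in>B. r \<noteq> s \<and> diagonal_pair q r \<and> diagonal_pair q s"
proof -
  obtain ts where ts: "set ts = B" "distinct ts" "3 \<le> length ts"
    "\<And>i. i < length ts \<Longrightarrow> diagonal_pair (ts ! i) (ts ! ((i + 1) mod length ts))"
    using assms unfolding closed_zigzag_def by auto
  let ?n = "length ts"
  obtain i where i: "i < ?n" "ts ! i = q" using assms(2) ts(1) by (auto simp: in_set_conv_nth)
  let ?p = "(i + ?n - 1) mod ?n" and ?s = "(i + 1) mod ?n"
  have lt: "?p < ?n" "?s < ?n" using i by (auto intro: mod_less_divisor)
  have "?p = (if i = 0 then ?n - 1 else i - 1)"
    using i ts(3) by (auto simp: mod_if)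
  moreover have "?s = (if i = ?n - 1 then 0 else i + 1)"
  proof (cases "i = ?n - 1")
    case True
    then have "i + 1 = ?n" using ts(3) by linarith
    then show ?thesis using True by simp
  qed (use i in auto)
  ultimately have ps: "?p \<noteq> ?s" "(?p + 1) mod ?n = i" using i ts(3) by (auto split: if_splits)
  have "diagonal_pair (ts ! ?p) q" using ts(4)[OF lt(1)] ps(2) i(2) by simp
  then have "diagonal_pair q (ts ! ?p)" by (simp add: diagonal_pair_def abs_minus_commute)
  moreover have "diagonal_pair q (ts ! ?s)" using ts(4)[OF i(1)] i(2) by simp
  moreover have "ts ! ?p \<noteq> ts ! ?s" using nth_eq_iff_index_eq[OF ts(2) lt] ps(1) by simp
  moreover have "ts ! ?p \<in> B" "ts ! ?s \<in> B" using ts(1) lt nth_mem by blast+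
  ultimately show ?thesis by blast
qed

section \<open>Reachability in the complement of the ring\<close>

lemma linked_sym: "(p, q) \<in> linked_in S \<Longrightarrow> (q, p) \<in> linked_in S"
proof -
  have "sym {(p, q). p \<in> S \<and> q \<in> S \<and> adjacent p q}"
    unfolding sym_def adjacent_def by (auto simp: abs_minus_commute)
  then show "(p, q) \<in> linked_in S \<Longrightarrow> (q, p) \<in> linked_in S"
    unfolding linked_in_def using sym_rtrancl unfolding sym_def by blast
qed

lemma linked_trans: "(p, q) \<in> linked_in S \<Longrightarrow> (q, r) \<in> linked_in S \<Longrightarrow> (p, r) \<in> linked_in S"
  unfolding linked_in_def by (rule rtrancl_trans)

lemma linked_step: "p \<in> S \<Longrightarrow> q \<in> S \<Longrightarrow> adjacent p q \<Longrightarrow> (p, q) \<in> linked_in S"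
  unfolding linked_in_def by auto

lemma linked_row:
  assumes "x \<le> x'" "\<And>u. x \<le> u \<Longrightarrow> u \<le> x' \<Longrightarrow> (u, y) \<in> S"
  shows "((x, y), (x', y)) \<in> linked_in S"
  using assms
proof (induction x' rule: int_ge_induct)
  case base
  then show ?case by (simp add: linked_in_def)
next
  case (step u)
  then show ?case
    by (intro linked_trans[OF step.IH linked_step]) (auto simp: adjacent_def)
qed

lemma linked_column:
  assumes "y \<le> y'" "\<And>v. y \<le> v \<Longrightarrow> v \<le> y' \<Longrightarrow> (x, v) \<in> S"
  shows "((x, y), (x, y')) \<in> linked_in S"
  using assms
proof (induction y' rule: int_ge_induct)
  case base
  then show ?case by (simp add: linked_in_def)
next
  case (step v)
  then show ?case
    by (intro linked_trans[OF step.IH linked_step]) (auto simp: adjacent_def)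
qed

lemma linked_rectangle:
  assumes "{x1..x2} \<times> {y1..y2} \<subseteq> S" "p \<in> {x1..x2} \<times> {y1..y2}" "q \<in> {x1..x2} \<times> {y1..y2}"
  shows "(p, q) \<in> linked_in S"
proof -
  obtain x y x' y' where pq: "p = (x, y)" "q = (x', y')" by (cases p, cases q)
  have "((x, y), (x', y)) \<in> linked_in S"
    using assms pq linked_row[of x x' y S] linked_row[of x' x y S] linked_sym
    by (cases "x \<le> x'") (fastforce)+
  moreover have "((x', y), (x', y')) \<in> linked_in S"
    using assms pq linked_column[of y y' x' S] linked_column[of y' y x' S] linked_sym
    by (cases "y \<le> y'") (fastforce)+
  ultimately show ?thesis using pq linked_trans by blast
qed

lemma infinite_rays:
  "infinite ((\<lambda>v. (x, v)) ` {y..} :: pixel set)" "infinite ((\<lambda>v. (x, v)) ` {..y} :: pixel set)"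
  "infinite ((\<lambda>u. (u, y)) ` {x..} :: pixel set)" "infinite ((\<lambda>u. (u, y)) ` {..x} :: pixel set)"
  by (auto simp: finite_image_iff inj_on_def infinite_Ici infinite_Iic)

text \<open>If a ray from a reachable pixel missed the ring, its infinitely many pixels would all be
  reachable.\<close>

lemma no_escape:
  assumes "encloses B P" "p \<in> P" "(p, (x, y)) \<in> linked_in (- B)"
  shows "\<exists>v\<ge>y. (x, v) \<in> B" "\<exists>v\<le>y. (x, v) \<in> B" "\<exists>u\<ge>x. (u, y) \<in> B" "\<exists>u\<le>x. (u, y) \<in> B"
proof -
  have fin: "finite {q. (p, q) \<in> linked_in (- B)}" using assms by (auto simp: encloses_def)
  have no: "\<not> infinite R" if "\<And>r. r \<in> R \<Longrightarrow> ((x, y), r) \<in> linked_in (- B)" for R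
  proof -
    have "R \<subseteq> {q. (p, q) \<in> linked_in (- B)}" using that assms(3) linked_trans by blast
    then show ?thesis using fin finite_subset by blast
  qed
  show "\<exists>v\<ge>y. (x, v) \<in> B"
  proof (rule ccontr)
    assume *: "\<not> ?thesis"
    have "((x, y), r) \<in> linked_in (- B)" if "r \<in> (\<lambda>v. (x, v)) ` {y..}" for r
      using that * by (auto intro!: linked_column)
    with no infinite_rays(1) show False by blast
  qed
  show "\<exists>v\<le>y. (x, v) \<in> B"
  proof (rule ccontr)
    assume *: "\<not> ?thesis"
    have "((x, y), r) \<in> linked_in (- B)" if "r \<in> (\<lambda>v. (x, v)) ` {..y}" for r
      using that * by (auto intro!: linked_sym[OF linked_column])
    with no infinite_rays(2) show False by blast
  qed
  show "\<exists>u\<ge>x. (u, y) \<in> B"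
  proof (rule ccontr)
    assume *: "\<not> ?thesis"
    have "((x, y), r) \<in> linked_in (- B)" if "r \<in> (\<lambda>u. (u, y)) ` {x..}" for r
      using that * by (auto intro!: linked_row)
    with no infinite_rays(3) show False by blast
  qed
  show "\<exists>u\<le>x. (u, y) \<in> B"
  proof (rule ccontr)
    assume *: "\<not> ?thesis"
    have "((x, y), r) \<in> linked_in (- B)" if "r \<in> (\<lambda>u. (u, y)) ` {..x}" for r
      using that * by (auto intro!: linked_sym[OF linked_row])
    with no infinite_rays(4) show False by blast
  qed
qed

text \<open>Every interior row and column must be blocked in the two lanes at both ends, and parity
  decides which lane holds the tile. The outer corners are excluded because each ring tile has two
  diagonal neighbours in the ring.\<close>

lemma boxed_of_bounding_box:
  assumes poly: "polyomino P" and bb: "bounding_box k P B"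
  shows "\<exists>a b c d e. boxed P B a b c d e \<and> xmin P - a \<le> int k \<and> b - xmax P \<le> int k \<and>
    ymin P - c \<le> int k \<and> d - ymax P \<le> int k"
proof -
  obtain a b c d where abcd:
    "a < xmin P" "xmin P - a \<le> int k" "xmax P < b" "b - xmax P \<le> int k"
    "c < ymin P" "ymin P - c \<le> int k" "ymax P < d" "d - ymax P \<le> int k"
    and lanes: "B \<subseteq> lane a b c d \<union> lane (a - 1) (b + 1) (c - 1) (d + 1)"
    and zz: "closed_zigzag B" and enc: "encloses B P"
    and touch: "\<And>p q. p \<in> P \<Longrightarrow> q \<in> B \<Longrightarrow> \<not> touching p q"
    using bb unfolding bounding_box_def by blast
  obtain e where e: "\<And>x y. (x, y) \<in> B \<Longrightarrow> even (x + y) = e"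
    by (rule zigzag_parity[OF zz]) blast
  have P: "finite P" "P \<noteq> {}" using poly by (auto simp: polyomino_def)
  have in_box: "a < x \<and> x < b \<and> c < y \<and> y < d" if "(x, y) \<in> P" for x y
  proof -
    have "x \<in> fst ` P" "y \<in> snd ` P" using that by force+
    then have "xmin P \<le> x" "x \<le> xmax P" "ymin P \<le> y" "y \<le> ymax P"
      unfolding xmin_def xmax_def ymin_def ymax_def using P by auto
    then show ?thesis using abcd by linarith
  qed
  have rng: "a - 1 \<le> x \<and> x \<le> b + 1 \<and> c - 1 \<le> y \<and> y \<le> d + 1 \<and> \<not> (a < x \<and> x < b \<and> c < y \<and> y < d)"
    if "(x, y) \<in> B" for x y
    using lanes that unfolding lane_def by auto
  obtain p where p: "p \<in> P" using P by blast
  have inside: "(p, (x, y)) \<in> linked_in (- B)" if "a < x" "x < b" "c < y" "y < d" for x y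
  proof (rule linked_rectangle)
    show "{a + 1..b - 1} \<times> {c + 1..d - 1} \<subseteq> - B" using rng by fastforce
    show "p \<in> {a + 1..b - 1} \<times> {c + 1..d - 1}" using in_box[of "fst p" "snd p"] p by (cases p) auto
  qed (use that in auto)
  have ext: "(p, q) \<in> linked_in (- B)" if "(p, r) \<in> linked_in (- B)" "r \<notin> B" "q \<notin> B" "adjacent r q" for q r
    using that linked_trans linked_step by blast
  obtain px py where pxy: "p = (px, py)" by (cases p)
  have box: "a + 2 \<le> b" "c + 2 \<le> d" using in_box p pxy by force+
  have free: "(x, y) \<notin> B" if "a < x" "x < b" "c < y" "y < d" for x y using rng that by blast
  have top: "(x, d) \<in> B \<or> (x, d + 1) \<in> B" if x: "a < x" "x < b" for x
  proof (rule ccontr)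
    assume n: "\<not> ?thesis"
    have "(p, (x, d)) \<in> linked_in (- B)"
      by (rule ext[OF inside[of x "d - 1"]]) (use x n box free in \<open>auto simp: adjacent_def\<close>)
    from no_escape(1)[OF enc p this] obtain v where v: "v \<ge> d" "(x, v) \<in> B" by blast
    then have "v = d \<or> v = d + 1" using rng[OF v(2)] by linarith
    with v n show False by blast
  qed
  have bot: "(x, c) \<in> B \<or> (x, c - 1) \<in> B" if x: "a < x" "x < b" for x
  proof (rule ccontr)
    assume n: "\<not> ?thesis"
    have "(p, (x, c)) \<in> linked_in (- B)"
      by (rule ext[OF inside[of x "c + 1"]]) (use x n box free in \<open>auto simp: adjacent_def\<close>)
    from no_escape(2)[OF enc p this] obtain v where v: "v \<le> c" "(x, v) \<in> B" by blast
    then have "v = c \<or> v = c - 1" using rng[OF v(2)] by linarith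
    with v n show False by blast
  qed
  have left: "(a, y) \<in> B \<or> (a - 1, y) \<in> B" if y: "c < y" "y < d" for y
  proof (rule ccontr)
    assume n: "\<not> ?thesis"
    have "(p, (a, y)) \<in> linked_in (- B)"
      by (rule ext[OF inside[of "a + 1" y]]) (use y n box free in \<open>auto simp: adjacent_def\<close>)
    from no_escape(4)[OF enc p this] obtain v where v: "v \<le> a" "(v, y) \<in> B" by blast
    then have "v = a \<or> v = a - 1" using rng[OF v(2)] by linarith
    with v n show False by blast
  qed
  have right: "(b, y) \<in> B \<or> (b + 1, y) \<in> B" if y: "c < y" "y < d" for y
  proof (rule ccontr)
    assume n: "\<not> ?thesis"
    have "(p, (b, y)) \<in> linked_in (- B)"
      by (rule ext[OF inside[of "b - 1" y]]) (use y n box free in \<open>auto simp: adjacent_def\<close>)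
    from no_escape(3)[OF enc p this] obtain v where v: "v \<ge> b" "(v, y) \<in> B" by blast
    then have "v = b \<or> v = b + 1" using rng[OF v(2)] by linarith
    with v n show False by blast
  qed
  \<comment> \<open>The horizontal neighbour of an inner corner has the wrong parity and is open.
    Through it an empty corner would be reachable, and the vertical ray from there meets no
    tile.\<close>
  have corner: "(x, y) \<in> B" if xy: "x = a \<or> x = b" "y = c \<or> y = d" "even (x + y) = e" for x y
  proof (rule ccontr)
    assume n: "(x, y) \<notin> B"
    define x' where "x' = (if x = a then a + 1 else b - 1)"
    define y' where "y' = (if y = c then c + 1 else d - 1)"
    have x': "a < x'" "x' < b" "\<bar>x' - x\<bar> = 1" using xy box by (auto simp: x'_def)
    have y': "c < y'" "y' < d" "\<bar>y' - y\<bar> = 1" using xy box by (auto simp: y'_def)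
    have nx': "(x', y) \<notin> B" using e[of x' y] xy(3) x'(3) by (auto; presburger)
    have "(p, (x', y)) \<in> linked_in (- B)"
      by (rule ext[OF inside[of x' y']]) (use x' y' nx' free in \<open>auto simp: adjacent_def\<close>)
    then have l: "(p, (x, y)) \<in> linked_in (- B)"
      by (rule ext) (use x' n nx' in \<open>auto simp: adjacent_def\<close>)
    have odd: "(x, y + 1) \<notin> B" "(x, y - 1) \<notin> B" using e[of x "y + 1"] e[of x "y - 1"] xy(3) by auto
    show False
    proof (cases "y = d")
      case True
      from no_escape(1)[OF enc p l] obtain v where v: "v \<ge> y" "(x, v) \<in> B" by blast
      then have "v = y \<or> v = y + 1" using rng[OF v(2)] True by linarith
      with v n odd show False by blast
    next
      case False
      then have "y = c" using xy by blast
      from no_escape(2)[OF enc p l] obtain v where v: "v \<le> y" "(x, v) \<in> B" by blast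
      then have "v = y \<or> v = y - 1" using rng[OF v(2)] \<open>y = c\<close> by linarith
      with v n odd show False by blast
    qed
  qed
  have B_in: "(x, y) \<in> B" if ev: "even (x + y) = e" and cases:
      "a \<le> x \<and> x \<le> b \<and> (y = c \<or> y = d) \<or> a < x \<and> x < b \<and> (y = c - 1 \<or> y = d + 1) \<or>
      c \<le> y \<and> y \<le> d \<and> (x = a \<or> x = b) \<or> c < y \<and> y < d \<and> (x = a - 1 \<or> x = b + 1)" for x y
  proof -
    have odd: "(x + 1, y) \<notin> B" "(x - 1, y) \<notin> B" "(x, y + 1) \<notin> B" "(x, y - 1) \<notin> B"
      using e[of "x + 1" y] e[of "x - 1" y] e[of x "y + 1"] e[of x "y - 1"] ev by auto
    consider "(x = a \<or> x = b) \<and> (y = c \<or> y = d)" | "a < x" "x < b" "y = c \<or> y = d \<or> y = c - 1 \<or> y = d + 1"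
      | "c < y" "y < d" "x = a \<or> x = b \<or> x = a - 1 \<or> x = b + 1" using cases by linarith
    then show ?thesis
    proof cases
      case 1
      then show ?thesis using corner ev by blast
    next
      case 2
      then show ?thesis using top[OF 2(1,2)] bot[OF 2(1,2)] odd by auto
    next
      case 3
      then show ?thesis using left[OF 3(1,2)] right[OF 3(1,2)] odd by auto
    qed
  qed
  have deg: "\<exists>r s r' s'. (r, s) \<in> B \<and> (r', s') \<in> B \<and> (r, s) \<noteq> (r', s') \<and>
      \<bar>x - r\<bar> = 1 \<and> \<bar>y - s\<bar> = 1 \<and> \<bar>x - r'\<bar> = 1 \<and> \<bar>y - s'\<bar> = 1" if xy: "(x, y) \<in> B" for x y
  proof -
    obtain u v where "u \<in> B" "v \<in> B" "u \<noteq> v" "diagonal_pair (x, y) u" "diagonal_pair (x, y) v"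
      using zigzag_degree[OF zz xy] by blast
    moreover obtain r s r' s' where "u = (r, s)" "v = (r', s')" by (cases u, cases v)
    ultimately have "(r, s) \<in> B \<and> (r', s') \<in> B \<and> (r, s) \<noteq> (r', s') \<and>
      \<bar>x - r\<bar> = 1 \<and> \<bar>y - s\<bar> = 1 \<and> \<bar>x - r'\<bar> = 1 \<and> \<bar>y - s'\<bar> = 1"
      by (auto simp: diagonal_pair_def)
    then show ?thesis by blast
  qed
  have outer: "\<not> ((x = a - 1 \<or> x = b + 1) \<and> (y = c - 1 \<or> y = d + 1))" if "(x, y) \<in> B" for x y
  proof
    assume xy: "(x = a - 1 \<or> x = b + 1) \<and> (y = c - 1 \<or> y = d + 1)"
    from deg[OF that] obtain r s r' s' where B: "(r, s) \<in> B" "(r', s') \<in> B" and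
      *: "(r, s) \<noteq> (r', s')" "\<bar>x - r\<bar> = 1" "\<bar>y - s\<bar> = 1" "\<bar>x - r'\<bar> = 1" "\<bar>y - s'\<bar> = 1" by blast
    have "r = r'" using * xy rng[OF B(1)] rng[OF B(2)] by linarith
    moreover have "s = s'" using * xy rng[OF B(1)] rng[OF B(2)] by linarith
    ultimately show False using * by blast
  qed
  \<comment> \<open>A tile in an outer vertical lane has diagonal neighbours only in the inner lane
    beside it, so it needs both.\<close>
  have side: "(r, y - 1) \<in> B \<and> (r, y + 1) \<in> B" if "(x, y) \<in> B" "x = a - 1 \<and> r = a \<or> x = b + 1 \<and> r = b" for x y r
  proof -
    from deg[OF that(1)] obtain r1 s1 r2 s2 where B: "(r1, s1) \<in> B" "(r2, s2) \<in> B" and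
      *: "(r1, s1) \<noteq> (r2, s2)" "\<bar>x - r1\<bar> = 1" "\<bar>y - s1\<bar> = 1" "\<bar>x - r2\<bar> = 1" "\<bar>y - s2\<bar> = 1" by blast
    have "r1 = r" "r2 = r" using * that(2) rng[OF B(1)] rng[OF B(2)] by linarith+
    moreover from this have "s1 = y - 1 \<and> s2 = y + 1 \<or> s1 = y + 1 \<and> s2 = y - 1" using * by auto
    ultimately show ?thesis using B by auto
  qed
  have side': "(x - 1, r) \<in> B \<and> (x + 1, r) \<in> B" if "(x, y) \<in> B" "y = c - 1 \<and> r = c \<or> y = d + 1 \<and> r = d" for x y r
  proof -
    from deg[OF that(1)] obtain r1 s1 r2 s2 where B: "(r1, s1) \<in> B" "(r2, s2) \<in> B" and
      *: "(r1, s1) \<noteq> (r2, s2)" "\<bar>x - r1\<bar> = 1" "\<bar>y - s1\<bar> = 1" "\<bar>x - r2\<bar> = 1" "\<bar>y - s2\<bar> = 1" by blast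
    have "s1 = r" "s2 = r" using * that(2) rng[OF B(1)] rng[OF B(2)] by linarith+
    moreover from this have "r1 = x - 1 \<and> r2 = x + 1 \<or> r1 = x + 1 \<and> r2 = x - 1" using * by auto
    ultimately show ?thesis using B by auto
  qed
  have "boxed P B a b c d e"
  proof
    show "polyomino P" by (rule poly)
    show "finite B" using zz unfolding closed_zigzag_def by auto
    fix x y
    show "a + 2 \<le> x \<and> x \<le> b - 2 \<and> c + 2 \<le> y \<and> y \<le> d - 2" if xy: "(x, y) \<in> P"
    proof -
      note ib = in_box[OF xy]
      have nt: "(u, v) \<notin> B" if "\<bar>x - u\<bar> \<le> 1" "\<bar>y - v\<bar> \<le> 1" for u v
        using touch[OF xy, of "(u, v)"] that by (auto simp: touching_def)
      \<comment> \<open>Of two consecutive pixels of the inner lane one is a ring tile; a tile of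
        \<open>P\<close> right next to the lane would touch it.\<close>
      have par: "even (u + v) = e \<or> even (u + (v + 1)) = e" for u v :: int by auto
      have par': "even (u + v) = e \<or> even (u + 1 + v) = e" for u v :: int by auto
      have "x \<noteq> a + 1" using par[of a y] B_in[of a y] B_in[of a "y + 1"] nt[of a y] nt[of a "y + 1"] ib by auto
      moreover have "x \<noteq> b - 1" using par[of b y] B_in[of b y] B_in[of b "y + 1"] nt[of b y] nt[of b "y + 1"] ib by auto
      moreover have "y \<noteq> c + 1" using par'[of x c] B_in[of x c] B_in[of "x + 1" c] nt[of x c] nt[of "x + 1" c] ib by auto
      moreover have "y \<noteq> d - 1" using par'[of x d] B_in[of x d] B_in[of "x + 1" d] nt[of x d] nt[of "x + 1" d] ib by auto
      ultimately show ?thesis using ib by auto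
    qed
    show "even (x + y) = e \<and> a - 1 \<le> x \<and> x \<le> b + 1 \<and> c - 1 \<le> y \<and> y \<le> d + 1 \<and>
      \<not> (a < x \<and> x < b \<and> c < y \<and> y < d) \<and> \<not> ((x = a - 1 \<or> x = b + 1) \<and> (y = c - 1 \<or> y = d + 1))"
      if "(x, y) \<in> B"
      using e[OF that] rng[OF that] outer[OF that] by blast
    show "(x, y) \<in> B" if "even (x + y) = e"
      "a \<le> x \<and> x \<le> b \<and> (y = c \<or> y = d) \<or> a < x \<and> x < b \<and> (y = c - 1 \<or> y = d + 1) \<or>
      c \<le> y \<and> y \<le> d \<and> (x = a \<or> x = b) \<or> c < y \<and> y < d \<and> (x = a - 1 \<or> x = b + 1)"
      using that by (rule B_in)
    show "(a - 1, c) \<in> B \<longleftrightarrow> (a, c - 1) \<in> B" using side[of "a - 1" c a] side'[of a "c - 1" c] by auto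
    show "(b + 1, c) \<in> B \<longleftrightarrow> (b, c - 1) \<in> B" using side[of "b + 1" c b] side'[of b "c - 1" c] by auto
    show "(a - 1, d) \<in> B \<longleftrightarrow> (a, d + 1) \<in> B" using side[of "a - 1" d a] side'[of a "d + 1" d] by auto
  qed
  with abcd show ?thesis by blast
qed

section \<open>Symmetry under exchange of the axes\<close>

lemma linked_swap: "(p, q) \<in> linked_in P \<Longrightarrow> (prod.swap p, prod.swap q) \<in> linked_in (prod.swap ` P)"
  unfolding linked_in_def
proof (induction rule: rtrancl_induct)
  case (step q r)
  then have "(prod.swap q, prod.swap r) \<in>
    {(p, q). p \<in> prod.swap ` P \<and> q \<in> prod.swap ` P \<and> adjacent p q}"
    by (auto simp: adjacent_def)
  with step.IH show ?case by (rule rtrancl_into_rtrancl)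
qed simp

lemma polyomino_swap:
  assumes "polyomino P"
  shows "polyomino (prod.swap ` P)"
  unfolding polyomino_def
proof (intro conjI ballI impI)
  show "finite (prod.swap ` P)" "prod.swap ` P \<noteq> {}" using assms by (auto simp: polyomino_def)
  fix p q assume "p \<in> prod.swap ` P" "q \<in> prod.swap ` P"
  then obtain p' q' where pq: "p' \<in> P" "q' \<in> P" "p = prod.swap p'" "q = prod.swap q'" by blast
  then show "(p, q) \<in> linked_in (prod.swap ` P)"
    using assms linked_swap[of p' q' P] by (simp add: polyomino_def)
  assume "diagonal_pair p q"
  then have "diagonal_pair p' q'" using pq by (auto simp: diagonal_pair_def)
  then obtain r where "r \<in> P" "adjacent r p'" "adjacent r q'"
    using assms pq unfolding polyomino_def by blast
  then show "\<exists>r\<in>prod.swap ` P. adjacent r p \<and> adjacent r q"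
    using pq by (auto simp: adjacent_def add.commute)
qed

lemma boxed_swap:
  assumes "boxed P B a b c d e"
  shows "boxed (prod.swap ` P) (prod.swap ` B) c d a b e"
proof -
  interpret boxed P B a b c d e by (rule assms)
  have sw: "(x, y) \<in> prod.swap ` S \<longleftrightarrow> (y, x) \<in> S" for x y and S :: "pixel set" by force
  show ?thesis
  proof
    show "polyomino (prod.swap ` P)" using poly by (rule polyomino_swap)
    show "finite (prod.swap ` B)" using B_finite by simp
    fix x y
    show "c + 2 \<le> x \<and> x \<le> d - 2 \<and> a + 2 \<le> y \<and> y \<le> b - 2" if "(x, y) \<in> prod.swap ` P"
      using P_in[of y x] that sw by auto
    show "even (x + y) = e \<and> c - 1 \<le> x \<and> x \<le> d + 1 \<and> a - 1 \<le> y \<and> y \<le> b + 1 \<and>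
      \<not> (c < x \<and> x < d \<and> a < y \<and> y < b) \<and> \<not> ((x = c - 1 \<or> x = d + 1) \<and> (y = a - 1 \<or> y = b + 1))"
      if "(x, y) \<in> prod.swap ` B"
      using B_only[of y x] that sw by (auto simp: add.commute)
    show "(x, y) \<in> prod.swap ` B" if "even (x + y) = e"
      "c \<le> x \<and> x \<le> d \<and> (y = a \<or> y = b) \<or> c < x \<and> x < d \<and> (y = a - 1 \<or> y = b + 1) \<or>
      a \<le> y \<and> y \<le> b \<and> (x = c \<or> x = d) \<or> a < y \<and> y < b \<and> (x = c - 1 \<or> x = d + 1)"
      unfolding sw by (rule B_in) (use that in \<open>auto simp: add.commute\<close>)
  qed (use corners sw in auto)
qed

section \<open>Both orientations\<close>

lemma swap_move: "prod.swap (move d p) = move (flip d) (prod.swap p)"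
  by (cases p; cases d) auto

lemma binary_counter_swap:
  assumes "binary_counter T p d e n v"
  shows "binary_counter (prod.swap ` T) (prod.swap p) (flip d) (flip e) n v"
proof -
  have it: "(move (flip d) ^^ i) (prod.swap p) = prod.swap ((move d ^^ i) p)" for i
    by (induction i) (auto simp: swap_move)
  have mem: "prod.swap q \<in> prod.swap ` T \<longleftrightarrow> q \<in> T" for q by (auto simp: inj_image_mem_iff)
  have "perpendicular (flip d) (flip e)"
    using assms unfolding binary_counter_def perpendicular_def by (cases d; cases e) auto
  moreover have "q \<notin> prod.swap ` T" if "move (flip d) q = prod.swap p" for q
  proof -
    have "prod.swap (move d (prod.swap q)) = prod.swap p" using that by (simp add: swap_move)
    then have "move d (prod.swap q) = p" by (metis swap_swap)
    then have "prod.swap q \<notin> T" using assms unfolding binary_counter_def by blast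
    then show ?thesis using mem[of "prod.swap q"] by simp
  qed
  ultimately show ?thesis
    using assms unfolding binary_counter_def it swap_move[symmetric] mem by auto
qed

abbreviation go2 :: "pixel set \<Rightarrow> nat \<Rightarrow> (bool \<times> label) cfg \<Rightarrow> nat \<Rightarrow> (bool \<times> label) cfg \<Rightarrow> bool" where
  "go2 \<equiv> goes dl2 (UNIV \<times> {Halt})"

lemma goes_area: "goes D S A M s n s' \<Longrightarrow> A \<subseteq> A' \<Longrightarrow> goes D S A' M s n s'"
  by (induction rule: goes.induct) (auto intro: goes.intros)

lemma go2_plain:
  assumes "goes dl {Halt, Flip} A M (l, p, T) n (l', p', T')" "A \<subseteq> A'"
  shows "go2 A' M ((False, l), p, T) n ((False, l'), p', T')"
proof -
  have "go2 (id ` A) M ((False, l), id p, id ` T) n ((False, l'), id p', id ` T')"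
    using goes_simulation[OF assms(1), of dl2 "Pair False" id "UNIV \<times> {Halt}" id]
    by (auto simp: dl2_def)
  then show ?thesis using goes_area assms(2) by fastforce
qed

lemma go2_flipped:
  assumes "goes dl {Halt, Flip} A M (l, p, T) n (l', p', T')" "prod.swap ` A \<subseteq> A'"
  shows "go2 A' M ((True, l), prod.swap p, prod.swap ` T) n ((True, l'), prod.swap p', prod.swap ` T')"
proof -
  have "go2 (prod.swap ` A) M ((True, l), prod.swap p, prod.swap ` T) n
      ((True, l'), prod.swap p', prod.swap ` T')"
    using goes_simulation[OF assms(1), of dl2 "Pair True" flip "UNIV \<times> {Halt}" prod.swap]
    by (auto simp: dl2_def swap_move)
  then show ?thesis using goes_area assms(2) by blast
qed

text \<open>The two strips hold the counter in the two possible orientations.\<close>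

definition workspace :: "int \<Rightarrow> int \<Rightarrow> int \<Rightarrow> int \<Rightarrow> nat \<Rightarrow> pixel set" where
  "workspace a b c d L = {a - 4..b + 4} \<times> {c - 4..d + 4} \<union>
     {a - 4 - int L..b + 4} \<times> {c - 4..c} \<union> {a - 4..a} \<times> {c - 4 - int L..d + 4}"

text \<open>The box is interpreted twice, the second time with exchanged coordinates; the part of
  the run after \<open>Flip\<close> takes place in the second one and is reflected back.\<close>

lemma boxed_count:
  fixes a b c d :: int
  assumes bx: "boxed P B a b c d e" and p0: "p0 \<in> B" and L: "card P < 2 ^ L"
    and M: "card P + card B + 2 * L + 3 \<le> M"
  defines "X \<equiv> nat (max (b - a) (d - c))" and "Y \<equiv> nat (min (b - a) (d - c))"
  shows "\<exists>q p T d' e' n. q \<in> UNIV \<times> {Halt} \<and> p \<in> workspace a b c d L \<and> card T \<le> M \<and>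
    binary_counter T p d' e' n (card P) \<and>
    go2 (workspace a b c d L) M ((False, Nav0 False F0), p0, P \<union> B)
      ((5 * card P + X + 2) * (4 * Y + 42) + (L + 2) * (11 * X + 2 * L + 30) + 40 * X + 131) (q, p, T)"
proof -
  interpret b1: boxed_run P B a b c d e L M
    using bx by (rule boxed_run.intro)
  interpret b2: boxed_run "prod.swap ` P" "prod.swap ` B" c d a b e L M
    using boxed_swap[OF bx] by (rule boxed_run.intro)
  note bs = b1.box_size
  let ?A = "workspace a b c d L"
  have A1: "b1.area L \<subseteq> ?A" by (auto simp: b1.area_def workspace_def)
  have A2: "prod.swap ` b2.area L \<subseteq> ?A" by (auto simp: b2.area_def workspace_def)
  have cards: "card (prod.swap ` P) = card P" "card (prod.swap ` B) = card B"
    by (simp_all add: card_image)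
  have fin: "finite (P \<union> B)" using b1.P_finite b1.B_finite by simp
  have card: "card (P \<union> B) \<le> M" using card_Un_le[of P B] M by simp
  have f1: "b1.fits (P \<union> B)" using fin card by (simp add: b1.fits_def)
  have f2: "b2.fits (prod.swap ` P \<union> prod.swap ` B)"
    unfolding b2.fits_def image_Un[symmetric] using fin card by (simp add: card_image)
  have le: "nat (b - a) \<le> X" "nat (d - c) \<le> X" by (auto simp: X_def)
  obtain x0 y0 where p0': "p0 = (x0, y0)" by (cases p0)
  obtain l where l: "b1.start_col l" and g1: "b1.go (Nav0 False F0, p0, P \<union> B)
      (4 * nat (b - a) + 8 * nat (d - c) + 50) (Dia0, (l, c - 1), P \<union> B)"
    using b1.navigate[of x0 y0 False] p0 p0' f1 by auto
  let ?n1 = "4 * nat (b - a) + 8 * nat (d - c) + 50"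
  let ?n2 = "8 * nat (b - a) + 8 * nat (d - c) + 30"
  obtain x y where xy: "(x, y) \<in> B" and
    alt: "b1.go (Dia0, (l, c - 1), P \<union> B) ?n2 (Nav0 True F0, (x, y), P \<union> B) \<and> d - c \<le> b - a \<or>
     b1.go (Dia0, (l, c - 1), P \<union> B) ?n2 (Flip, (x + 1, y), P \<union> B) \<and> b - a \<le> d - c + 4"
    using b1.decide[OF l f1] by blast
  from alt show ?thesis
  proof
    assume *: "b1.go (Dia0, (l, c - 1), P \<union> B) ?n2 (Nav0 True F0, (x, y), P \<union> B) \<and> d - c \<le> b - a"
    obtain l' where l': "b1.start_col l'" and g3: "b1.go (Nav0 True F0, (x, y), P \<union> B) ?n1 (Put0, (l', c - 1), P \<union> B)"
      using b1.navigate[OF xy f1, of True] by auto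
    obtain T n where T: "binary_counter T (l' - 1, c - 2) Left Down n (card P)" "card T \<le> M"
      and g4: "b1.go (Put0, (l', c - 1), P \<union> B) ((5 * card P + nat (b - a) + 2) * (4 * nat (d - c) + 26) +
        (L + 2) * (11 * nat (b - a) + 2 * L + 30)) (Halt, (l' - 1, c - 2), T)"
      using b1.count_from_corner[OF l' L M] by blast
    have "nat (d - c) = Y" "nat (b - a) = X" using * by (auto simp: X_def Y_def)
    then have "?n1 + ?n2 + ?n1 + ((5 * card P + nat (b - a) + 2) * (4 * nat (d - c) + 26) +
        (L + 2) * (11 * nat (b - a) + 2 * L + 30))
      \<le> (5 * card P + X + 2) * (4 * Y + 42) + (L + 2) * (11 * X + 2 * L + 30) + 40 * X + 131"
      using le mult_le_mono2[of "4 * Y + 26" "4 * Y + 42" "5 * card P + X + 2"] by simp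
    from b1.go_mono[OF b1.go_trans[OF b1.go_trans[OF b1.go_trans[OF g1 *[THEN conjunct1]] g3] g4] this]
    have "go2 ?A M ((False, Nav0 False F0), p0, P \<union> B)
      ((5 * card P + X + 2) * (4 * Y + 42) + (L + 2) * (11 * X + 2 * L + 30) + 40 * X + 131)
      ((False, Halt), (l' - 1, c - 2), T)" using A1 by (rule go2_plain)
    moreover have "(l' - 1, c - 2) \<in> ?A"
      using l' bs by (auto simp: b1.start_col_def workspace_def)
    ultimately show ?thesis using T by blast
  next
    assume *: "b1.go (Dia0, (l, c - 1), P \<union> B) ?n2 (Flip, (x + 1, y), P \<union> B) \<and> b - a \<le> d - c + 4"
    have xy': "(y, x) \<in> prod.swap ` B" using xy by force
    let ?P = "prod.swap ` P" and ?B = "prod.swap ` B"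
    let ?n3 = "4 * nat (d - c) + 8 * nat (b - a) + 50"
    let ?n4 = "(5 * card P + nat (d - c) + 2) * (4 * nat (b - a) + 26) + (L + 2) * (11 * nat (d - c) + 2 * L + 30)"
    obtain l' where l': "b2.start_col l'" and g3: "b2.go (Nav0 True F0, (y, x), ?P \<union> ?B) ?n3 (Put0, (l', a - 1), ?P \<union> ?B)"
      using b2.navigate[OF xy' f2, of True] by auto
    obtain T n where T: "binary_counter T (l' - 1, a - 2) Left Down n (card P)" "card T \<le> M"
      and g4: "b2.go (Put0, (l', a - 1), ?P \<union> ?B) ?n4 (Halt, (l' - 1, a - 2), T)"
      using b2.count_from_corner[OF l'] L M cards by auto
    have gA: "go2 ?A M ((False, Nav0 False F0), p0, P \<union> B) (?n1 + ?n2) ((False, Flip), (x + 1, y), P \<union> B)"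
      by (rule go2_plain[OF b1.go_trans[OF g1 *[THEN conjunct1]] A1])
    have "mstep dl2 ((False, Flip), (x + 1, y), P \<union> B) = ((True, Nav0 True F0), (x, y), P \<union> B)"
      by (auto simp: mstep_def dl2_def insert_absorb)
    moreover have "(x + 1, y) \<in> ?A" using b1.B_range[OF xy] by (auto simp: workspace_def)
    ultimately have gB: "go2 ?A M ((False, Flip), (x + 1, y), P \<union> B) (Suc 0) ((True, Nav0 True F0), (x, y), P \<union> B)"
      using fin card by (intro goes_step) (auto intro: goes_refl)
    have ss: "prod.swap ` (?P \<union> ?B) = P \<union> B" by (simp add: image_Un image_image)
    have gC: "go2 ?A M ((True, Nav0 True F0), (x, y), P \<union> B) (?n3 + ?n4) ((True, Halt), (a - 2, l' - 1), prod.swap ` T)"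
      using go2_flipped[OF b2.go_trans[OF g3 g4] A2] unfolding ss by simp
    \<comment> \<open>The slack of \<open>decide\<close> turns 26 into
      \<open>26 + 4 * 4 = 42\<close>.\<close>
    have "nat (b - a) \<le> Y + 4" using * bs by (auto simp: Y_def)
    with le have "(5 * card P + nat (d - c) + 2) * (4 * nat (b - a) + 26) \<le> (5 * card P + X + 2) * (4 * Y + 42)"
      by (intro mult_le_mono; linarith)
    moreover have "(L + 2) * (11 * nat (d - c) + 2 * L + 30) \<le> (L + 2) * (11 * X + 2 * L + 30)"
      using le by (intro mult_le_mono; linarith)
    ultimately have "?n1 + ?n2 + Suc 0 + (?n3 + ?n4)
      \<le> (5 * card P + X + 2) * (4 * Y + 42) + (L + 2) * (11 * X + 2 * L + 30) + 40 * X + 131"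
      using le by linarith
    from goes_mono[OF goes_trans[OF goes_trans[OF gA gB] gC] this]
    have "go2 ?A M ((False, Nav0 False F0), p0, P \<union> B)
      ((5 * card P + X + 2) * (4 * Y + 42) + (L + 2) * (11 * X + 2 * L + 30) + 40 * X + 131)
      ((True, Halt), (a - 2, l' - 1), prod.swap ` T)" .
    moreover have "binary_counter (prod.swap ` T) (a - 2, l' - 1) Down Left n (card P)"
      using binary_counter_swap[OF T(1)] by simp
    moreover have "card (prod.swap ` T) \<le> M" using T(2) by (simp add: card_image)
    moreover have "(a - 2, l' - 1) \<in> ?A"
      using l' bs by (auto simp: b2.start_col_def workspace_def)
    ultimately show ?thesis by blast
  qed
qed

section \<open>Bounds\<close>

context boxed
begin

text \<open>Absorbs the cost of columns with few tiles into the term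
  \<open>N min(w,h)\<close>.\<close>

lemma width_le_card: "width P \<le> card P"
proof -
  have "1 \<le> colh u" if "u \<in> {xmin P..xmax P}" for u
    using P_column[of u] that finite_column[of u] by (auto simp: colh_def Suc_le_eq card_gt_0_iff)
  then have "(\<Sum>u = xmin P..xmax P. 1) \<le> (\<Sum>u = xmin P..xmax P. colh u)" by (rule sum_mono)
  then show ?thesis using sum_colh[of "xmin P" "xmax P"] by (simp add: width_def)
qed

end

lemma height_swap: "width (prod.swap ` P) = height P"
  by (simp add: width_def height_def xmin_def xmax_def ymin_def ymax_def image_image)

lemma card_le_area:
  assumes "finite P" "P \<noteq> {}"
  shows "card P \<le> width P * height P" "1 \<le> width P" "1 \<le> height P"
proof -
  have "p \<in> bounding_rectangle P" if "p \<in> P" for p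
  proof -
    have "fst p \<in> fst ` P" "snd p \<in> snd ` P" using that by auto
    then have "fst p \<in> {xmin P..xmax P}" "snd p \<in> {ymin P..ymax P}"
      unfolding xmin_def xmax_def ymin_def ymax_def using assms(1) by auto
    then show ?thesis unfolding bounding_rectangle_def by (cases p) auto
  qed
  then have "P \<subseteq> bounding_rectangle P" by blast
  then have "card P \<le> card (bounding_rectangle P)"
    by (intro card_mono) (auto simp: bounding_rectangle_def)
  then show "card P \<le> width P * height P"
    by (simp add: bounding_rectangle_def card_cartesian_product width_def height_def)
  then show "1 \<le> width P" "1 \<le> height P" using assms by (auto simp: Suc_le_eq card_gt_0_iff intro!: gr0I)
qed

text \<open>\<open>q\<close> is twice the distance \<open>k\<close> of the inner lane plus a margin
  of four pixels on each side.\<close>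

lemma workspace_card:
  fixes a b c d :: int and q L w h :: nat
  assumes wh: "int w = r2 - r1 + 1" "int h = s2 - s1 + 1"
    and ab: "r1 - a \<le> int k" "b - r2 \<le> int k" "s1 - c \<le> int k" "d - s2 \<le> int k"
    and in_box: "a \<le> r1" "r2 \<le> b" "c \<le> s1" "s2 \<le> d" "1 \<le> w" "1 \<le> h"
  defines "q \<equiv> 2 * k + 8"
  shows "finite (workspace a b c d L)"
    and "card (workspace a b c d L - {r1..r2} \<times> {s1..s2}) \<le> q * (w + h) + q * q + 5 * (w + q + L) + 5 * (h + q + L)"
proof -
  let ?B = "{a - 4..b + 4} \<times> {c - 4..d + 4}" and ?R = "{r1..r2} \<times> {s1..s2}"
  let ?S1 = "{a - 4 - int L..b + 4} \<times> {c - 4..c}" and ?S2 = "{a - 4..a} \<times> {c - 4 - int L..d + 4}"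
  show "finite (workspace a b c d L)" by (simp add: workspace_def)
  have "?R \<subseteq> ?B" using in_box by auto
  then have "card (?B - ?R) = card ?B - card ?R" by (intro card_Diff_subset) auto
  moreover have "card ?R = w * h" using wh by (simp add: card_cartesian_product flip: wh)
  moreover have "card ?B \<le> (w + q) * (h + q)"
    unfolding card_cartesian_product using ab wh in_box by (intro mult_le_mono) (auto simp: q_def)
  moreover have "(w + q) * (h + q) = w * h + (q * (w + h) + q * q)" by (simp add: algebra_simps)
  ultimately have 1: "card (?B - ?R) \<le> q * (w + h) + q * q" by linarith
  have "card ?S1 \<le> (w + q + L) * 5"
    unfolding card_cartesian_product using ab wh in_box by (intro mult_le_mono) (auto simp: q_def)
  moreover have "card ?S2 \<le> 5 * (h + q + L)"
    unfolding card_cartesian_product using ab wh in_box by (intro mult_le_mono) (auto simp: q_def)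
  moreover have "workspace a b c d L - ?R \<subseteq> (?B - ?R) \<union> ?S1 \<union> ?S2" by (auto simp: workspace_def)
  then have "card (workspace a b c d L - ?R) \<le> card ((?B - ?R) \<union> ?S1 \<union> ?S2)" by (intro card_mono) auto
  moreover have "card ((?B - ?R) \<union> ?S1 \<union> ?S2) \<le> card (?B - ?R) + card ?S1 + card ?S2"
    by (meson card_Un_le add_le_mono1 le_trans)
  ultimately show "card (workspace a b c d L - ?R) \<le> q * (w + h) + q * q + 5 * (w + q + L) + 5 * (h + q + L)"
    using 1 by linarith
qed

section \<open>The robot\<close>

definition make_robot :: "((bool \<times> label) \<Rightarrow> nat) \<Rightarrow> robot" where
  "make_robot f = \<lparr>states = range f, start = f (False, Nav0 False F0), halting = f ` (UNIV \<times> {Halt}),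
     delta = (\<lambda>n b. case dl2 (inv f n) b of (q, c, d) \<Rightarrow> (f q, c, d))\<rparr>"

lemma finite_automaton_make_robot: "finite_automaton (make_robot f)"
proof -
  have "finite (UNIV :: (bool \<times> label) set)" using finite_label by (simp add: finite_Prod_UNIV)
  then show ?thesis
    by (auto simp: finite_automaton_def make_robot_def split: prod.split)
qed

lemma run_make_robot:
  assumes "inj f"
  shows "run (make_robot f) (initial (make_robot f) p T) t =
    (case (mstep dl2 ^^ t) ((False, Nav0 False F0), p, T) of (q, p', T') \<Rightarrow>
      \<lparr>state = f q, pos = p', tiles = T'\<rparr>)"
proof (induction t)
  case 0
  show ?case by (simp add: run_def initial_def make_robot_def)
next
  case (Suc t)
  then show ?case
    using assms by (simp add: run_def step_def make_robot_def mstep_def split: prod.split)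
qed

text \<open>Lower-order terms are absorbed by \<open>N * m\<close>, since \<open>x \<le> N\<close>
  and \<open>1 \<le> m\<close>; this also covers \<open>N = 1\<close>, where the logarithm vanishes.
  The bound \<open>L \<le> 3 * x\<close> makes the cost of a pass linear in
  \<open>x\<close>.\<close>

lemma steps_arith:
  fixes N w h L k X Y :: nat and l :: real
  assumes "1 \<le> w" "1 \<le> h" "w \<le> N" "h \<le> N" "real L \<le> l + 1" "0 \<le> l" "L \<le> 3 * max w h"
    and "X \<le> max w h + 2 * k" "Y \<le> min w h + 2 * k"
  shows "real ((5 * N + X + 2) * (4 * Y + 42) + (L + 2) * (11 * X + 2 * L + 30) + 40 * X + 131)
    \<le> real ((2 * k + 8) * (8 * k + 46) + 3 * (22 * k + 47) + (80 * k + 171)) *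
       (real (max w h) * l + real N * real (min w h))"
proof -
  define x m where "x = max w h" and "m = min w h"
  have x1: "1 \<le> x" "1 \<le> m" "x \<le> N" "m \<le> x" using assms by (auto simp: x_def m_def)
  have kx: "k \<le> k * x" "k \<le> k * m" "k \<le> k * N" using x1 assms by auto
  have xN: "x \<le> N * m" using x1 by (metis mult.right_neutral mult_le_mono)
  have X: "X \<le> x + 2 * k" and Y: "Y \<le> m + 2 * k" and L: "L \<le> 3 * x" using assms by (auto simp: x_def m_def)
  have "(5 * N + X + 2) * (4 * Y + 42) \<le> ((2 * k + 8) * N) * ((8 * k + 46) * m)"
  proof (rule mult_le_mono)
    have "(2 * k + 8) * N = 2 * (k * N) + 8 * N" by (simp add: algebra_simps)
    then show "5 * N + X + 2 \<le> (2 * k + 8) * N"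
      using X x1 kx by linarith
    have "(8 * k + 46) * m = 8 * (k * m) + 46 * m" by (simp add: algebra_simps)
    then show "4 * Y + 42 \<le> (8 * k + 46) * m"
      using Y x1 kx by linarith
  qed
  then have 1: "real ((5 * N + X + 2) * (4 * Y + 42)) \<le> real ((2 * k + 8) * (8 * k + 46)) * real (N * m)"
    by (simp only: of_nat_mult[symmetric] of_nat_le_iff) (simp only: ac_simps)
  have "(22 * k + 47) * x = 22 * (k * x) + 47 * x" by (simp add: algebra_simps)
  then have "11 * X + 2 * L + 30 \<le> (22 * k + 47) * x"
    using X L x1 kx by linarith
  then have "real (L + 2) * real (11 * X + 2 * L + 30) \<le> (l + 3) * real ((22 * k + 47) * x)"
    using assms(5,6) by (intro mult_mono) (auto simp del: of_nat_add of_nat_mult simp: of_nat_add[of L 2])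
  also have "\<dots> = real (22 * k + 47) * (real x * l) + 3 * (real (22 * k + 47) * real x)"
    by (simp add: algebra_simps)
  also have "\<dots> \<le> real (22 * k + 47) * (real x * l) + 3 * (real (22 * k + 47) * real (N * m))"
    using xN by (intro add_mono mult_left_mono order_refl) (auto simp del: of_nat_mult)
  finally have 2: "real ((L + 2) * (11 * X + 2 * L + 30)) \<le>
    real (22 * k + 47) * (real x * l) + 3 * (real (22 * k + 47) * real (N * m))"
    unfolding of_nat_mult[of "L + 2" "11 * X + 2 * L + 30"] .
  have "(80 * k + 171) * x = 80 * (k * x) + 171 * x" by (simp add: algebra_simps)
  then have "40 * X + 131 \<le> (80 * k + 171) * x"
    using X x1 kx by linarith
  also have "\<dots> \<le> (80 * k + 171) * (N * m)" using xN by (intro mult_le_mono) auto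
  finally have 3: "real (40 * X + 131) \<le> real (80 * k + 171) * real (N * m)"
    by (simp only: of_nat_mult[symmetric] of_nat_le_iff)
  let ?C1 = "real ((2 * k + 8) * (8 * k + 46))" and ?C2 = "real (22 * k + 47)" and ?C3 = "real (80 * k + 171)"
  have C: "real ((2 * k + 8) * (8 * k + 46) + 3 * (22 * k + 47) + (80 * k + 171)) = ?C1 + 3 * ?C2 + ?C3"
    by (simp only: of_nat_add of_nat_mult of_nat_numeral)
  have "0 \<le> (?C1 + 2 * ?C2 + ?C3) * (real x * l)" using assms(6) by simp
  then have "?C2 * (real x * l) \<le> (?C1 + 3 * ?C2 + ?C3) * (real x * l)"
    by (simp only: distrib_right mult.assoc)
  moreover have "?C1 * real (N * m) + 3 * (?C2 * real (N * m)) + ?C3 * real (N * m) = (?C1 + 3 * ?C2 + ?C3) * real (N * m)"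
    by (simp only: distrib_right mult.assoc)
  ultimately show ?thesis
    using 1 2 3 unfolding C x_def[symmetric] m_def[symmetric] of_nat_mult[symmetric, of N m]
    by (simp only: of_nat_add[of "_ + _"] of_nat_add[of "_ * _"] distrib_left)
qed

theorem theorem2:
  shows "\<exists>R. finite_automaton R \<and>
    (\<forall>k. \<exists>C::real. \<forall>P B p0.
       polyomino P \<longrightarrow> bounding_box k P B \<longrightarrow> p0 \<in> B \<longrightarrow>
       (let w = width P; h = height P; N = card P; s = initial R p0 (P \<union> B) in
        \<exists>t. halts_at R s t \<and>
            (\<exists>d e n. binary_counter (tiles (run R s t)) (pos (run R s t)) d e n N) \<and>
            real t \<le> C * (real (max w h) * log 2 (real N) + real N * real (min w h)) \<and>
            real (additional_space R s t P) \<le> C * real (max w h) \<and>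
            (N \<ge> 2 \<longrightarrow>
               real (max_tiles R s t) - real (card P + card B) \<le> C * log 2 (real N))))"
proof -
  have "finite (UNIV :: (bool \<times> label) set)" using finite_label by (simp add: finite_Prod_UNIV)
  then obtain f :: "(bool \<times> label) \<Rightarrow> nat" where f: "inj f"
    using finite_imp_inj_to_nat_seg[of "UNIV :: (bool \<times> label) set"] by blast
  let ?R = "make_robot f"
  show ?thesis
  proof (intro exI[of _ ?R] conjI finite_automaton_make_robot allI)
    fix k :: nat
    define C1 where "C1 = (2 * k + 8) * (8 * k + 46) + 3 * (22 * k + 47) + (80 * k + 171)"
    define q where "q = 2 * k + 8"
    define C2 where "C2 = q * 2 + q * q + 10 * (q + 4)"
    \<comment> \<open>The summand 7 is for the tiles: if \<open>N \<ge> 2\<close>, then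
      \<open>l \<ge> 1\<close> and \<open>2 * L + 3 \<le> 2 * l + 5 \<le> 7 * l\<close>.\<close>
    define C where "C = real C1 + real C2 + 7"
    show "\<exists>C::real. \<forall>P B p0.
       polyomino P \<longrightarrow> bounding_box k P B \<longrightarrow> p0 \<in> B \<longrightarrow>
       (let w = width P; h = height P; N = card P; s = initial ?R p0 (P \<union> B) in
        \<exists>t. halts_at ?R s t \<and>
            (\<exists>d e n. binary_counter (tiles (run ?R s t)) (pos (run ?R s t)) d e n N) \<and>
            real t \<le> C * (real (max w h) * log 2 (real N) + real N * real (min w h)) \<and>
            real (additional_space ?R s t P) \<le> C * real (max w h) \<and>
            (N \<ge> 2 \<longrightarrow>
               real (max_tiles ?R s t) - real (card P + card B) \<le> C * log 2 (real N)))"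
    proof (intro exI[of _ C] allI impI)
      fix P B p0 assume P: "polyomino P" and bb: "bounding_box k P B" and p0: "p0 \<in> B"
      define w h N where "w = width P" and "h = height P" and "N = card P"
      define s where "s = initial ?R p0 (P \<union> B)"
      define l where "l = log 2 (real N)"
      define L where "L = nat \<lfloor>l\<rfloor> + 1"
      \<comment> \<open>\<open>2 * L\<close> for the digits, one for the first base tile, and two
        for temporary tiles during compacting.\<close>
      define M where "M = card P + card B + 2 * L + 3"
      obtain a b c d e where bx: "boxed P B a b c d e" and sl: "xmin P - a \<le> int k" "b - xmax P \<le> int k"
        "ymin P - c \<le> int k" "d - ymax P \<le> int k"
        using boxed_of_bounding_box[OF P bb] by blast
      interpret b1: boxed P B a b c d e by (rule bx)
      interpret b2: boxed "prod.swap ` P" "prod.swap ` B" c d a b e by (rule boxed_swap[OF bx])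
      have fin: "finite P" "P \<noteq> {}" by (rule b1.P_finite, rule b1.P_ne)
      note area = card_le_area[OF fin, folded w_def h_def N_def]
      have wN: "w \<le> N" using b1.width_le_card by (simp add: w_def N_def)
      have hN: "h \<le> N" using b2.width_le_card by (simp add: h_def N_def height_swap card_image)
      have N1: "1 \<le> N" using area wN by simp
      have l0: "0 \<le> l" using N1 by (simp add: l_def)
      have Ll: "real L \<le> l + 1" using l0 by (simp add: L_def)
      have NL: "N < 2 ^ L"
      proof -
        have "l < real L" using l0 by (simp add: L_def) linarith
        then have "real N < 2 powr real L" using N1 by (simp add: l_def log_less_iff)
        then show ?thesis by (simp add: powr_realpow)
      qed
      \<comment> \<open>\<open>N\<close> is at most the area of the bounding rectangle, hence below
        \<open>2 ^ (2 * x)\<close>, so the counter fits into space linear in the longer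
        side.\<close>
      have Lx: "L \<le> 3 * max w h"
      proof -
        define x where "x = max w h"
        have x1: "1 \<le> x" using area by (simp add: x_def)
        have "N \<le> x * x" using area(1) by (rule le_trans) (simp add: x_def mult_le_mono)
        also have "\<dots> < 2 ^ x * 2 ^ x" by (intro mult_strict_mono) (auto simp: less_exp)
        finally have "N < 2 ^ (2 * x)" by (simp add: mult_2 power_add)
        then have "real N < 2 powr real (2 * x)" by (simp only: powr_realpow) (metis of_nat_less_iff of_nat_numeral of_nat_power powr_realpow zero_less_numeral)
        then have "l < real (2 * x)" using N1 by (simp only: l_def log_less_iff)
        then have "real L < 2 * real x + 1" using Ll by simp
        then show ?thesis using x1 unfolding x_def[symmetric] by linarith
      qed
      define X Y where "X = nat (max (b - a) (d - c))" and "Y = nat (min (b - a) (d - c))"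
      have rng: "xmin P \<le> xmax P" "ymin P \<le> ymax P" "int w = xmax P - xmin P + 1" "int h = ymax P - ymin P + 1"
        using area(2,3) by (auto simp: w_def h_def width_def height_def)
      have ins: "a + 2 \<le> xmin P" "xmax P \<le> b - 2" "c + 2 \<le> ymin P" "ymax P \<le> d - 2"
        using b1.x_bounds b2.x_bounds by (auto simp: xmin_def xmax_def ymin_def ymax_def image_image)
      have XY: "X \<le> max w h + 2 * k" "Y \<le> min w h + 2 * k"
        using sl rng by (auto simp: X_def Y_def)
      define n where "n = (5 * N + X + 2) * (4 * Y + 42) + (L + 2) * (11 * X + 2 * L + 30) + 40 * X + 131"
      let ?A = "workspace a b c d L"
      obtain qf p T d' e' m where fin': "qf \<in> UNIV \<times> {Halt}" "p \<in> ?A" "card T \<le> M"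
        "binary_counter T p d' e' m N"
        and g: "go2 ?A M ((False, Nav0 False F0), p0, P \<union> B) n (qf, p, T)"
        using boxed_count[OF bx p0, of L M] NL unfolding N_def M_def n_def X_def Y_def by blast
      define cf where "cf i = (mstep dl2 ^^ i) ((False, Nav0 False F0), p0, P \<union> B)" for i
      obtain t where t: "t \<le> n" "cf t = (qf, p, T)"
        "\<And>i. i < t \<Longrightarrow> fst (cf i) \<notin> UNIV \<times> {Halt} \<and> fst (snd (cf i)) \<in> ?A \<and> card (snd (snd (cf i))) \<le> M"
        using goes_run[OF g] unfolding cf_def by blast
      have run: "run ?R s i = \<lparr>state = f (fst (cf i)), pos = fst (snd (cf i)), tiles = snd (snd (cf i))\<rparr>" for i
        unfolding s_def run_make_robot[OF f] cf_def by (simp split: prod.split)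
      have all: "fst (snd (cf i)) \<in> ?A \<and> card (snd (snd (cf i))) \<le> M" if "i \<le> t" for i
        using t fin' that by (cases "i = t") auto
      have halt: "halts_at ?R s t"
        unfolding halts_at_def run using t fin' f
        by (auto simp: make_robot_def inj_image_mem_iff)
      have steps: "real t \<le> C * (real (max w h) * l + real N * real (min w h))"
      proof -
        have "real t \<le> real n" using t by simp
        also have "\<dots> \<le> real C1 * (real (max w h) * l + real N * real (min w h))"
          unfolding n_def C1_def by (rule steps_arith) (use area wN hN Ll l0 Lx XY in auto)
        also have "\<dots> \<le> C * (real (max w h) * l + real N * real (min w h))"
          using l0 by (intro mult_right_mono) (auto simp: C_def)
        finally show ?thesis .
      qed
      have space: "real (additional_space ?R s t P) \<le> C * real (max w h)"
      proof -
        have "visited ?R s t \<subseteq> ?A" unfolding visited_def run using all by auto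
        then have "additional_space ?R s t P \<le> card (?A - bounding_rectangle P)"
          unfolding additional_space_def using workspace_card(1)[OF rng(3,4) sl] ins area
          by (intro card_mono) auto
        also have "\<dots> \<le> q * (w + h) + q * q + 5 * (w + q + L) + 5 * (h + q + L)"
          unfolding bounding_rectangle_def q_def
          by (rule workspace_card(2)) (use rng sl ins area in auto)
        also have "\<dots> \<le> C2 * max w h"
        proof -
          define x where "x = max w h"
          have x: "1 \<le> x" "w \<le> x" "h \<le> x" "L \<le> 3 * x" using area Lx by (auto simp: x_def)
          have "q * (w + h) \<le> q * (2 * x)" using x by (intro mult_le_mono) auto
          moreover have "q * q \<le> q * q * x" using x by simp
          moreover have "q \<le> q * x" using x by simp
          moreover have "C2 * x = q * (2 * x) + q * q * x + 10 * (q * x) + 40 * x"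
            by (simp add: C2_def algebra_simps)
          moreover have "u + v + 5 * (w + q + L) + 5 * (h + q + L) \<le> u' + v' + 10 * z + 40 * x"
            if "u \<le> u'" "v \<le> v'" "q \<le> z" for u v u' v' z
            unfolding distrib_left using that x by linarith
          ultimately show ?thesis unfolding x_def[symmetric] by metis
        qed
        finally have "real (additional_space ?R s t P) \<le> real C2 * real (max w h)"
          by (simp only: of_nat_mult[symmetric] of_nat_le_iff)
        also have "\<dots> \<le> C * real (max w h)" by (intro mult_right_mono) (auto simp: C_def)
        finally show ?thesis .
      qed
      have tls: "real (max_tiles ?R s t) - real (card P + card B) \<le> C * l" if "N \<ge> 2"
      proof -
        have "max_tiles ?R s t \<le> M" unfolding max_tiles_def run using all by auto
        then have "real (max_tiles ?R s t) \<le> real (card P + card B) + 2 * real L + 3"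
          unfolding M_def by linarith
        moreover have "1 \<le> l" using that by (simp add: l_def le_log_iff)
        moreover have "7 * l \<le> C * l" using l0 by (intro mult_right_mono) (auto simp: C_def)
        ultimately show ?thesis using Ll by linarith
      qed
      have "binary_counter (tiles (run ?R s t)) (pos (run ?R s t)) d' e' m N"
        unfolding run t(2) using fin'(4) by simp
      then show "let w = width P; h = height P; N = card P; s = initial ?R p0 (P \<union> B) in
        \<exists>t. halts_at ?R s t \<and>
            (\<exists>d e n. binary_counter (tiles (run ?R s t)) (pos (run ?R s t)) d e n N) \<and>
            real t \<le> C * (real (max w h) * log 2 (real N) + real N * real (min w h)) \<and>
            real (additional_space ?R s t P) \<le> C * real (max w h) \<and>
            (N \<ge> 2 \<longrightarrow>
               real (max_tiles ?R s t) - real (card P + card B) \<le> C * log 2 (real N))"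
        unfolding Let_def w_def[symmetric] h_def[symmetric] N_def[symmetric] s_def[symmetric] l_def[symmetric]
        using halt steps space tls unfolding N_def[symmetric] by blast
    qed
  qed
qed

end
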